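(* Let $0<\Delta<\frac16$ and suppose there is a constant $A(\Delta)>0$ such that for all sufficiently large $t$ and all real $a,b$ with $0<a\le b\le 2a$ and $b\le\sqrt{t/(2\pi)}$, $$\Big|\sum_{a\le n<b} n^{it}\Big|<A(\Delta)\sqrt{a}\,t^{\Delta}.$$ Let $\psi(T)$ be any positive function with $\psi(T)\to\infty$ as $T\to\infty$. Then for all sufficiently large $T$, the interval $(T,T+T^{\Delta}\psi(T))$ contains a root of odd order of the equation $Z'(t)=0$ (equivalently, a point of local maximum or local minimum of $Z(t)$).
   Context: $\zeta$ is the Riemann zeta-function. For real $t>0$, $\vartheta(t)=-\frac t2\ln\pi+\operatorname{Im}\ln\Gamma\left(\frac14+\frac12 it\right)$ (so $\vartheta(t)=\frac t2\ln\frac t{2\pi}-\frac t2-\frac\pi8+O(1/t)$), and $Z(t)=e^{i\vartheta(t)}\zeta\left(\frac12+it\right)$, which is a real-valued real-analytic function of real $t$. The sums over $n$ run over positive integers. A root of odd order of $Z'(t)=0$ is a real zero of $Z'$ of odd multiplicity. *)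

theory Defs
  imports "HOL-Analysis.Analysis"
begin

text \<open>Riemann zeta on the critical line via the Dirichlet eta function:
  for Re s > 0, s not a zero of 1 - 2^(1-s),
  zeta s = (sum_{n>=1} (-1)^(n-1) n^(-s)) / (1 - 2^(1-s)).
  On Re s = 1/2 the denominator never vanishes.\<close>
definition zeta_crit :: "real \<Rightarrow> complex" where
  "zeta_crit t = (let s = Complex (1/2) t in
     (\<Sum>n. (-1) ^ n * (of_nat (Suc n)) powr (- s)) / (1 - 2 powr (1 - s)))"

text \<open>Riemann--Siegel theta function (ln_Gamma is the standard holomorphic log-Gamma).\<close>
definition rs_theta :: "real \<Rightarrow> real" where
  "rs_theta t = - (t / 2) * ln pi + Im (ln_Gamma (Complex (1/4) (t / 2)))"

text \<open>Hardy's Z-function (real-valued; we take the real part).\<close>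
definition hardy_Z :: "real \<Rightarrow> real" where
  "hardy_Z t = Re (exp (\<i> * of_real (rs_theta t)) * zeta_crit t)"

definition odd_order_zero :: "(real \<Rightarrow> real) \<Rightarrow> real \<Rightarrow> bool" where
  "odd_order_zero f x \<longleftrightarrow>
     (\<exists>k. odd k \<and> (\<forall>j<k. (deriv ^^ j) f x = 0) \<and> (deriv ^^ k) f x \<noteq> 0)"

end

theory Submission
  imports Defs "HOL-Complex_Analysis.Complex_Analysis" "HOL-Probability.Probability" "HOL-Real_Asymp.Real_Asymp"
begin

text \<open>
  Suppose \<open>Z'\<close> has no zero of odd order on an interval of length \<open>H = k h\<close> after \<open>T\<close>, where \<open>h = c T\<^sup>\<Delta>\<close>.
  Then \<open>Z\<close> is monotone there, so the integral of \<open>\<bar>Z'\<bar>\<close> over any subinterval of length \<open>h\<close> is at most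
  twice the maximum of \<open>\<bar>Z\<bar>\<close>. The hypothesis bounds that maximum by a multiple of \<open>T\<^sup>\<Delta> ln T\<close>, because
  \<open>\<bar>zeta(1/2 + \<i>t)\<bar>\<close> is at most twice the modulus of its Dirichlet sum up to \<open>sqrt(t / 2\<pi>)\<close>, plus a constant.
  This last fact comes from rotating the Mellin integral of the theta function almost onto the imaginary axis,
  where theta inversion makes one half of it the conjugate of the other.

  On the other hand, with \<open>P = 1 - 2\<^sup>1\<^sup>-\<^sup>s\<close> the function \<open>exp(-\<i>\<theta>) Z' P\<^sup>2\<close> is up to a small error a finite sum
  of waves \<open>exp(-\<i>lt)\<close>. Its constant term is \<open>\<i>\<theta>'(T)\<close>, of size about \<open>(ln T) / 2\<close>, and its other
  frequencies are at least \<open>ln 2\<close>. Averaging \<open>k\<close> times over windows of length \<open>h\<close> damps the latter by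
  \<open>(4 / h)\<^sup>k\<close>, which for large \<open>k\<close> beats the number of terms. Hence \<open>(ln T) / 2\<close> is at most
  \<open>O(T\<^sup>\<Delta> ln T / h) + o(ln T)\<close>, which fails for large \<open>c\<close>.
\<close>

section \<open>The alternating zeta series\<close>

text \<open>On the critical line the Dirichlet series of zeta diverges, so the waves come from the
  alternating series \<open>eta\<close>, whose tail after M terms is O(t M^(-1/2)). About T^4 terms
  make this O(1/T). The coefficients of the resulting waves then add up to about T^8, which is why k
  is about 9 / \<Delta>: the damping \<open>(4 / h) ^ k\<close> becomes T^(-9). The hypothesis
  reaches only up to sqrt(t / 2 pi), so a bound for Z needs a Dirichlet sum that stops there, with
  an error O(1) and no logarithm. Theta converges only in the open right half plane; therefore the
  rotation stops at the angle 1 / t before the imaginary axis, which changes exp(-t \<phi> / 2) by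
  the factor exp(1/2) only. There the n-th Gamma integral, with c = pi n^2, is cut at modulus 1,
  while its saddle point is at modulus t / (2 c). For c > t / 2 the part beyond the cut is small,
  for c < t / 2 the part before it; each case has its own path.\<close>

lemma norm_powr_diff_le:
  fixes x y :: real and s :: complex
  assumes "0 < x" "x \<le> y" "Re s > 0"
  shows "norm (of_real x powr (-s) - of_real y powr (-s))
           \<le> norm s / Re s * (x powr (- Re s) - y powr (- Re s))"
proof (cases "x = y")
  case False
  with assms have xy: "x < y" by simp
  define \<sigma> where "\<sigma> = Re s"
  \<comment> \<open>The majorant is a primitive of \<open>norm s * u powr (-\<sigma>-1)\<close>. A
    bound by a difference of values of one real function telescopes over consecutive
    integers.\<close>
  have "norm (of_real y powr (-s) - of_real x powr (-s))
          \<le> (- (norm s / \<sigma>) * y powr (-\<sigma>)) - (- (norm s / \<sigma>) * x powr (-\<sigma>))"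
  proof (rule differentiable_bound_general[OF xy])
    show "continuous_on {x..y} (\<lambda>u. of_real u powr (-s))"
      using assms by (intro continuous_intros) auto
    show "continuous_on {x..y} (\<lambda>u. - (norm s / \<sigma>) * u powr (-\<sigma>))"
      using assms by (intro continuous_intros) auto
    fix u assume u: "x < u" "u < y"
    hence u0: "u > 0" using assms by auto
    show "((\<lambda>u. of_real u powr (-s)) has_vector_derivative (-s * of_real u powr (-s - 1))) (at u)"
      using u0 by (auto intro!: derivative_eq_intros has_vector_derivative_real_field simp: complex_nonpos_Reals_iff)
    show "((\<lambda>u. - (norm s / \<sigma>) * u powr (-\<sigma>)) has_vector_derivative norm s * u powr (-\<sigma>-1)) (at u)"
      using u0 assms(3) unfolding has_real_derivative_iff_has_vector_derivative[symmetric]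
      by (auto intro!: derivative_eq_intros simp: \<sigma>_def)
    show "norm (-s * of_real u powr (-s - 1)) \<le> norm s * u powr (-\<sigma>-1)"
      using u0 by (simp add: norm_mult norm_powr_real_powr \<sigma>_def)
  qed
  thus ?thesis by (simp add: norm_minus_commute \<sigma>_def algebra_simps)
qed auto

text \<open>The Dirichlet eta function, with shifted index: \<open>eta_term s n\<close> belongs to
  the integer \<open>Suc n\<close>.\<close>

definition eta_term :: "complex \<Rightarrow> nat \<Rightarrow> complex" where
  "eta_term s n = (-1) ^ n * of_nat (Suc n) powr (-s)"

definition eta :: "complex \<Rightarrow> complex" where
  "eta s = (\<Sum>n. eta_term s n)"

text \<open>Twice a block equals the signed sum of the differences of neighbours plus two end terms,
  and the differences telescope by \<open>norm_powr_diff_le\<close>. The bound does not depend on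
  m', so it gives convergence for Re s > 0 as well as the size of the tail.\<close>

lemma norm_sum_eta_term_le:
  assumes "Re s > 0" "m \<le> m'"
  shows "norm (\<Sum>n=m..<m'. eta_term s n) \<le> (1 + norm s / Re s) * real (Suc m) powr (- Re s)"
proof -
  define b where "b n = (of_real (real (Suc n)) :: complex) powr (-s)" for n
  define r where "r n = real (Suc n) powr (- Re s)" for n
  define K where "K = norm s / Re s"
  have K: "K \<ge> 0" using assms by (simp add: K_def)
  have eb: "eta_term s n = (-1)^n * b n" for n by (simp add: eta_term_def b_def)
  have nb: "norm (eta_term s n) = r n" for n
    by (simp only: eb norm_mult norm_power b_def r_def) (simp add: norm_powr_real_powr)
  have d: "norm (b n - b (Suc n)) \<le> K * (r n - r (Suc n))" for n
    unfolding b_def r_def K_def using assms by (intro norm_powr_diff_le) auto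
  have "2 * (\<Sum>n=m..<m'. eta_term s n)
     = (\<Sum>n=m..<m'. (-1)^n * (b n - b (Suc n))) + (\<Sum>n=m..<m'. eta_term s n - eta_term s (Suc n))"
    unfolding sum.distrib[symmetric] sum_distrib_left
    by (intro sum.cong) (auto simp: eb algebra_simps)
  also have "(\<Sum>n=m..<m'. eta_term s n - eta_term s (Suc n)) = eta_term s m - eta_term s m'"
    using sum_Suc_diff'[OF assms(2), of "\<lambda>n. - eta_term s n"] by (simp add: algebra_simps sum_subtractf)
  finally have "norm (2 * (\<Sum>n=m..<m'. eta_term s n))
      \<le> norm (\<Sum>n=m..<m'. (-1)^n * (b n - b (Suc n))) + norm (eta_term s m) + norm (eta_term s m')"
    using norm_triangle_ineq norm_triangle_ineq4 by (smt (verit))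
  also have "norm (\<Sum>n=m..<m'. (-1)^n * (b n - b (Suc n))) \<le> (\<Sum>n=m..<m'. K * (r n - r (Suc n)))"
    by (rule order.trans[OF norm_sum sum_mono]) (use d in \<open>simp add: norm_mult norm_power\<close>)
  also have "\<dots> = K * (r m - r m')"
    using sum_Suc_diff'[OF assms(2), of "\<lambda>n. - r n"] by (simp flip: sum_distrib_left)
  finally have "2 * norm (\<Sum>n=m..<m'. eta_term s n) \<le> K * (r m - r m') + r m + r m'"
    by (simp add: norm_mult nb)
  moreover have "r m' \<le> r m" using assms unfolding r_def by (intro powr_mono2') auto
  moreover have "K * (r m - r m') \<le> K * r m" using K by (intro mult_left_mono) (auto simp: r_def)
  moreover have "0 \<le> K * r m" using K by (auto simp: r_def)
  ultimately show ?thesis by (simp add: K_def r_def algebra_simps)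
qed

lemma powr_neg_tendsto_0:
  assumes "(\<sigma>::real) > 0" shows "(\<lambda>m. real (Suc m) powr (-\<sigma>)) \<longlonglongrightarrow> 0"
  using assms by real_asymp

lemma summable_eta_term:
  assumes "Re s > 0" shows "summable (eta_term s)"
  unfolding summable_Cauchy
proof (intro allI impI)
  fix e :: real assume e: "e > 0"
  have "(\<lambda>m. (1 + norm s / Re s) * real (Suc m) powr (- Re s)) \<longlonglongrightarrow> (1 + norm s / Re s) * 0"
    by (intro tendsto_intros powr_neg_tendsto_0 assms)
  hence "\<forall>\<^sub>F m in sequentially. (1 + norm s / Re s) * real (Suc m) powr (- Re s) < e"
    using e by (intro order_tendstoD) auto
  then obtain N where N: "\<And>m. m \<ge> N \<Longrightarrow> (1 + norm s / Re s) * real (Suc m) powr (- Re s) < e"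
    by (auto simp: eventually_sequentially)
  have "norm (sum (eta_term s) {m..<n}) < e" if "m \<ge> N" for m n
  proof (cases "m \<le> n")
    case True
    from norm_sum_eta_term_le[OF assms True] N[OF that] show ?thesis by simp
  qed (use e in auto)
  thus "\<exists>N. \<forall>m\<ge>N. \<forall>n. norm (sum (eta_term s) {m..<n}) < e" by blast
qed

lemma norm_eta_diff_le:
  assumes "Re s > 0"
  shows "norm (eta s - (\<Sum>n<m. eta_term s n)) \<le> (1 + norm s / Re s) * real (Suc m) powr (- Re s)"
proof (rule LIMSEQ_le_const2)
  show "(\<lambda>n. norm (sum (eta_term s) {..<n} - (\<Sum>n<m. eta_term s n))) \<longlonglongrightarrow> norm (eta s - (\<Sum>n<m. eta_term s n))"
    unfolding eta_def by (intro tendsto_intros summable_LIMSEQ summable_eta_term assms)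
  have "norm (sum (eta_term s) {..<n} - (\<Sum>n<m. eta_term s n)) \<le> (1 + norm s / Re s) * real (Suc m) powr (- Re s)"
    if "n \<ge> m" for n
  proof -
    have "sum (eta_term s) {..<n} = (\<Sum>n<m. eta_term s n) + (\<Sum>n=m..<n. eta_term s n)"
      using that by (metis atLeast0LessThan sum.atLeastLessThan_concat zero_le)
    thus ?thesis using norm_sum_eta_term_le[OF assms that] by simp
  qed
  thus "\<exists>N. \<forall>n\<ge>N. norm (sum (eta_term s) {..<n} - (\<Sum>n<m. eta_term s n)) \<le> (1 + norm s / Re s) * real (Suc m) powr (- Re s)"
    by blast
qed

lemma holomorphic_eta: "eta holomorphic_on {s. Re s > 0}"
proof (rule holomorphic_uniform_sequence[where f = "\<lambda>m s. \<Sum>n<m. eta_term s n"])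
  show "open {s. Re s > 0}" by (rule open_halfspace_Re_gt)
  show "(\<lambda>s. \<Sum>n<m. eta_term s n) holomorphic_on {s. 0 < Re s}" for m
    unfolding eta_term_def by (intro holomorphic_intros) (auto simp flip: of_nat_Suc)
  fix z :: complex assume "z \<in> {s. Re s > 0}"
  hence z: "Re z > 0" by simp
  define d where "d = Re z / 2"
  have d: "d > 0" using z by (simp add: d_def)
  have inb: "Re s \<ge> d \<and> norm s \<le> norm z + d" if "s \<in> cball z d" for s
  proof -
    have "norm (s - z) \<le> d" using that by (simp add: dist_norm norm_minus_commute)
    moreover have "\<bar>Re (s - z)\<bar> \<le> norm (s - z)" by (rule abs_Re_le_cmod)
    moreover have "norm s \<le> norm z + norm (s - z)" using norm_triangle_sub[of s z] by simp
    ultimately show ?thesis by (auto simp: d_def)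
  qed
  have "uniform_limit (cball z d) (\<lambda>m s. \<Sum>n<m. eta_term s n) eta sequentially"
  proof (rule uniform_limitI)
    fix e :: real assume e: "e > 0"
    have "(\<lambda>m. (1 + (norm z + d) / d) * real (Suc m) powr (- d)) \<longlonglongrightarrow> (1 + (norm z + d) / d) * 0"
      by (intro tendsto_intros powr_neg_tendsto_0 d)
    hence "\<forall>\<^sub>F m in sequentially. (1 + (norm z + d) / d) * real (Suc m) powr (- d) < e"
      using e by (intro order_tendstoD) auto
    thus "\<forall>\<^sub>F m in sequentially. \<forall>s\<in>cball z d. dist (\<Sum>n<m. eta_term s n) (eta s) < e"
    proof eventually_elim
      case (elim m)
      show ?case
      proof
        fix s assume s: "s \<in> cball z d"
        note inb[OF s]
        hence "norm (eta s - (\<Sum>n<m. eta_term s n)) \<le> (1 + norm s / Re s) * real (Suc m) powr (- Re s)"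
          using d by (intro norm_eta_diff_le) auto
        also have "\<dots> \<le> (1 + (norm z + d) / d) * real (Suc m) powr (- d)"
          using inb[OF s] d by (intro mult_mono add_mono frac_le powr_mono) auto
        finally show "dist (\<Sum>n<m. eta_term s n) (eta s) < e" using elim by (simp add: dist_norm norm_minus_commute)
      qed
    qed
  qed
  moreover have "cball z d \<subseteq> {s. 0 < Re s}" using inb d by force
  ultimately show "\<exists>d>0. cball z d \<subseteq> {s. 0 < Re s} \<and>
      uniform_limit (cball z d) (\<lambda>m s. \<Sum>n<m. eta_term s n) eta sequentially" using d by blast
qed

section \<open>The Gamma function on vertical lines\<close>

lemma Ln_times_Re_pos:
  assumes "Re w > 0" "Re z > 0"
  shows "Ln (w * z) = Ln w + Ln z"
proof -
  have "w \<noteq> 0" "z \<noteq> 0" using assms by auto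
  thus ?thesis using Re_Ln_pos_lt_imp[OF assms(1)] Re_Ln_pos_lt_imp[OF assms(2)]
    by (subst Ln_times) auto
qed

text \<open>Digamma is the limit of ln m minus the sum of the 1 / (z + n), while Ln (z + m) - Ln z
  is the sum of the Ln (1 + 1 / (z + n)). The terms of the two sums differ by O(1 / |z + n|^2), and
  |z + n|^2 is at least (n + Im z)^2 / 2, which leads to a telescoping majorant.\<close>

lemma norm_Digamma_minus_Ln_le:
  fixes z :: complex
  assumes "Re z > 0" "Im z \<ge> 2"
  shows "norm (Digamma z - Ln z) \<le> 4 / (Im z - 1)"
proof -
  define y where "y = Im z"
  define d where "d n = Ln (1 + 1 / (z + of_nat n)) - 1 / (z + of_nat n)" for n
  define D where "D m = of_real (ln (real m)) - (\<Sum>n<m. inverse (z + of_nat n)) - Ln z" for m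
  have z0: "z \<noteq> 0" using assms by auto
  have Re_pos: "Re (z + of_nat n) > 0" for n using assms by (simp add: add_pos_nonneg)
  have nrm: "norm (z + of_nat n) ^ 2 \<ge> (real n + y)^2 / 2" for n
  proof -
    have "norm (z + of_nat n) ^ 2 = (Re z + real n)^2 + y^2" by (simp add: cmod_power2 y_def)
    also have "\<dots> \<ge> real n ^ 2 + y^2" using assms by (intro add_mono power_mono) (auto simp: y_def)
    also have "real n ^ 2 + y^2 \<ge> (real n + y)^2 / 2"
      using sum_squares_bound[of "real n" y] by (simp add: power2_eq_square field_simps)
    finally show ?thesis by simp
  qed
  have d_le: "norm (d n) \<le> 4 * (1 / (real n + y - 1) - 1 / (real (Suc n) + y - 1))" for n
  proof -
    define w where "w = z + of_nat n"
    have y: "norm w \<ge> 2" using abs_Im_le_cmod[of w] assms by (auto simp: w_def)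
    hence w2: "norm (1/w) \<le> 1/2" by (simp add: norm_divide divide_simps)
    have "norm (d n) \<le> norm (1/w)^2 / (1 - norm (1/w))"
      unfolding d_def w_def[symmetric] using w2 by (intro Ln_approx_linear) auto
    also have "\<dots> \<le> norm (1/w)^2 / (1/2)" using w2 by (intro divide_left_mono) auto
    also have "\<dots> = 2 / norm w ^ 2" by (simp add: norm_divide power_divide)
    also have "\<dots> \<le> 2 / ((real n + y)^2 / 2)"
      using nrm[of n] y assms unfolding w_def by (intro divide_left_mono) (auto simp: y_def intro!: mult_pos_pos)
    also have "\<dots> = 4 * (1 / ((real n + y) * (real n + y)))" by (simp add: power2_eq_square)
    finally have *: "norm (d n) \<le> 4 * (1 / ((real n + y) * (real n + y)))" .
    have "1 / ((real n + y) * (real n + y)) \<le> 1 / ((real n + y - 1) * (real n + y))"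
      using assms by (intro divide_left_mono mult_right_mono mult_pos_pos) (auto simp: y_def)
    also have "1 / ((real n + y - 1) * (real n + y)) = 1 / (real n + y - 1) - 1 / (real (Suc n) + y - 1)"
    proof -
      have "real n + y - 1 \<noteq> 0" "real n + y \<noteq> 0" using assms by (auto simp: y_def)
      thus ?thesis by (simp add: field_simps)
    qed
    finally show ?thesis using * by (meson order.trans mult_left_mono zero_le_numeral)
  qed
  have Ln_sum: "Ln (z + of_nat m) = Ln z + (\<Sum>n<m. Ln (1 + 1 / (z + of_nat n)))" for m
  proof (induction m)
    case (Suc m)
    have nz: "z + of_nat m \<noteq> 0" using Re_pos[of m] by (metis zero_complex.sel(1) less_irrefl)
    have "Re (1 / (z + of_nat m)) > 0"
    proof -
      have "Re (1 / (z + of_nat m)) = Re (z + of_nat m) / norm (z + of_nat m) ^ 2"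
        unfolding cmod_power2 by (simp add: Re_divide)
      thus ?thesis using Re_pos[of m] nz by (metis divide_pos_pos zero_less_norm_iff zero_less_power)
    qed
    hence "Re (1 + 1 / (z + of_nat m)) > 0" by simp
    hence "Ln ((z + of_nat m) * (1 + 1 / (z + of_nat m))) = Ln (z + of_nat m) + Ln (1 + 1 / (z + of_nat m))"
      by (intro Ln_times_Re_pos Re_pos)
    also have "(z + of_nat m) * (1 + 1 / (z + of_nat m)) = z + of_nat (Suc m)"
      using nz by (simp add: field_simps)
    finally show ?case using Suc.IH by simp
  qed simp
  have bound: "norm (\<Sum>n<m. d n) \<le> 4 / (y - 1)" for m
  proof -
    have "norm (\<Sum>n<m. d n) \<le> (\<Sum>n<m. 4 * (1 / (real n + y - 1) - 1 / (real (Suc n) + y - 1)))"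
      by (rule order.trans[OF norm_sum sum_mono]) (rule d_le)
    also have "\<dots> = 4 * (1 / (y - 1) - 1 / (real m + y - 1))"
      unfolding sum_distrib_left[symmetric] by (subst sum_lessThan_telescope') simp
    also have "\<dots> \<le> 4 / (y - 1)" using assms by (simp add: y_def)
    finally show ?thesis .
  qed
  have Deq: "D m = (\<Sum>n<m. d n) - Ln (1 + z / of_nat m)" if "m > 0" for m
  proof -
    have "Ln (z + of_nat m) = Ln (of_nat m * (1 + z / of_nat m))" using that by (simp add: distrib_left add.commute)
    also have "\<dots> = Ln (of_nat m) + Ln (1 + z / of_nat m)"
      using that assms by (intro Ln_times_Re_pos) (auto simp: add_pos_pos)
    also have "Ln (of_nat m) = of_real (ln (real m))" using that
      by (metis Ln_of_real of_nat_0_less_iff of_real_of_nat_eq)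
    finally have "of_real (ln (real m)) = Ln z + (\<Sum>n<m. Ln (1 + 1 / (z + of_nat n))) - Ln (1 + z / of_nat m)"
      by (simp add: Ln_sum)
    thus ?thesis by (simp add: D_def d_def sum_subtractf inverse_eq_divide)
  qed
  have L0: "(\<lambda>m. Ln (1 + z / of_nat m)) \<longlonglongrightarrow> 0"
  proof -
    have "(\<lambda>m. 1 + z / of_nat m) \<longlonglongrightarrow> 1 + 0" by (intro tendsto_intros lim_const_over_n)
    hence "(\<lambda>m. Ln (1 + z / of_nat m)) \<longlonglongrightarrow> Ln (1 + 0)" by (rule tendsto_Ln) auto
    thus ?thesis by simp
  qed
  have "(\<lambda>m. D m + Ln (1 + z / of_nat m)) \<longlonglongrightarrow> (Digamma z - Ln z) + 0"
    unfolding D_def by (intro tendsto_intros L0 Digamma_LIMSEQ z0)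
  moreover have "\<forall>\<^sub>F m in sequentially. D m + Ln (1 + z / of_nat m) = (\<Sum>n<m. d n)"
    using eventually_gt_at_top[of 0] by eventually_elim (simp add: Deq)
  ultimately have "(\<lambda>m. \<Sum>n<m. d n) \<longlonglongrightarrow> (Digamma z - Ln z) + 0"
    by (rule Lim_transform_eventually)
  hence "(\<lambda>m. \<Sum>n<m. d n) \<longlonglongrightarrow> Digamma z - Ln z" by simp
  hence "(\<lambda>m. norm (\<Sum>n<m. d n)) \<longlonglongrightarrow> norm (Digamma z - Ln z)" by (rule tendsto_norm)
  thus ?thesis unfolding y_def[symmetric] by (rule LIMSEQ_le_const2) (use bound in auto)
qed

text \<open>The reflection formula gives the product of the norms of Gamma at 1/4 + iy and 3/4 + iy.
  Their quotient is controlled by the mean value theorem for the real part of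
  \<open>ln_Gamma\<close>, whose derivative is at most ln t + 4. The result is the true order of
  magnitude, and errors in the Mellin transform are later divided by it.\<close>

lemma norm_Gamma_quarter_ge:
  fixes t :: real
  assumes t: "t \<ge> 4"
  shows "norm (Gamma (Complex (1/4) (t/2))) \<ge> exp (-3) * t powr (-1/4) * exp (- pi * t / 4)"
proof -
  define y where "y = t / 2"
  have y: "y \<ge> 2" using t by (simp add: y_def)
  have npi: "Complex \<sigma> y \<notin> \<int>\<^sub>\<le>\<^sub>0" for \<sigma> using y by (auto elim!: nonpos_Ints_cases simp: complex_eq_iff)
  have npr: "Complex \<sigma> y \<notin> \<real>\<^sub>\<le>\<^sub>0" for \<sigma> using y by (auto simp: complex_nonpos_Reals_iff)
  define L where "L \<sigma> = Re (ln_Gamma (Complex \<sigma> y))" for \<sigma>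
  have Lder: "(L has_real_derivative Re (Digamma (Complex \<sigma> y))) (at \<sigma>)" for \<sigma>
  proof -
    have "((\<lambda>\<sigma>. ln_Gamma (Complex \<sigma> y)) has_vector_derivative Digamma (Complex \<sigma> y)) (at \<sigma>)"
    proof -
      have "((\<lambda>w. ln_Gamma (w + \<i> * of_real y)) has_field_derivative Digamma (Complex \<sigma> y)) (at (of_real \<sigma>))"
        using npr[of \<sigma>] by (auto intro!: derivative_eq_intros simp: Complex_eq)
      from has_vector_derivative_real_field[OF this] show ?thesis by (simp add: Complex_eq)
    qed
    thus ?thesis unfolding L_def by (rule has_field_derivative_Re)
  qed
  have "\<exists>\<xi>>1/4. \<xi> < 3/4 \<and> L (3/4) - L (1/4) = (3/4 - 1/4) * Re (Digamma (Complex \<xi> y))"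
    by (rule MVT2) (use Lder in auto)
  then obtain \<xi> where \<xi>: "\<xi> > 1/4" "\<xi> < 3/4" "L (3/4) - L (1/4) = 1/2 * Re (Digamma (Complex \<xi> y))" by auto
  define z where "z = Complex \<xi> y"
  have "norm (Digamma z - Ln z) \<le> 4 / (Im z - 1)"
    using \<xi> y by (intro norm_Digamma_minus_Ln_le) (auto simp: z_def)
  also have "\<dots> \<le> 4" using y by (simp add: z_def divide_simps)
  finally have "Re (Digamma z) \<le> Re (Ln z) + 4" using abs_Re_le_cmod[of "Digamma z - Ln z"] by simp
  also have "Re (Ln z) \<le> ln t"
  proof -
    have "norm z \<le> \<xi> + y" using cmod_le[of z] \<xi> y by (simp add: z_def)
    also have "\<dots> \<le> t" using \<xi> y by (simp add: y_def)
    finally have "norm z \<le> t" .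
    moreover have "z \<noteq> 0" using \<xi> by (auto simp: z_def complex_eq_iff)
    ultimately show ?thesis using t by simp
  qed
  finally have L34: "L (3/4) \<le> L (1/4) + ln t / 2 + 2" using \<xi>(3) by (simp add: z_def)
  have nG: "norm (Gamma (Complex \<sigma> y)) = exp (L \<sigma>)" for \<sigma>
    using npi[of \<sigma>] by (simp add: Gamma_complex_altdef L_def)
  define u where "u = Complex (1/4) y"
  have "Gamma u * Gamma (1 - u) = of_real pi / sin (of_real pi * u)" by (rule Gamma_reflection_complex)
  hence "norm (Gamma u) * norm (Gamma (1 - u)) = pi / norm (sin (of_real pi * u))"
    by (metis norm_mult norm_divide norm_of_real abs_of_pos pi_gt_zero)
  moreover have "norm (Gamma (1 - u)) = norm (Gamma (Complex (3/4) y))"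
  proof -
    have "1 - u = cnj (Complex (3/4) y)" by (simp add: u_def complex_eq_iff)
    thus ?thesis by (metis cnj_Gamma complex_mod_cnj)
  qed
  moreover have "pi / norm (sin (of_real pi * u)) \<ge> pi / exp (pi * y)"
  proof -
    have "norm (sin (1 *\<^sub>R (of_real pi * u))) \<le> exp \<bar>Im (of_real pi * u)\<bar>" by (rule cmod_sin_le_exp) auto
    hence "norm (sin (of_real pi * u)) \<le> exp (pi * y)" using y by (simp add: u_def abs_mult)
    moreover have "norm (sin (of_real pi * u)) > 0"
    proof -
      have "norm (Gamma u) > 0" "norm (Gamma (1 - u)) > 0"
        unfolding \<open>norm (Gamma (1 - u)) = norm (Gamma (Complex (3/4) y))\<close> unfolding u_def nG by simp_all
      thus ?thesis using \<open>Gamma u * Gamma (1 - u) = _\<close> by auto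
    qed
    ultimately show ?thesis by (intro divide_left_mono) (auto intro!: mult_pos_pos)
  qed
  ultimately have "pi / exp (pi * y) \<le> exp (L (1/4)) * exp (L (3/4))" by (simp add: nG u_def)
  also have "\<dots> \<le> exp (L (1/4)) * exp (L (1/4) + ln t / 2 + 2)" using L34 by simp
  also have "\<dots> = exp (2 * L (1/4) + ln t / 2 + 2)" by (simp add: exp_add[symmetric] algebra_simps)
  finally have "exp (- pi * y) \<le> exp (2 * L (1/4) + ln t / 2 + 2)"
    using mult_right_mono[of 1 pi "exp (- pi * y)"] pi_gt3 by (simp add: exp_minus field_simps)
  hence "- pi * y \<le> 2 * L (1/4) + ln t / 2 + 2" by simp
  hence "-3 - 1/4 * ln t - pi * t / 4 \<le> L (1/4)" by (simp add: y_def)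
  hence "exp (-3 + (-1/4) * ln t + (- pi * t / 4)) \<le> exp (L (1/4))" by simp
  also have "exp (-3 + (-1/4) * ln t + (- pi * t / 4)) = exp (-3) * t powr (-1/4) * exp (- pi * t / 4)"
    using t by (simp only: exp_add) (simp add: powr_def)
  finally show ?thesis using nG[of "1/4"] by (simp add: y_def)
qed

section \<open>The derivative of the Riemann-Siegel theta function\<close>

definition rs_theta' :: "real \<Rightarrow> real" where
  "rs_theta' t = Re (Digamma (Complex (1/4) (t/2))) / 2 - ln pi / 2"

lemma has_real_derivative_rs_theta: "(rs_theta has_real_derivative rs_theta' t) (at t)"
proof -
  have "((\<lambda>w. ln_Gamma (1/4 + \<i> * w / 2)) has_field_derivative \<i> / 2 * Digamma (Complex (1/4) (t/2))) (at (of_real t))"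
    by (auto intro!: derivative_eq_intros simp: Complex_eq complex_nonpos_Reals_iff)
  from has_field_derivative_Im[OF has_vector_derivative_real_field[OF this]]
  have 1: "((\<lambda>t. Im (ln_Gamma (Complex (1/4) (t/2)))) has_real_derivative Re (Digamma (Complex (1/4) (t/2))) / 2) (at t)"
    by (simp add: Complex_eq)
  have 2: "((\<lambda>t. - (t / 2) * ln pi) has_real_derivative - (ln pi / 2)) (at t)"
    by (auto intro!: derivative_eq_intros)
  have 3: "rs_theta = (\<lambda>t. - (t / 2) * ln pi + Im (ln_Gamma (Complex (1/4) (t/2))))"
    by (auto simp: rs_theta_def)
  show ?thesis using DERIV_add[OF 2 1] unfolding 3 rs_theta'_def by (simp add: algebra_simps)
qed

lemma rs_theta'_approx:
  assumes "t \<ge> 4"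
  shows "\<bar>rs_theta' t - (ln (norm (Complex (1/4) (t/2))) / 2 - ln pi / 2)\<bar> \<le> 8 / t"
proof -
  define z where "z = Complex (1/4) (t/2)"
  have "norm (Digamma z - Ln z) \<le> 4 / (Im z - 1)"
    using assms by (intro norm_Digamma_minus_Ln_le) (auto simp: z_def)
  hence "\<bar>Re (Digamma z) - Re (Ln z)\<bar> \<le> 4 / (t/2 - 1)" using abs_Re_le_cmod[of "Digamma z - Ln z"] by (simp add: z_def)
  also have "\<dots> \<le> 16 / t" using assms by (simp add: divide_simps)
  finally have "\<bar>Re (Digamma z) - Re (Ln z)\<bar> \<le> 2 * (8 / t)" by simp
  moreover have "Re (Ln z) = ln (norm z)" using assms by (subst Re_Ln) (auto simp: z_def complex_eq_iff)
  ultimately show ?thesis unfolding rs_theta'_def z_def[symmetric] by linarith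
qed

lemma rs_theta'_ge:
  assumes "t \<ge> 4" shows "rs_theta' t \<ge> ln t / 2 - 4"
proof -
  define z where "z = Complex (1/4) (t/2)"
  have "norm z \<ge> t / 2" using abs_Im_le_cmod[of z] unfolding z_def complex.sel by linarith
  hence "ln (norm z) \<ge> ln (t / 2)" using assms by (intro ln_mono) linarith+
  moreover have "ln (t / 2) = ln t - ln 2" using assms by (simp add: ln_div)
  moreover have "8 / t \<le> 2" using assms by (simp add: divide_simps)
  moreover have "ln (2::real) \<le> 1" using ln_le_minus_one[of 2] by simp
  moreover have "ln pi \<le> 3" using ln_le_minus_one[of pi] pi_less_4 by simp
  ultimately show ?thesis using rs_theta'_approx[OF assms] unfolding z_def[symmetric] by linarith
qed

text \<open>Permits freezing the derivative of theta at T over an interval of length O(T^\<Delta>).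
  The 16 collects the errors 8 / t and 8 / T of \<open>rs_theta'_approx\<close>.\<close>

lemma rs_theta'_diff_le:
  assumes "T \<ge> 4" "T \<le> t" shows "\<bar>rs_theta' t - rs_theta' T\<bar> \<le> (t - T + 16) / T"
proof -
  define a where "a = norm (Complex (1/4) (t/2))"
  define b where "b = norm (Complex (1/4) (T/2))"
  have b: "b \<ge> T / 2" using abs_Im_le_cmod[of "Complex (1/4) (T/2)"] unfolding b_def complex.sel by linarith
  have ab: "a \<le> b + (t - T) / 2"
  proof -
    have "a \<le> b + norm (Complex 0 ((t - T)/2))"
      unfolding a_def b_def by (rule order.trans[OF _ norm_triangle_ineq]) (simp add: complex_add diff_divide_distrib)
    also have "norm (Complex 0 ((t - T)/2)) = (t - T)/2" using assms by (simp add: cmod_def)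
    finally show ?thesis .
  qed
  have ba: "b \<le> a" unfolding a_def b_def cmod_def using assms by (auto intro!: real_sqrt_le_mono power_mono)
  have "ln a - ln b = ln (a / b)" using b ba assms by (simp add: ln_div)
  also have "\<dots> \<le> a / b - 1" using b ba assms by (intro ln_le_minus_one) auto
  also have "\<dots> = (a - b) / b" using b assms by (simp add: field_simps)
  also have "\<dots> \<le> ((t - T) / 2) / (T / 2)"
  proof (rule frac_le)
    show "a - b \<le> (t - T) / 2" using ab by linarith
  qed (use b assms in auto)
  also have "\<dots> = (t - T) / T" by (simp add: divide_simps)
  finally have "ln a - ln b \<le> (t - T) / T" .
  moreover have "ln a - ln b \<ge> 0" using ba b assms by simp
  moreover have "8 / t \<le> 8 / T" using assms by (simp add: frac_le)
  moreover have "\<bar>rs_theta' t - (ln a / 2 - ln pi / 2)\<bar> \<le> 8 / t" "\<bar>rs_theta' T - (ln b / 2 - ln pi / 2)\<bar> \<le> 8 / T"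
    using rs_theta'_approx[of t] rs_theta'_approx[of T] assms by (auto simp: a_def b_def)
  moreover have "(t - T) / T \<ge> 0" using assms by simp
  ultimately have "\<bar>rs_theta' t - rs_theta' T\<bar> \<le> (t - T) / T + 16 / T" by linarith
  thus ?thesis by (simp add: add_divide_distrib)
qed

section \<open>Zeros of even order\<close>

text \<open>\<open>odd_order_zero\<close> speaks of iterated real derivatives; this ties them to the
  Taylor coefficients of a holomorphic extension. Differentiability goes through the induction along
  with the equation, because \<open>deriv\<close> carries information only where the function is
  differentiable.\<close>

lemma higher_deriv_of_real_restrict:
  fixes f :: "complex \<Rightarrow> complex" and g :: "real \<Rightarrow> real"
  assumes hol: "f holomorphic_on S" and op: "open S" and sub: "\<And>x. of_real x \<in> S"
    and eq: "\<And>x. f (of_real x) = of_real (g x)"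
  shows "(deriv ^^ k) f (of_real x) = of_real ((deriv ^^ k) g x) \<and> (deriv ^^ k) g differentiable (at x)"
proof (induction k arbitrary: x)
  case (Suc k)
  define fk where "fk = (deriv ^^ k) f"
  define gk where "gk = (deriv ^^ k) g"
  have fd: "(fk has_field_derivative deriv fk (of_real x)) (at (of_real x))" for x
    unfolding fk_def using holomorphic_derivI[OF holomorphic_higher_deriv[OF hol op] op sub] by simp
  have gd: "(gk has_real_derivative Re (deriv fk (of_real x))) (at x) \<and> deriv fk (of_real x) = of_real (Re (deriv fk (of_real x)))" for x
  proof -
    have "((\<lambda>x. fk (of_real x)) has_vector_derivative deriv fk (of_real x)) (at x)"
      using has_vector_derivative_real_field[OF fd] .
    moreover have "(\<lambda>x. fk (of_real x)) = (\<lambda>x. of_real (gk x))" using Suc by (auto simp: fk_def gk_def)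
    ultimately have *: "((\<lambda>x. complex_of_real (gk x)) has_vector_derivative deriv fk (of_real x)) (at x)" by simp
    from has_field_derivative_Re[OF *] has_field_derivative_Im[OF *]
    have 1: "(gk has_real_derivative Re (deriv fk (of_real x))) (at x)"
      and 2: "((\<lambda>x. 0) has_real_derivative Im (deriv fk (of_real x))) (at x)" by auto
    from 2 have "Im (deriv fk (of_real x)) = 0"
      using DERIV_unique[OF 2 DERIV_const] by simp
    with 1 show ?thesis by (simp add: complex_eq_iff)
  qed
  have "deriv gk x = Re (deriv fk (of_real x))" for x using gd by (blast intro: DERIV_imp_deriv)
  hence eq': "deriv fk (of_real x) = of_real (deriv gk x)" for x using gd by metis
  have "(deriv gk) differentiable (at x)"
  proof -
    have "(deriv fk has_field_derivative deriv (deriv fk) (of_real x)) (at (of_real x))"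
      using holomorphic_derivI[OF holomorphic_higher_deriv[OF hol op, of "Suc k"] op sub] by (simp add: fk_def)
    from has_field_derivative_Re[OF has_vector_derivative_real_field[OF this]]
    show ?thesis by (auto simp: eq' real_differentiable_def)
  qed
  with eq' show ?case by (simp add: fk_def gk_def)
next
  case 0
  have "(f has_field_derivative deriv f (of_real x)) (at (of_real x))"
    using holomorphic_derivI[OF hol op sub] .
  from has_field_derivative_Re[OF has_vector_derivative_real_field[OF this]]
  show ?case by (auto simp: eq real_differentiable_def)
qed

text \<open>Unless f vanishes identically, the first non-vanishing derivative at each point has even
  order, so g has one strict sign on a punctured neighbourhood. The points with positive and those
  with negative sign form disjoint open sets that cover the interval, and connectedness leaves only
  one of them.\<close>

lemma no_odd_order_zero_imp_const_sign:
  fixes f :: "complex \<Rightarrow> complex" and g :: "real \<Rightarrow> real"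
  assumes hol: "f holomorphic_on S" and op: "open S" and con: "connected S" and sub: "\<And>x. of_real x \<in> S"
    and eq: "\<And>x. f (of_real x) = of_real (g x)"
    and no: "\<And>x. a < x \<Longrightarrow> x < b \<Longrightarrow> \<not> odd_order_zero g x"
  shows "(\<forall>x\<in>{a<..<b}. g x \<ge> 0) \<or> (\<forall>x\<in>{a<..<b}. g x \<le> 0)"
proof (cases "\<forall>z\<in>S. f z = 0")
  case True
  hence "g x = 0" for x using eq[of x] sub[of x] by simp
  thus ?thesis by simp
next
  case False
  then obtain z0 where z0: "z0 \<in> S" "f z0 \<noteq> 0" by blast
  have loc: "\<exists>d>0. (\<forall>y. y \<noteq> x \<and> \<bar>y - x\<bar> < d \<longrightarrow> g y > 0) \<or> (\<forall>y. y \<noteq> x \<and> \<bar>y - x\<bar> < d \<longrightarrow> g y < 0)"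
    if x: "x \<in> {a<..<b}" for x
  proof -
    define \<xi> where "\<xi> = complex_of_real x"
    have ex: "\<exists>n. (deriv ^^ n) f \<xi> \<noteq> 0"
    proof (rule ccontr)
      assume "\<not> ?thesis"
      hence *: "\<And>n. (deriv ^^ n) f \<xi> = 0" by blast
      have "f z0 = 0"
        by (rule holomorphic_fun_eq_0_on_connected[OF hol op con *, of z0]) (use sub z0 in \<open>auto simp: \<xi>_def\<close>)
      thus False using z0 by blast
    qed
    \<comment> \<open>A point where g does not vanish has \<open>k = 0\<close>, which is even, so it
      is treated together with the zeros.\<close>
    define k where "k = (LEAST n. (deriv ^^ n) f \<xi> \<noteq> 0)"
    have k: "(deriv ^^ k) f \<xi> \<noteq> 0" "\<And>j. j < k \<Longrightarrow> (deriv ^^ j) f \<xi> = 0"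
      using LeastI_ex[OF ex] not_less_Least unfolding k_def by blast+
    have dr: "(deriv ^^ j) f \<xi> = of_real ((deriv ^^ j) g x)" for j
      unfolding \<xi>_def using higher_deriv_of_real_restrict[OF hol op sub eq] by blast
    have "even k"
    proof (rule ccontr)
      assume "odd k"
      hence "odd_order_zero g x" unfolding odd_order_zero_def using k by (auto simp: dr intro!: exI[of _ k])
      thus False using no x by auto
    qed
    define c where "c = (deriv ^^ k) g x / fact k"
    have c0: "c \<noteq> 0" using k(1) by (auto simp: dr c_def)
    have lim: "((\<lambda>y. g y / (y - x)^k) \<longlongrightarrow> c) (at x)"
    proof -
      obtain r where r: "r > 0" "ball \<xi> r \<subseteq> S" using op sub[of x] by (auto simp: open_contains_ball \<xi>_def)
      have holr: "f holomorphic_on ball \<xi> r" using hol r holomorphic_on_subset by blast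
      define h where "h w = (\<Sum>n. (deriv ^^ (n + k)) f \<xi> / fact (n + k) * (w - \<xi>)^n)" for w
      have S: "(\<lambda>n. (deriv ^^ n) f \<xi> / fact n * (w - \<xi>)^n) sums f w" if "w \<in> ball \<xi> r" for w
        using holomorphic_power_series[OF holr that] .
      have fh: "f w = (w - \<xi>)^k * h w \<and> summable (\<lambda>n. (deriv ^^ (n + k)) f \<xi> / fact (n + k) * (w - \<xi>)^n)" if w: "w \<in> ball \<xi> r" "w \<noteq> \<xi>" for w
      proof -
        have "(\<lambda>n. (deriv ^^ (n+k)) f \<xi> / fact (n+k) * (w - \<xi>)^(n+k)) sums (f w - (\<Sum>n<k. (deriv ^^ n) f \<xi> / fact n * (w - \<xi>)^n))"
          using sums_split_initial_segment[OF S[OF w(1)], of k] .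
        also have "(\<Sum>n<k. (deriv ^^ n) f \<xi> / fact n * (w - \<xi>)^n) = 0" using k(2) by (intro sum.neutral) auto
        finally have "(\<lambda>n. (deriv ^^ (n+k)) f \<xi> / fact (n+k) * (w - \<xi>)^(n+k)) sums f w" by simp
        from sums_divide[OF this, of "(w - \<xi>)^k"]
        have "(\<lambda>n. (deriv ^^ (n+k)) f \<xi> / fact (n+k) * (w - \<xi>)^n) sums (f w / (w - \<xi>)^k)"
          using w by (simp add: power_add)
        thus ?thesis using w by (auto simp: sums_iff h_def)
      qed
      \<comment> \<open>After division by (w - \<xi>)^k a power series is left, and its continuity
        at the centre gives the limit c.\<close>
      have hl: "((\<lambda>y. h (of_real y)) \<longlongrightarrow> of_real c) (at x)"
      proof -
        define G where "G u = (\<Sum>n. (deriv ^^ (n + k)) f \<xi> / fact (n + k) * u^n)" for u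
        define w0 where "w0 = \<xi> + of_real (r/2)"
        have "w0 \<in> ball \<xi> r" "w0 \<noteq> \<xi>" using r by (auto simp: w0_def dist_norm)
        from fh[OF this] have "summable (\<lambda>n. (deriv ^^ (n + k)) f \<xi> / fact (n + k) * (w0 - \<xi>)^n)" by blast
        hence "isCont G 0" unfolding G_def
          by (rule isCont_powser) (use r in \<open>auto simp: w0_def\<close>)
        hence *: "isCont G (of_real x - \<xi>)" by (simp add: \<xi>_def)
        have "isCont (\<lambda>y. of_real y - \<xi>) x" by (intro continuous_intros)
        hence "isCont (\<lambda>y. G (of_real y - \<xi>)) x" using * by (rule isCont_o2)
        hence "((\<lambda>y. G (of_real y - \<xi>)) \<longlongrightarrow> G 0) (at x)" unfolding isCont_def \<xi>_def by simp
        moreover have "G 0 = of_real c" unfolding G_def powser_zero by (simp add: dr c_def)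
        moreover have "h = (\<lambda>w. G (w - \<xi>))" by (simp add: h_def G_def fun_eq_iff)
        ultimately show ?thesis by simp
      qed
      have "((\<lambda>y. Re (h (of_real y))) \<longlongrightarrow> c) (at x)" using tendsto_Re[OF hl] by simp
      moreover have "\<forall>\<^sub>F y in at x. Re (h (of_real y)) = g y / (y - x)^k"
      proof -
        have "\<forall>\<^sub>F y in at x. y \<noteq> x \<and> dist y x < r" using r by (auto simp: eventually_at intro!: exI[of _ r])
        thus ?thesis
        proof eventually_elim
          case (elim y)
          have "of_real y \<in> ball \<xi> r" "of_real y \<noteq> \<xi>" using elim by (auto simp: \<xi>_def dist_norm norm_minus_commute simp flip: of_real_diff)
          from fh[OF this] have "of_real (g y) = of_real ((y - x)^k) * h (of_real y)" by (simp add: eq \<xi>_def)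
          hence "h (of_real y) = of_real (g y / (y - x)^k)" using elim by (simp add: field_simps)
          thus ?case by simp
        qed
      qed
      ultimately show ?thesis by (rule Lim_transform_eventually)
    qed
    have pk: "(y - x)^k > 0" if "y \<noteq> x" for y using that \<open>even k\<close> by (metis zero_less_power_eq right_minus_eq)
    show ?thesis
    proof (cases "c > 0")
      case True
      have "\<forall>\<^sub>F y in at x. g y / (y - x)^k > 0" using order_tendstoD(1)[OF lim True] .
      then obtain d where "d > 0" "\<And>y. y \<noteq> x \<Longrightarrow> dist y x < d \<Longrightarrow> g y / (y - x)^k > 0" by (auto simp: eventually_at)
      hence "g y > 0" if "y \<noteq> x" "\<bar>y - x\<bar> < d" for y
        using pk[OF that(1)] that by (metis zero_less_divide_iff order_less_not_sym dist_real_def)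
      thus ?thesis using \<open>d > 0\<close> by blast
    next
      case False
      hence "c < 0" using c0 by simp
      have "\<forall>\<^sub>F y in at x. g y / (y - x)^k < 0" using order_tendstoD(2)[OF lim \<open>c < 0\<close>] .
      then obtain d where "d > 0" "\<And>y. y \<noteq> x \<Longrightarrow> dist y x < d \<Longrightarrow> g y / (y - x)^k < 0" by (auto simp: eventually_at)
      hence "g y < 0" if "y \<noteq> x" "\<bar>y - x\<bar> < d" for y
        using pk[OF that(1)] that by (metis divide_less_0_iff order_less_not_sym dist_real_def)
      thus ?thesis using \<open>d > 0\<close> by blast
    qed
  qed
  have cont: "isCont g x" for x
    using higher_deriv_of_real_restrict[OF hol op sub eq, of 0 x] by (auto intro: differentiable_imp_continuous_within)
  \<comment> \<open>The neighbourhoods are punctured so that a zero of even order falls into the set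
    of the sign around it.\<close>
  define P where "P = {x. \<exists>d>0. \<forall>y. y \<noteq> x \<and> \<bar>y - x\<bar> < d \<longrightarrow> g y > 0}"
  define N where "N = {x. \<exists>d>0. \<forall>y. y \<noteq> x \<and> \<bar>y - x\<bar> < d \<longrightarrow> g y < 0}"
  have ge: "g x \<ge> 0" if "x \<in> P" for x
  proof (rule ccontr)
    assume "\<not> g x \<ge> 0"
    hence "\<forall>\<^sub>F y in at x. g y < 0" using cont[of x] by (intro order_tendstoD(2)[of g "g x"]) (auto simp: isCont_def)
    moreover have "\<forall>\<^sub>F y in at x. g y > 0" using that by (auto simp: P_def eventually_at dist_real_def)
    ultimately have "\<forall>\<^sub>F y in at x. False" by eventually_elim auto
    thus False by simp
  qed
  have le: "g x \<le> 0" if "x \<in> N" for x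
  proof (rule ccontr)
    assume "\<not> g x \<le> 0"
    hence "\<forall>\<^sub>F y in at x. g y > 0" using cont[of x] by (intro order_tendstoD(1)[of g "g x"]) (auto simp: isCont_def)
    moreover have "\<forall>\<^sub>F y in at x. g y < 0" using that by (auto simp: N_def eventually_at dist_real_def)
    ultimately have "\<forall>\<^sub>F y in at x. False" by eventually_elim auto
    thus False by simp
  qed
  have oP: "open P"
  proof (rule openI)
    fix x assume "x \<in> P"
    then obtain d where d: "d > 0" "\<And>y. y \<noteq> x \<Longrightarrow> \<bar>y - x\<bar> < d \<Longrightarrow> g y > 0" by (auto simp: P_def)
    have "z \<in> P" if z: "z \<in> ball x d" for z
    proof (cases "z = x")
      case False
      show ?thesis unfolding P_def
        by (intro CollectI exI[of _ "min \<bar>z - x\<bar> (d - \<bar>z - x\<bar>)"] conjI allI impI d(2))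
           (use z False in \<open>auto simp: dist_real_def\<close>)
    qed (use \<open>x \<in> P\<close> in auto)
    thus "\<exists>e>0. ball x e \<subseteq> P" using d(1) by blast
  qed
  have oN: "open N"
  proof (rule openI)
    fix x assume "x \<in> N"
    then obtain d where d: "d > 0" "\<And>y. y \<noteq> x \<Longrightarrow> \<bar>y - x\<bar> < d \<Longrightarrow> g y < 0" by (auto simp: N_def)
    have "z \<in> N" if z: "z \<in> ball x d" for z
    proof (cases "z = x")
      case False
      show ?thesis unfolding N_def
        by (intro CollectI exI[of _ "min \<bar>z - x\<bar> (d - \<bar>z - x\<bar>)"] conjI allI impI d(2))
           (use z False in \<open>auto simp: dist_real_def\<close>)
    qed (use \<open>x \<in> N\<close> in auto)
    thus "\<exists>e>0. ball x e \<subseteq> N" using d(1) by blast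
  qed
  have "P \<inter> N = {}"
  proof (rule equals0I)
    fix x assume "x \<in> P \<inter> N"
    hence "\<forall>\<^sub>F y in at x. g y > 0" "\<forall>\<^sub>F y in at x. g y < 0" by (auto simp: P_def N_def eventually_at dist_real_def)
    hence "\<forall>\<^sub>F y in at x. False" by eventually_elim auto
    thus False by simp
  qed
  moreover have "{a<..<b} \<subseteq> P \<union> N" using loc unfolding P_def N_def by blast
  ultimately have "P \<inter> {a<..<b} = {} \<or> N \<inter> {a<..<b} = {}"
    by (intro connectedD[OF connected_Ioo oP oN]) auto
  thus ?thesis using \<open>{a<..<b} \<subseteq> P \<union> N\<close> ge le by blast
qed

section \<open>Rotated incomplete Gamma integrals\<close>

text \<open>Contour integrals are expressed through an entire primitive F. Deforming a contour then
  means nothing more than estimating F between the same endpoints along another path.\<close>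

lemma norm_primitive_diff_le_exp:
  fixes F g :: "complex \<Rightarrow> complex" and \<gamma> \<gamma>' :: "real \<Rightarrow> complex"
  assumes F: "\<And>w. (F has_field_derivative g w) (at w)"
    and le: "u1 \<le> u2" and \<kappa>: "\<kappa> > 0"
    and \<gamma>: "\<And>u. u1 \<le> u \<Longrightarrow> u \<le> u2 \<Longrightarrow> (\<gamma> has_vector_derivative \<gamma>' u) (at u)"
    and bd: "\<And>u. u1 \<le> u \<Longrightarrow> u \<le> u2 \<Longrightarrow> norm (g (\<gamma> u) * \<gamma>' u) \<le> B * exp (- \<kappa> * u)"
  shows "norm (F (\<gamma> u2) - F (\<gamma> u1)) \<le> B / \<kappa> * (exp (- \<kappa> * u1) - exp (- \<kappa> * u2))"
proof (cases "u1 = u2")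
  case False
  have der: "((\<lambda>u. F (\<gamma> u)) has_vector_derivative \<gamma>' u * g (\<gamma> u)) (at u)" if "u1 \<le> u" "u \<le> u2" for u
    using field_vector_diff_chain_at[OF \<gamma>[OF that] F] by (simp add: o_def)
  have "norm (F (\<gamma> u2) - F (\<gamma> u1)) \<le> (- B / \<kappa> * exp (- \<kappa> * u2)) - (- B / \<kappa> * exp (- \<kappa> * u1))"
  proof (rule differentiable_bound_general)
    show "u1 < u2" using False le by simp
    show "continuous_on {u1..u2} (\<lambda>u. F (\<gamma> u))"
      using der by (intro continuous_at_imp_continuous_on ballI) (auto intro: has_vector_derivative_continuous)
    show "continuous_on {u1..u2} (\<lambda>u. - B / \<kappa> * exp (- \<kappa> * u))" by (intro continuous_intros)
    fix u assume u: "u1 < u" "u < u2"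
    show "((\<lambda>u. F (\<gamma> u)) has_vector_derivative \<gamma>' u * g (\<gamma> u)) (at u)" using der u by simp
    show "((\<lambda>u. - B / \<kappa> * exp (- \<kappa> * u)) has_vector_derivative B * exp (- \<kappa> * u)) (at u)"
      unfolding has_real_derivative_iff_has_vector_derivative[symmetric] using \<kappa>
      by (auto intro!: derivative_eq_intros)
    show "norm (\<gamma>' u * g (\<gamma> u)) \<le> B * exp (- \<kappa> * u)" using bd[of u] u by (simp add: mult.commute)
  qed
  thus ?thesis by (simp add: algebra_simps)
qed auto

text \<open>The difference is cubic near 0, but \<open>norm_primitive_diff_le_exp\<close> wants a
  linear exponent. The line through (u0, 0) with slope u0^2 / 2 lies below, since 1 - 1 / (1 + x^2)
  is at least u0^2 / 2 for x at least u0 and u0 at most 1. The choice u0 = t^(-1/3) later makes t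
  u0^3 = 1.\<close>

lemma sub_arctan_ge:
  fixes u u0 :: real
  assumes "0 \<le> u" "0 \<le> u0" "u0 \<le> 1"
  shows "u - arctan u \<ge> u0^2 / 2 * (u - u0)"
proof (cases "u \<le> u0")
  case True
  hence "u0^2 / 2 * (u - u0) \<le> 0" by (intro mult_nonneg_nonpos) auto
  moreover have "arctan u \<le> u" using assms arctan_le_self by simp
  ultimately show ?thesis by linarith
next
  case False
  have "u0 - arctan u0 - u0^2 / 2 * (u0 - u0) \<le> u - arctan u - u0^2 / 2 * (u - u0)"
  proof (rule DERIV_nonneg_imp_nondecreasing[of u0 u])
    show "u0 \<le> u" using False by simp
    fix x assume x: "u0 \<le> x" "x \<le> u"
    have "((\<lambda>x. x - arctan x - u0^2 / 2 * (x - u0)) has_real_derivative (1 - inverse (1 + x^2) - u0^2/2)) (at x)"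
      by (auto intro!: derivative_eq_intros)
    moreover have "1 - inverse (1 + x^2) - u0^2/2 \<ge> 0"
    proof -
      have "u0^2 \<le> x^2" "u0^2 \<le> 1" using x assms by (auto intro!: power_mono power_le_one)
      hence "u0^2 * (1 + x^2) \<le> 2 * x^2"
        using mult_right_mono[of "u0^2" 1 "x^2"] by (simp add: algebra_simps)
      hence "u0^2 / 2 \<le> x^2 / (1 + x^2)" by (subst pos_le_divide_eq) (auto simp: add_pos_nonneg)
      moreover have "1 + x^2 > 0" by (simp add: add_pos_nonneg)
      hence "1 - inverse (1 + x^2) = x^2 / (1 + x^2)" by (simp add: field_simps)
      ultimately show ?thesis by simp
    qed
    ultimately show "\<exists>y. ((\<lambda>x. x - arctan x - u0^2 / 2 * (x - u0)) has_real_derivative y) (at x) \<and> y \<ge> 0" by blast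
  qed
  moreover have "arctan u0 \<le> u0" using assms arctan_le_self by simp
  ultimately show ?thesis by simp
qed

lemma half_le_sin: fixes x :: real assumes "0 \<le> x" "x \<le> 1" shows "x / 2 \<le> sin x"
proof -
  have "sin 0 - 0 / 2 \<le> sin x - x / 2"
  proof (rule DERIV_nonneg_imp_nondecreasing[OF assms(1)])
    fix y assume y: "0 \<le> y" "y \<le> x"
    have "((\<lambda>x. sin x - x / 2) has_real_derivative (cos y - 1/2)) (at y)" by (auto intro!: derivative_eq_intros)
    moreover have "cos y \<ge> cos (pi/3)" using y assms pi_gt3 by (intro cos_monotone_0_pi_le) auto
    ultimately show "\<exists>z. ((\<lambda>x. sin x - x / 2) has_real_derivative z) (at y) \<and> z \<ge> 0" by (auto simp: cos_60)
  qed
  thus ?thesis by simp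
qed

lemma square_le_one_minus_cos: fixes x :: real assumes "0 \<le> x" "x \<le> 1" shows "x^2 / 4 \<le> 1 - cos x"
proof -
  have "1 - cos 0 - 0^2 / 4 \<le> 1 - cos x - x^2 / 4"
  proof (rule DERIV_nonneg_imp_nondecreasing[OF assms(1)])
    fix y assume y: "0 \<le> y" "y \<le> x"
    have "((\<lambda>x. 1 - cos x - x^2 / 4) has_real_derivative (sin y - y/2)) (at y)" by (auto intro!: derivative_eq_intros)
    thus "\<exists>z. ((\<lambda>x. 1 - cos x - x^2 / 4) has_real_derivative z) (at y) \<and> z \<ge> 0"
      using half_le_sin[of y] y assms by auto
  qed
  thus ?thesis by simp
qed

text \<open>The analogue of \<open>sub_arctan_ge\<close> on the vertical path, which has length
  about pi.\<close>

lemma sub_sin_ge: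
  fixes u u0 :: real
  assumes "0 \<le> u" "u \<le> pi" "0 \<le> u0" "u0 \<le> 1"
  shows "u - sin u \<ge> u0^2 / 4 * (u - u0)"
proof (cases "u \<le> u0")
  case True
  hence "u0^2 / 4 * (u - u0) \<le> 0" by (intro mult_nonneg_nonpos) auto
  moreover have "sin u \<le> u" using assms sin_x_le_x by simp
  ultimately show ?thesis by linarith
next
  case False
  have "u0 - sin u0 - u0^2 / 4 * (u0 - u0) \<le> u - sin u - u0^2 / 4 * (u - u0)"
  proof (rule DERIV_nonneg_imp_nondecreasing[of u0 u])
    show "u0 \<le> u" using False by simp
    fix x assume x: "u0 \<le> x" "x \<le> u"
    have "((\<lambda>x. x - sin x - u0^2 / 4 * (x - u0)) has_real_derivative (1 - cos x - u0^2/4)) (at x)"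
      by (auto intro!: derivative_eq_intros)
    moreover have "cos x \<le> cos u0" using x assms by (intro cos_monotone_0_pi_le) auto
    ultimately show "\<exists>y. ((\<lambda>x. x - sin x - u0^2 / 4 * (x - u0)) has_real_derivative y) (at x) \<and> y \<ge> 0"
      using square_le_one_minus_cos[OF assms(3,4)] by (intro exI[of _ "1 - cos x - u0^2/4"]) auto
  qed
  moreover have "sin u0 \<le> u0" using assms sin_x_le_x by simp
  ultimately show ?thesis by simp
qed

text \<open>The integrand of the Gamma integral of x^(a-1) exp(-c x) at a = 1/4 + it/2, in the
  coordinate x = exp w. In this coordinate it is entire, and rotating the ray of integration by an
  angle is a vertical translation.\<close>

definition mellin_exp :: "real \<Rightarrow> real \<Rightarrow> complex \<Rightarrow> complex" where
  "mellin_exp t c w = exp (Complex (1/4) (t/2) * w - of_real c * exp w)"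

lemma norm_mellin_exp:
  "norm (mellin_exp t c w) = exp (Re w / 4 - t / 2 * Im w - c * exp (Re w) * cos (Im w))"
  by (simp add: mellin_exp_def Re_exp)

lemma norm_mellin_exp_Ln:
  assumes "z \<noteq> 0"
  shows "norm (mellin_exp t c (Ln z) * (1 / z)) = exp (- 3/4 * ln (norm z) - t / 2 * Im (Ln z) - c * Re z)"
proof -
  have "Re (exp (Ln z)) = Re z" using assms by simp
  hence "exp (Re (Ln z)) * cos (Im (Ln z)) = Re z" by (simp only: Re_exp)
  hence "norm (mellin_exp t c (Ln z)) = exp (ln (norm z) / 4 - t / 2 * Im (Ln z) - c * Re z)"
    using assms by (simp add: norm_mellin_exp mult.assoc)
  moreover have "norm (1 / z) = exp (- ln (norm z))" using assms by (simp add: norm_divide exp_minus inverse_eq_divide)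
  ultimately have "norm (mellin_exp t c (Ln z) * (1 / z)) = exp ((ln (norm z) / 4 - t / 2 * Im (Ln z) - c * Re z) + - ln (norm z))"
    by (simp only: norm_mult exp_add)
  thus ?thesis by (simp add: algebra_simps)
qed

lemma has_vector_derivative_Ln_line:
  assumes "z + of_real u * w \<notin> \<real>\<^sub>\<le>\<^sub>0"
  shows "((\<lambda>u. Ln (z + of_real u * w)) has_vector_derivative w * (1 / (z + of_real u * w))) (at u)"
proof -
  have "((\<lambda>\<zeta>. Ln (z + \<zeta> * w)) has_field_derivative w * (1 / (z + of_real u * w))) (at (of_real u))"
    using assms by (auto intro!: derivative_eq_intros simp: field_simps)
  from has_vector_derivative_real_field[OF this] show ?thesis by simp
qed

text \<open>Turning the endpoint of the incomplete Gamma integral almost up to the imaginary axis; the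
  remaining path runs parallel to the real axis from there.\<close>

lemma upper_rotated_le:
  fixes F :: "complex \<Rightarrow> complex"
  assumes F: "\<And>w. (F has_field_derivative mellin_exp t c w) (at w)"
    and Lp: "((\<lambda>v. F (of_real v)) \<longlongrightarrow> Lp) at_top"
    and t: "t \<ge> 4" and c: "c > 0" and \<kappa>: "\<kappa> > 0"
    and ex: "\<And>u. u \<ge> 0 \<Longrightarrow> t / 2 * arctan u - c * u \<le> B - \<kappa> * u"
  defines "\<phi> \<equiv> pi / 2 - 1 / t"
  shows "norm (Lp - F (\<i> * of_real \<phi>)) \<le> exp (1/2 + B - pi * t / 4) / \<kappa>"
proof -
  define x0 where "x0 = cis \<phi>"
  have it: "1 / t \<le> 1 / 4" "1 / t > 0" using t by (auto simp: divide_simps)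
  have \<phi>: "0 < \<phi>" "\<phi> < pi / 2" unfolding \<phi>_def using it pi_gt3 by linarith+
  have s: "0 < sin \<phi>" "sin \<phi> \<le> 1" "0 < cos \<phi>" using \<phi> by (auto intro: sin_gt_zero cos_gt_zero_pi)
  have x0: "Re x0 = cos \<phi>" "Im x0 = sin \<phi>" "norm x0 = 1" by (auto simp: x0_def)
  have npr: "x0 + of_real u * 1 \<notin> \<real>\<^sub>\<le>\<^sub>0" for u using s by (auto simp: complex_nonpos_Reals_iff x0)
  have n1: "norm (x0 + of_real u) ^ 2 \<ge> 1 + u^2" if "u \<ge> 0" for u
  proof -
    have "norm (x0 + of_real u) ^ 2 = (cos \<phi> + u)^2 + (sin \<phi>)^2"
      by (simp add: cmod_power2 x0)
    also have "\<dots> = 1 + 2 * cos \<phi> * u + u^2"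
      using sin_cos_squared_add[of \<phi>] by (simp add: power2_eq_square algebra_simps)
    finally have "norm (x0 + of_real u) ^ 2 = 1 + 2 * cos \<phi> * u + u^2" .
    thus ?thesis using s that by simp
  qed
  have n1': "norm (x0 + of_real u) \<ge> 1" if "u \<ge> 0" for u
  proof -
    have "1 ^ 2 \<le> norm (x0 + of_real u) ^ 2" unfolding power_one using n1[OF that] zero_le_power2[of u] by linarith
    thus ?thesis by (rule power2_le_imp_le) auto
  qed
  have Ln_x0: "Ln x0 = \<i> * of_real \<phi>"
    unfolding x0_def cis_conv_exp using \<phi> by (subst Ln_exp) auto
  \<comment> \<open>Along the ray the argument falls at the rate sin \<phi> / |x0 + u|^2, which is
    at most the derivative of arctan.\<close>
  have Arg_ge: "Im (Ln (x0 + of_real u)) \<ge> \<phi> - arctan u" if u: "u \<ge> 0" for u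
  proof -
    have "Im (Ln (x0 + of_real 0)) + arctan 0 \<le> Im (Ln (x0 + of_real u)) + arctan u"
    proof (rule DERIV_nonneg_imp_nondecreasing[OF u])
      fix x assume x: "0 \<le> x" "x \<le> u"
      have d0: "((\<lambda>u. Im (Ln (x0 + of_real u))) has_real_derivative Im (1 * (1 / (x0 + of_real x * 1)))) (at x)"
        using has_field_derivative_Im[OF has_vector_derivative_Ln_line[OF npr]] by simp
      have d: "((\<lambda>u. Im (Ln (x0 + of_real u)) + arctan u) has_real_derivative
              (Im (1 / (x0 + of_real x)) + inverse (1 + x^2))) (at x)"
        using DERIV_add[OF d0 DERIV_arctan[of x]] by simp
      have "Im (1 / (x0 + of_real x)) = - sin \<phi> / norm (x0 + of_real x)^2"
        unfolding cmod_power2 by (simp add: Im_divide x0)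
      moreover have "sin \<phi> / norm (x0 + of_real x)^2 \<le> 1 / (1 + x^2)"
        using n1[OF x(1)] s by (intro frac_le) (auto simp: add_pos_nonneg)
      ultimately have "Im (1 / (x0 + of_real x)) + inverse (1 + x^2) \<ge> 0" by (simp add: inverse_eq_divide)
      with d show "\<exists>y. ((\<lambda>u. Im (Ln (x0 + of_real u)) + arctan u) has_real_derivative y) (at x) \<and> y \<ge> 0" by blast
    qed
    thus ?thesis using Ln_x0 by simp
  qed
  have main: "norm (F (Ln (x0 + of_real U)) - F (\<i> * of_real \<phi>)) \<le> exp (1/2 + B - pi * t / 4) / \<kappa>" if U: "U \<ge> 0" for U
  proof -
    have "norm (F (Ln (x0 + of_real U * 1)) - F (Ln (x0 + of_real 0 * 1)))
       \<le> exp (1/2 + B - pi * t / 4) / \<kappa> * (exp (- \<kappa> * 0) - exp (- \<kappa> * U))"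
    proof (rule norm_primitive_diff_le_exp[OF F U \<kappa>])
      fix u assume u: "0 \<le> u" "u \<le> U"
      show "((\<lambda>u. Ln (x0 + of_real u * 1)) has_vector_derivative 1 * (1 / (x0 + of_real u * 1))) (at u)"
        by (rule has_vector_derivative_Ln_line[OF npr])
      have nz: "x0 + of_real u \<noteq> 0" using npr[of u] by auto
      have "norm (mellin_exp t c (Ln (x0 + of_real u)) * (1 / (x0 + of_real u)))
          = exp (- 3/4 * ln (norm (x0 + of_real u)) - t / 2 * Im (Ln (x0 + of_real u)) - c * Re (x0 + of_real u))"
        by (rule norm_mellin_exp_Ln[OF nz])
      \<comment> \<open>Here \<open>t / 2 * \<phi>\<close> equals \<open>pi * t / 4 - 1/2\<close>:
        this is the cost of stopping short of the imaginary axis.\<close>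
      also have "\<dots> \<le> exp (1/2 + B - pi * t / 4 + - \<kappa> * u)"
      proof (subst exp_le_cancel_iff)
        have "ln (norm (x0 + of_real u)) \<ge> 0" using n1'[OF u(1)] by simp
        moreover have "t / 2 * Im (Ln (x0 + of_real u)) \<ge> t / 2 * (\<phi> - arctan u)"
          using Arg_ge[OF u(1)] t by (intro mult_left_mono) auto
        moreover have "t / 2 * (\<phi> - arctan u) = pi * t / 4 - 1/2 - t / 2 * arctan u"
          using t by (simp add: \<phi>_def field_simps)
        moreover have "c * Re (x0 + of_real u) \<ge> c * u" using c s by (simp add: x0)
        moreover note ex[OF u(1)]
        ultimately show "- 3/4 * ln (norm (x0 + of_real u)) - t / 2 * Im (Ln (x0 + of_real u)) - c * Re (x0 + of_real u)
            \<le> 1/2 + B - pi * t / 4 + - \<kappa> * u" by linarith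
      qed
      finally show "norm (mellin_exp t c (Ln (x0 + of_real u * 1)) * (1 * (1 / (x0 + of_real u * 1))))
          \<le> exp (1/2 + B - pi * t / 4) * exp (- \<kappa> * u)" by (simp only: exp_add mult_1_right mult_1_left)
    qed
    also have "\<dots> \<le> exp (1/2 + B - pi * t / 4) / \<kappa> * 1" using \<kappa> by (intro mult_left_mono) auto
    also have "Ln (x0 + of_real 0 * 1) = \<i> * of_real \<phi>"
      using Ln_x0 by simp
    finally show ?thesis by simp
  qed
  \<comment> \<open>The shifted ray and the real axis have the same limit, because the segment from
    U to U + x0 contributes at most a multiple of exp(-c U). The rate 1 and the factor
    \<open>exp 1\<close> only give this constant bound the form required by
    \<open>norm_primitive_diff_le_exp\<close>.\<close>
  have "((\<lambda>U. F (Ln (x0 + of_real U)) - F (of_real (ln U))) \<longlongrightarrow> 0) at_top"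
  proof (rule Lim_null_comparison)
    show "\<forall>\<^sub>F U in at_top. norm (F (Ln (x0 + of_real U)) - F (of_real (ln U))) \<le> exp (- c * U) * exp 1"
      using eventually_ge_at_top[of 1]
    proof eventually_elim
      case (elim U)
      have npr': "of_real U + of_real r * x0 \<notin> \<real>\<^sub>\<le>\<^sub>0" if "r \<ge> 0" for r
        using s elim that by (auto simp: complex_nonpos_Reals_iff x0 add_pos_nonneg not_le)
      have "norm (F (Ln (of_real U + of_real 1 * x0)) - F (Ln (of_real U + of_real 0 * x0)))
        \<le> exp (- c * U) * exp 1 / 1 * (exp (- 1 * 0) - exp (- 1 * 1))"
      proof (rule norm_primitive_diff_le_exp[OF F])
        fix r :: real assume r: "0 \<le> r" "r \<le> 1"
        define x where "x = of_real U + of_real r * x0"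
        have x: "Re x \<ge> U" "Im x \<ge> 0" using r s by (auto simp: x_def x0)
        have xnz: "x \<noteq> 0" using x elim by auto
        have nx: "norm x \<ge> 1" using x elim complex_Re_le_cmod[of x] by linarith
        show "((\<lambda>r. Ln (of_real U + of_real r * x0)) has_vector_derivative x0 * (1 / (of_real U + of_real r * x0))) (at r)"
          by (rule has_vector_derivative_Ln_line[OF npr'[OF r(1)]])
        have "norm (mellin_exp t c (Ln x) * (x0 * (1 / x))) = norm (mellin_exp t c (Ln x) * (1 / x))"
          by (simp add: norm_mult norm_divide x0)
        also have "\<dots> = exp (- 3/4 * ln (norm x) - t / 2 * Im (Ln x) - c * Re x)" by (rule norm_mellin_exp_Ln[OF xnz])
        also have "\<dots> \<le> exp (- c * U)"
        proof (subst exp_le_cancel_iff)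
          have "Im (Ln x) \<ge> 0" using x xnz Im_Ln_pos_le[of x] by auto
          hence "t / 2 * Im (Ln x) \<ge> 0" using t by simp
          moreover have "ln (norm x) \<ge> 0" using nx by simp
          moreover have "c * Re x \<ge> c * U" using x c by simp
          ultimately show "- 3/4 * ln (norm x) - t / 2 * Im (Ln x) - c * Re x \<le> - c * U" by linarith
        qed
        also have "\<dots> \<le> exp (- c * U) * (exp 1 * exp (- 1 * r))" using r by (simp add: exp_add[symmetric])
        finally show "norm (mellin_exp t c (Ln (of_real U + of_real r * x0)) * (x0 * (1 / (of_real U + of_real r * x0))))
            \<le> exp (- c * U) * exp 1 * exp (- 1 * r)" by (simp add: x_def)
      qed auto
      also have "\<dots> \<le> exp (- c * U) * exp 1 * 1" unfolding div_by_1 by (intro mult_left_mono) auto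
      also have "Ln (of_real U + of_real 0 * x0) = of_real (ln U)" using elim by (simp add: Ln_of_real)
      finally show ?case by (simp add: add.commute)
    qed
    show "((\<lambda>U. exp (- c * U) * exp 1) \<longlongrightarrow> 0) at_top" using c by real_asymp
  qed
  moreover have "((\<lambda>U. F (of_real (ln U))) \<longlongrightarrow> Lp) at_top"
    by (rule filterlim_compose[OF Lp ln_at_top])
  ultimately have "((\<lambda>U. (F (Ln (x0 + of_real U)) - F (of_real (ln U))) + F (of_real (ln U))) \<longlongrightarrow> 0 + Lp) at_top"
    by (rule tendsto_add)
  hence lim: "((\<lambda>U. norm (F (Ln (x0 + of_real U)) - F (\<i> * of_real \<phi>))) \<longlongrightarrow> norm (Lp - F (\<i> * of_real \<phi>))) at_top"
    by (intro tendsto_intros) simp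
  show ?thesis
  proof (rule tendsto_upperbound[OF lim])
    show "\<forall>\<^sub>F U in at_top. norm (F (Ln (x0 + of_real U)) - F (\<i> * of_real \<phi>)) \<le> exp (1/2 + B - pi * t / 4) / \<kappa>"
      using eventually_ge_at_top[of 0] by eventually_elim (rule main)
  qed simp
qed

text \<open>Here the part of the integral before the cut is estimated. In the coordinate w the path
  goes up the imaginary axis from \<phi> to 3 pi / 2, where exp(-t Im w / 2) outweighs exp(c sin u),
  and then to the left along Im w = 3 pi / 2.\<close>

lemma lower_rotated_le:
  fixes F :: "complex \<Rightarrow> complex"
  assumes F: "\<And>w. (F has_field_derivative mellin_exp t c w) (at w)"
    and Lm: "((\<lambda>v. F (of_real v)) \<longlongrightarrow> Lm) at_bot"
    and t: "t \<ge> 4" and c: "c > 0" and \<kappa>: "\<kappa> > 0" "\<kappa> \<le> t / 2" and B: "B \<ge> 0"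
    and ex: "\<And>u. u \<ge> 0 \<Longrightarrow> u \<le> pi \<Longrightarrow> c * sin u - t / 2 * u \<le> B - \<kappa> * u"
  defines "\<phi> \<equiv> pi / 2 - 1 / t"
  shows "norm (F (\<i> * of_real \<phi>) - Lm) \<le> (exp (1 + B) + 2) * exp (- pi * t / 4) / \<kappa>"
proof -
  have it: "1 / t \<le> 1 / 4" "1 / t > 0" using t by (auto simp: divide_simps)
  define \<gamma> where "\<gamma> u = \<i> * of_real (pi/2 + u)" for u
  have "norm (F (\<gamma> pi) - F (\<gamma> (-1/t))) \<le> exp (1/2 + B - pi * t / 4) / \<kappa> * (exp (- \<kappa> * (-1/t)) - exp (- \<kappa> * pi))"
  proof (rule norm_primitive_diff_le_exp[OF F _ \<kappa>(1)])
    show "-1/t \<le> pi" using it pi_gt3 by linarith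
    fix u assume u: "-1/t \<le> u" "u \<le> pi"
    show "(\<gamma> has_vector_derivative \<i>) (at u)" unfolding \<gamma>_def
      by (auto intro!: derivative_eq_intros simp: has_vector_derivative_def scaleR_conv_of_real)
    have "norm (mellin_exp t c (\<gamma> u) * \<i>) = exp (- (t / 2 * (pi/2 + u)) + c * sin u)"
      by (simp add: norm_mult norm_mellin_exp \<gamma>_def cos_add)
    also have "\<dots> \<le> exp (1/2 + B - pi * t / 4 + - \<kappa> * u)"
    proof (subst exp_le_cancel_iff)
      \<comment> \<open>Negative u occurs because the path starts 1 / t below pi / 2; on this short
        stretch the sine is not positive and \<open>- (t / 2 * u)\<close> is at most 1/2.\<close>
      have "c * sin u - t / 2 * u \<le> 1/2 + B - \<kappa> * u"
      proof (cases "u \<ge> 0")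
        case True
        thus ?thesis using ex[of u] u by simp
      next
        case False
        have "- u \<le> pi" using u it pi_gt3 by linarith
        hence "sin u \<le> 0" using False sin_ge_zero[of "- u"] by simp
        hence "c * sin u \<le> 0" using c by (simp add: mult_nonneg_nonpos)
        moreover have "- (t / 2 * u) \<le> 1/2" using u t by (simp add: field_simps)
        moreover have "- \<kappa> * u \<ge> 0" using False \<kappa> by (intro mult_nonpos_nonpos) auto
        ultimately show ?thesis using B by linarith
      qed
      thus "- (t / 2 * (pi/2 + u)) + c * sin u \<le> 1/2 + B - pi * t / 4 + - \<kappa> * u" by (simp add: algebra_simps)
    qed
    finally show "norm (mellin_exp t c (\<gamma> u) * \<i>) \<le> exp (1/2 + B - pi * t / 4) * exp (- \<kappa> * u)"
      by (simp only: exp_add)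
  qed
  also have "\<dots> \<le> exp (1/2 + B - pi * t / 4) / \<kappa> * exp (1/2)"
  proof (rule mult_left_mono)
    have "\<kappa> / t \<le> 1 / 2" using \<kappa> t by (simp add: divide_simps)
    hence "exp (- \<kappa> * (-1/t)) \<le> exp (1/2)" by simp
    thus "exp (- \<kappa> * (-1/t)) - exp (- \<kappa> * pi) \<le> exp (1/2)" using exp_gt_zero[of "-\<kappa>*pi"] by linarith
  qed (use \<kappa> in auto)
  also have "\<dots> = exp (1 + B) * exp (- pi * t / 4) / \<kappa>" by (simp add: exp_add[symmetric] field_simps)
  finally have vert: "norm (F (\<gamma> pi) - F (\<gamma> (-1/t))) \<le> exp (1 + B) * exp (- pi * t / 4) / \<kappa>" .
  \<comment> \<open>At this height exp w is purely imaginary, so c drops out of the norm of the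
    integrand and exp(Re w / 4) alone provides the decay.\<close>
  define h where "h u = of_real (-u) + \<i> * of_real (3 * pi / 2)" for u :: real
  have hor: "norm (F (h U) - F (h 0)) \<le> 2 * exp (- pi * t / 4) / \<kappa>" if U: "U \<ge> 0" for U
  proof -
    have "norm (F (h U) - F (h 0)) \<le> exp (- 3 * pi * t / 4) / (1/4) * (exp (- (1/4) * 0) - exp (- (1/4) * U))"
    proof (rule norm_primitive_diff_le_exp[OF F U])
      fix u assume u: "0 \<le> u" "u \<le> U"
      show "(h has_vector_derivative -1) (at u)" unfolding h_def
        by (auto intro!: derivative_eq_intros simp: has_vector_derivative_def scaleR_conv_of_real)
      have "cos (3 * pi / 2) = 0"
      proof -
        have "cos (3 * pi / 2) = cos (pi / 2 + pi)" by (rule arg_cong[of _ _ cos]) simp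
        thus ?thesis by (simp only: cos_periodic_pi cos_pi_half)
      qed
      thus "norm (mellin_exp t c (h u) * - 1) \<le> exp (- 3 * pi * t / 4) * exp (- (1/4) * u)"
        by (simp add: norm_mellin_exp h_def exp_add[symmetric])
    qed auto
    also have "\<dots> \<le> exp (- 3 * pi * t / 4) / (1/4) * 1" by (intro mult_left_mono) auto
    also have "\<dots> = exp (- pi * t / 4) * (4 * exp (- (pi * t / 2)))" by (simp add: exp_add[symmetric])
    also have "\<dots> \<le> exp (- pi * t / 4) * (2 / \<kappa>)"
    proof (rule mult_left_mono)
      have "3 * t \<le> pi * t" using pi_gt3 t by (intro mult_right_mono) auto
      hence "t \<le> exp (pi * t / 2)" using exp_ge_add_one_self[of "pi * t / 2"] t by linarith
      hence "4 * \<kappa> \<le> 2 * exp (pi * t / 2)" using \<kappa> by simp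
      thus "4 * exp (- (pi * t / 2)) \<le> 2 / \<kappa>" using \<kappa> by (simp add: exp_minus field_simps)
    qed auto
    finally show ?thesis by (simp add: mult.commute)
  qed
  have "((\<lambda>U. F (h U) - F (of_real (-U))) \<longlongrightarrow> 0) at_top"
  proof (rule Lim_null_comparison)
    show "\<forall>\<^sub>F U in at_top. norm (F (h U) - F (of_real (-U))) \<le> exp (c - U / 4) * exp (3 * pi / 2)"
      using eventually_ge_at_top[of 0]
    proof eventually_elim
      case (elim U)
      define v where "v y = of_real (-U) + \<i> * of_real y" for y :: real
      have "norm (F (v (3 * pi / 2)) - F (v 0)) \<le> exp (c - U / 4) * exp (3 * pi / 2) / 1 * (exp (- 1 * 0) - exp (- 1 * (3 * pi / 2)))"
      proof (rule norm_primitive_diff_le_exp[OF F])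
        fix y :: real assume y: "0 \<le> y" "y \<le> 3 * pi / 2"
        show "(v has_vector_derivative \<i>) (at y)" unfolding v_def
          by (auto intro!: derivative_eq_intros simp: has_vector_derivative_def scaleR_conv_of_real)
        have "norm (mellin_exp t c (v y) * \<i>) = exp (- U / 4 - t / 2 * y - c * exp (-U) * cos y)"
          by (simp add: norm_mult norm_mellin_exp v_def)
        also have "\<dots> \<le> exp (c - U / 4)"
        proof (subst exp_le_cancel_iff)
          have "- (exp (-U) * cos y) \<le> 1 * 1"
            using elim abs_cos_le_one[of y] by (intro order.trans[OF abs_ge_minus_self]) (simp add: abs_mult mult_le_one)
          hence "c * (- (exp (-U) * cos y)) \<le> c * 1" using c by (intro mult_left_mono) auto
          moreover have "t / 2 * y \<ge> 0" using t y by simp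
          ultimately show "- U / 4 - t / 2 * y - c * exp (-U) * cos y \<le> c - U / 4" by (simp add: mult.assoc)
        qed
        also have "\<dots> \<le> exp (c - U / 4) * (exp (3 * pi / 2) * exp (- 1 * y))" using y by (simp add: exp_add[symmetric])
        finally show "norm (mellin_exp t c (v y) * \<i>) \<le> exp (c - U / 4) * exp (3 * pi / 2) * exp (- 1 * y)" by simp
      qed auto
      also have "\<dots> \<le> exp (c - U / 4) * exp (3 * pi / 2) * 1" unfolding div_by_1 by (intro mult_left_mono) auto
      finally show ?case by (simp add: v_def h_def)
    qed
    show "((\<lambda>U. exp (c - U / 4) * exp (3 * pi / 2)) \<longlongrightarrow> 0) at_top" by real_asymp
  qed
  moreover have "((\<lambda>U. F (of_real (-U))) \<longlongrightarrow> Lm) at_top"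
    by (rule filterlim_compose[OF Lm filterlim_uminus_at_bot_at_top])
  ultimately have "((\<lambda>U. (F (h U) - F (of_real (-U))) + F (of_real (-U))) \<longlongrightarrow> 0 + Lm) at_top"
    by (rule tendsto_add)
  hence lim: "((\<lambda>U. norm (F (h U) - F (h 0))) \<longlongrightarrow> norm (Lm - F (h 0))) at_top"
    by (intro tendsto_intros) simp
  have "norm (Lm - F (h 0)) \<le> 2 * exp (- pi * t / 4) / \<kappa>"
  proof (rule tendsto_upperbound[OF lim])
    show "\<forall>\<^sub>F U in at_top. norm (F (h U) - F (h 0)) \<le> 2 * exp (- pi * t / 4) / \<kappa>"
      using eventually_ge_at_top[of 0] by eventually_elim (rule hor)
  qed simp
  moreover have "h 0 = \<gamma> pi" by (simp add: h_def \<gamma>_def)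
  moreover have "\<gamma> (-1/t) = \<i> * of_real \<phi>" by (simp add: \<gamma>_def \<phi>_def)
  ultimately have "norm (F (\<i> * of_real \<phi>) - Lm) \<le> exp (1 + B) * exp (- pi * t / 4) / \<kappa> + 2 * exp (- pi * t / 4) / \<kappa>"
    using vert norm_triangle_ineq[of "F (\<i> * of_real \<phi>) - F (\<gamma> pi)" "F (\<gamma> pi) - Lm"]
    by (simp add: norm_minus_commute)
  also have "\<dots> = (exp (1 + B) + 2) * exp (- pi * t / 4) / \<kappa>" by (simp only: distrib_right add_divide_distrib)
  finally show ?thesis .
qed

section \<open>Inversion of the Jacobi theta function\<close>

lemma integral_cos_2pi:
  fixes m :: int
  shows "((\<lambda>y. cos (2 * pi * of_int m * y)) has_integral (if m = 0 then 1 else 0)) {-1/2..1/2::real}"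
proof (cases "m = 0")
  case True
  thus ?thesis using has_integral_const_real[of "1::real" "-1/2" "1/2"] by simp
next
  case False
  have "((\<lambda>y. cos (2 * pi * of_int m * y)) has_integral
          (sin (2 * pi * of_int m * (1/2)) / (2 * pi * of_int m) - sin (2 * pi * of_int m * (-1/2)) / (2 * pi * of_int m))) {-1/2..1/2::real}"
  proof (rule fundamental_theorem_of_calculus)
    fix x :: real
    show "((\<lambda>y. sin (2 * pi * of_int m * y) / (2 * pi * of_int m)) has_vector_derivative cos (2 * pi * of_int m * x)) (at x within {-1/2..1/2})"
      unfolding has_real_derivative_iff_has_vector_derivative[symmetric] using False
      by (auto intro!: derivative_eq_intros)
  qed auto
  moreover have "sin (pi * of_int m) = 0" by (metis mult.commute sin_npi_int)
  ultimately show ?thesis using False by simp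
qed

text \<open>The functions sin((2k+1) pi y) are orthogonal on this interval, so Bessel's inequality
  makes the squared coefficients summable. Continuity of r suffices for this argument.\<close>

lemma Riemann_Lebesgue_sin_odd:
  fixes r :: "real \<Rightarrow> real"
  assumes cont: "continuous_on {-1/2..1/2} r"
  shows "(\<lambda>k. integral {-1/2..1/2} (\<lambda>y. r y * sin (of_int (2 * int k + 1) * pi * y))) \<longlonglongrightarrow> 0"
proof -
  define I where "I = {-1/2..1/2::real}"
  define s where "s k y = sin (of_int (2 * int k + 1) * pi * y)" for k and y :: real
  define b where "b k = integral I (\<lambda>y. r y * s k y)" for k
  have cs: "continuous_on I (s k)" for k unfolding s_def by (intro continuous_intros)
  have cr: "continuous_on I r" using cont by (simp add: I_def)
  have int: "f integrable_on I" if "continuous_on I f" for f :: "real \<Rightarrow> real"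
    using that unfolding I_def by (rule integrable_continuous_interval)
  have orth: "integral I (\<lambda>y. s j y * s k y) = (if j = k then 1/2 else 0)" for j k
  proof -
    have "((\<lambda>y. (cos (2 * pi * of_int (int j - int k) * y) - cos (2 * pi * of_int (int j + int k + 1) * y)) / 2) has_integral
       ((if int j - int k = 0 then 1 else 0) - (if int j + int k + 1 = 0 then 1 else 0)) / 2) I"
      unfolding I_def by (intro has_integral_divide has_integral_diff integral_cos_2pi)
    also have "(\<lambda>y. (cos (2 * pi * of_int (int j - int k) * y) - cos (2 * pi * of_int (int j + int k + 1) * y)) / 2) = (\<lambda>y. s j y * s k y)"
      unfolding s_def sin_times_sin by (intro ext) (simp add: algebra_simps)
    finally show ?thesis by (simp add: integral_unique)
  qed
  have Bessel: "(\<Sum>k<M. (b k)\<^sup>2) \<le> integral I (\<lambda>y. (r y)\<^sup>2) / 2" for M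
  proof -
    \<comment> \<open>The orthogonal projection of r; since each \<open>s k\<close> has squared norm
      1/2, its coefficient is \<open>2 * b k\<close>.\<close>
    define h where "h y = (\<Sum>k<M. 2 * b k * s k y)" for y
    have ch: "continuous_on I h" unfolding h_def by (intro continuous_intros cs)
    have rh: "integral I (\<lambda>y. r y * h y) = 2 * (\<Sum>k<M. (b k)\<^sup>2)"
    proof -
      have "integral I (\<lambda>y. r y * h y) = integral I (\<lambda>y. \<Sum>k<M. 2 * b k * (r y * s k y))"
        by (simp add: h_def sum_distrib_left mult_ac)
      also have "\<dots> = (\<Sum>k<M. integral I (\<lambda>y. 2 * b k * (r y * s k y)))"
        by (intro integral_sum int continuous_intros cr cs) auto
      also have "\<dots> = (\<Sum>k<M. 2 * (b k)\<^sup>2)" by (simp add: b_def power2_eq_square mult.assoc)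
      finally show ?thesis by (simp add: sum_distrib_left)
    qed
    have hh: "integral I (\<lambda>y. h y * h y) = 2 * (\<Sum>k<M. (b k)\<^sup>2)"
    proof -
      have "integral I (\<lambda>y. h y * h y) = integral I (\<lambda>y. \<Sum>j<M. \<Sum>k<M. (4 * b j * b k) * (s j y * s k y))"
        by (simp add: h_def sum_product mult_ac)
      also have "\<dots> = (\<Sum>j<M. integral I (\<lambda>y. \<Sum>k<M. (4 * b j * b k) * (s j y * s k y)))"
        by (intro integral_sum int continuous_intros cs) auto
      also have "\<dots> = (\<Sum>j<M. \<Sum>k<M. integral I (\<lambda>y. (4 * b j * b k) * (s j y * s k y)))"
        by (intro sum.cong refl integral_sum int continuous_intros cs) auto
      also have "\<dots> = (\<Sum>j<M. \<Sum>k<M. if j = k then 2 * b j * b j else 0)"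
        by (intro sum.cong refl) (simp add: orth)
      also have "\<dots> = (\<Sum>j<M. 2 * b j * b j)" by (intro sum.cong refl) (simp add: sum.delta')
      finally show ?thesis by (simp add: sum_distrib_left power2_eq_square mult_ac)
    qed
    have "0 \<le> integral I (\<lambda>y. (r y - h y)\<^sup>2)"
      by (intro integral_nonneg int continuous_intros cr ch) auto
    also have "integral I (\<lambda>y. (r y - h y)\<^sup>2) = integral I (\<lambda>y. ((r y)\<^sup>2 - 2 * (r y * h y)) + h y * h y)"
      by (intro integral_cong) (simp add: power2_eq_square algebra_simps)
    also have "\<dots> = integral I (\<lambda>y. (r y)\<^sup>2 - 2 * (r y * h y)) + integral I (\<lambda>y. h y * h y)"
      by (intro integral_add int continuous_intros cr ch)
    also have "integral I (\<lambda>y. (r y)\<^sup>2 - 2 * (r y * h y)) = integral I (\<lambda>y. (r y)\<^sup>2) - integral I (\<lambda>y. 2 * (r y * h y))"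
      by (intro integral_diff int continuous_intros cr ch)
    finally show ?thesis using rh hh by simp
  qed
  have "summable (\<lambda>k. (b k)\<^sup>2)"
    by (rule summableI_nonneg_bounded[OF _ Bessel]) auto
  hence "(\<lambda>k. (b k)\<^sup>2) \<longlonglongrightarrow> 0" by (rule summable_LIMSEQ_zero)
  from tendsto_real_sqrt[OF this] have "b \<longlonglongrightarrow> 0" by (simp add: tendsto_rabs_zero_iff)
  thus ?thesis by (simp add: b_def[abs_def] s_def I_def)
qed

definition dirichlet_kernel :: "nat \<Rightarrow> real \<Rightarrow> real" where
  "dirichlet_kernel K y = 1 + 2 * (\<Sum>k<K. cos (2 * pi * real (Suc k) * y))"

lemma sin_times_dirichlet_kernel:
  "sin (pi * y) * dirichlet_kernel K y = sin (of_int (2 * int K + 1) * pi * y)"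
proof (induction K)
  case (Suc K)
  have "sin (pi * y) * dirichlet_kernel (Suc K) y
      = sin (pi * y) * dirichlet_kernel K y + 2 * sin (pi * y) * cos (2 * pi * real (Suc K) * y)"
    by (simp add: dirichlet_kernel_def algebra_simps)
  also have "2 * sin (pi * y) * cos (2 * pi * real (Suc K) * y)
      = sin (pi * y + 2 * pi * real (Suc K) * y) + sin (pi * y - 2 * pi * real (Suc K) * y)"
    by (simp add: sin_add sin_diff)
  also have "pi * y - 2 * pi * real (Suc K) * y = - (of_int (2 * int K + 1) * pi * y)" by (simp add: algebra_simps)
  also have "pi * y + 2 * pi * real (Suc K) * y = of_int (2 * int (Suc K) + 1) * pi * y" by (simp add: algebra_simps)
  finally show ?case using Suc.IH by simp
qed (simp add: dirichlet_kernel_def)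

lemma dirichlet_kernel_shift: "dirichlet_kernel K (y + of_int n) = dirichlet_kernel K y"
proof -
  have "cos (2 * pi * real (Suc k) * (y + of_int n)) = cos (2 * pi * real (Suc k) * y)" for k
  proof -
    have "2 * pi * real (Suc k) * (y + of_int n) = 2 * pi * real (Suc k) * y + 2 * pi * of_int (int (Suc k) * n)"
      by (simp add: algebra_simps)
    thus ?thesis by (simp only: cos_add sin_int_2pin cos_int_2pin)
  qed
  thus ?thesis by (simp only: dirichlet_kernel_def)
qed

lemma continuous_on_dirichlet_kernel [continuous_intros]: "continuous_on A (dirichlet_kernel K)"
  unfolding dirichlet_kernel_def by (intro continuous_intros)

lemma integral_dirichlet_kernel: "integral {-1/2..1/2} (dirichlet_kernel K) = 1"
proof -
  have "((\<lambda>y. 1 + 2 * (\<Sum>k<K. cos (2 * pi * of_int (int (Suc k)) * y))) has_integral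
     (1 + 2 * (\<Sum>k<K. if int (Suc k) = 0 then 1 else 0))) {-1/2..1/2::real}"
    using has_integral_const_real[of "1::real" "-1/2" "1/2"]
    by (intro has_integral_add has_integral_mult_right has_integral_sum integral_cos_2pi) auto
  thus ?thesis by (simp add: dirichlet_kernel_def[abs_def] integral_unique)
qed

text \<open>The kernel has integral 1, so P may be replaced by P - P 0. Differentiability at 0 makes
  (P y - P 0) / sin(pi y) continuous, with value D / pi at 0, and the product of sine and kernel is
  the oscillating factor of \<open>Riemann_Lebesgue_sin_odd\<close>.\<close>

lemma dirichlet_kernel_tendsto:
  fixes P :: "real \<Rightarrow> real"
  assumes cont: "continuous_on {-1/2..1/2} P" and der: "(P has_real_derivative D) (at 0)"
  shows "(\<lambda>K. integral {-1/2..1/2} (\<lambda>y. P y * dirichlet_kernel K y)) \<longlonglongrightarrow> P 0"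
proof -
  define I where "I = {-1/2..1/2::real}"
  define r where "r y = (if y = 0 then D * inverse pi else (P y - P 0) / sin (pi * y))" for y
  have sn: "sin (pi * y) \<noteq> 0" if "y \<in> I" "y \<noteq> 0" for y
  proof
    assume "sin (pi * y) = 0"
    then obtain i :: int where "pi * y = of_int i * pi" by (auto simp: sin_zero_iff_int2)
    hence "y = of_int i" by simp
    with that show False by (auto simp: I_def)
  qed
  have "continuous_on I r"
  proof (rule continuous_on_eq_continuous_within[THEN iffD2], rule ballI)
    fix y assume y: "y \<in> I"
    show "continuous (at y within I) r"
    proof (cases "y = 0")
      case True
      have "((\<lambda>h. (P h - P 0) / h) \<longlongrightarrow> D) (at 0)" using der by (simp add: DERIV_def)
      moreover have "((\<lambda>h. h / sin (pi * h)) \<longlongrightarrow> inverse pi) (at (0::real))" by real_asymp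
      ultimately have "((\<lambda>h. ((P h - P 0) / h) * (h / sin (pi * h))) \<longlongrightarrow> D * inverse pi) (at 0)" by (rule tendsto_mult)
      moreover have "\<forall>\<^sub>F h in at 0. ((P h - P 0) / h) * (h / sin (pi * h)) = r h"
        by (auto simp: eventually_at r_def intro!: exI[of _ 1])
      ultimately have "(r \<longlongrightarrow> D * inverse pi) (at 0)" by (rule Lim_transform_eventually)
      hence "isCont r 0" by (simp add: isCont_def r_def)
      thus ?thesis using True continuous_at_imp_continuous_at_within by blast
    next
      case False
      have "continuous (at y within I) (\<lambda>y. (P y - P 0) / sin (pi * y))"
        using cont y sn[OF y False] unfolding I_def[symmetric] continuous_on_eq_continuous_within
        by (intro continuous_intros) auto
      moreover have "\<forall>\<^sub>F z in at y within I. (P z - P 0) / sin (pi * z) = r z"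
        using eventually_neq_at_within[of 0 y I] by eventually_elim (auto simp: r_def)
      ultimately show ?thesis unfolding continuous_within using False
        by (auto simp: r_def intro: Lim_transform_eventually)
    qed
  qed
  from Riemann_Lebesgue_sin_odd[OF this[unfolded I_def]]
  have "(\<lambda>K. integral I (\<lambda>y. r y * sin (of_int (2 * int K + 1) * pi * y)) + P 0) \<longlonglongrightarrow> 0 + P 0"
    unfolding I_def by (intro tendsto_intros)
  moreover have "integral I (\<lambda>y. r y * sin (of_int (2 * int K + 1) * pi * y)) + P 0
      = integral I (\<lambda>y. P y * dirichlet_kernel K y)" for K
  proof -
    have "integral I (\<lambda>y. r y * sin (of_int (2 * int K + 1) * pi * y)) = integral I (\<lambda>y. P y * dirichlet_kernel K y - P 0 * dirichlet_kernel K y)"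
    proof (rule integral_cong)
      fix y assume y: "y \<in> I"
      show "r y * sin (of_int (2 * int K + 1) * pi * y) = P y * dirichlet_kernel K y - P 0 * dirichlet_kernel K y"
        using sn[OF y] unfolding sin_times_dirichlet_kernel[symmetric] by (auto simp: r_def field_simps)
    qed
    also have "\<dots> = integral I (\<lambda>y. P y * dirichlet_kernel K y) - integral I (\<lambda>y. P 0 * dirichlet_kernel K y)"
      using cont unfolding I_def by (intro integral_diff integrable_continuous_interval continuous_intros)
    also have "integral I (\<lambda>y. P 0 * dirichlet_kernel K y) = P 0"
      using integral_dirichlet_kernel[of K] by (simp add: I_def)
    finally show ?thesis by simp
  qed
  ultimately show ?thesis by (simp add: I_def)
qed

section \<open>Poisson summation for the Gaussian\<close>

lemma gaussian_cos_integral: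
  fixes x \<xi> :: real
  assumes x: "x > 0"
  shows "has_bochner_integral lborel (\<lambda>y. exp (- (pi * y\<^sup>2 / x)) * cos (2 * pi * \<xi> * y)) (sqrt x * exp (- (pi * \<xi>\<^sup>2 * x)))"
proof -
  \<comment> \<open>Scaling by this number turns exp(-y^2 / 2) into exp(-pi y^2 / x), so the
    transform can be read off from the characteristic function of the standard normal
    distribution.\<close>
  define \<sigma> where "\<sigma> = sqrt (x / (2 * pi))"
  have \<sigma>: "\<sigma> > 0" "\<sigma>\<^sup>2 = x / (2 * pi)" using x by (auto simp: \<sigma>_def)
  define t where "t = 2 * pi * \<xi> * \<sigma>"
  have "char std_normal_distribution t = (CLINT y|lborel. std_normal_density y *\<^sub>R iexp (t * y))"
    unfolding char_def by (subst integral_density) (auto simp: normal_density_nonneg)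
  hence "(CLINT y|lborel. std_normal_density y *\<^sub>R iexp (t * y)) = of_real (exp (- (t\<^sup>2) / 2))"
    by (simp add: char_std_normal_distribution)
  moreover have "integrable lborel (\<lambda>y. std_normal_density y *\<^sub>R iexp (t * y))"
  proof (rule Bochner_Integration.integrable_bound)
    show "integrable lborel std_normal_density" by simp
  qed (auto simp: normal_density_nonneg)
  ultimately have "has_bochner_integral lborel (\<lambda>y. std_normal_density y *\<^sub>R iexp (t * y)) (of_real (exp (- (t\<^sup>2) / 2)))"
    by (simp add: has_bochner_integral_iff)
  from has_bochner_integral_Re[OF this]
  have "has_bochner_integral lborel (\<lambda>y. std_normal_density y * cos (t * y)) (exp (- (t\<^sup>2) / 2))"
    by (simp add: Re_exp)
  hence "has_bochner_integral lborel (\<lambda>y. sqrt (2 * pi) * (std_normal_density y * cos (t * y))) (sqrt (2 * pi) * exp (- (t\<^sup>2) / 2))"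
    by (rule has_bochner_integral_mult_right)
  also have "(\<lambda>y. sqrt (2 * pi) * (std_normal_density y * cos (t * y))) = (\<lambda>y. exp (- (y\<^sup>2) / 2) * cos (t * y))"
    by (simp add: normal_density_def fun_eq_iff)
  finally have *: "has_bochner_integral lborel (\<lambda>y. exp (- (y\<^sup>2) / 2) * cos (t * y)) (sqrt (2 * pi) * exp (- (t\<^sup>2) / 2))" .
  have "has_bochner_integral lborel (\<lambda>y. exp (- ((0 + (1/\<sigma>) * y)\<^sup>2) / 2) * cos (t * (0 + (1/\<sigma>) * y))) ((sqrt (2 * pi) * exp (- (t\<^sup>2) / 2)) /\<^sub>R \<bar>1/\<sigma>\<bar>)"
    using \<sigma> lborel_has_bochner_integral_real_affine_iff[of "1/\<sigma>" "\<lambda>y. exp (- (y\<^sup>2) / 2) * cos (t * y)" _ 0] * by simp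
  also have "(\<lambda>y. exp (- ((0 + (1/\<sigma>) * y)\<^sup>2) / 2) * cos (t * (0 + (1/\<sigma>) * y))) = (\<lambda>y. exp (- (pi * y\<^sup>2 / x)) * cos (2 * pi * \<xi> * y))"
  proof
    fix y
    have x_eq: "x = 2 * pi * \<sigma>\<^sup>2" using \<sigma> by simp
    have "(0 + (1/\<sigma>) * y)\<^sup>2 / 2 = pi * y\<^sup>2 / x" using \<sigma>(1) unfolding x_eq by (simp add: power_divide)
    moreover have "t * (0 + (1/\<sigma>) * y) = 2 * pi * \<xi> * y" using \<sigma>(1) by (simp add: t_def)
    ultimately show "exp (- ((0 + (1/\<sigma>) * y)\<^sup>2) / 2) * cos (t * (0 + (1/\<sigma>) * y)) = exp (- (pi * y\<^sup>2 / x)) * cos (2 * pi * \<xi> * y)" by simp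
  qed
  also have "(sqrt (2 * pi) * exp (- (t\<^sup>2) / 2)) /\<^sub>R \<bar>1/\<sigma>\<bar> = sqrt x * exp (- (pi * \<xi>\<^sup>2 * x))"
  proof -
    have "sqrt (2 * pi) * \<sigma> = sqrt x" unfolding \<sigma>_def by (simp flip: real_sqrt_mult)
    moreover have "t\<^sup>2 / 2 = pi * \<xi>\<^sup>2 * x" using \<sigma> by (simp add: t_def power_mult_distrib power2_eq_square)
    ultimately show ?thesis using \<sigma> by (simp add: mult_ac)
  qed
  finally show ?thesis .
qed

text \<open>The factor \<open>real n + 2\<close> bounds |y + n + 1| and |y - n - 1| for |y| at most
  1. Thus one majorant serves for the periodised Gaussian, for its derivative and for the theta
  series.\<close>

lemma summable_gaussian:
  fixes \<alpha> :: real
  assumes "\<alpha> > 0" shows "summable (\<lambda>n. (real n + 2) * exp (- \<alpha> * real n))"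
proof (rule summable_comparison_test')
  have "norm (exp (- \<alpha> / 2)) < 1" using assms by simp
  hence "summable (\<lambda>n. (2 + 2 / \<alpha>) * exp (- \<alpha> / 2) ^ n)" by (intro summable_mult summable_geometric)
  thus "summable (\<lambda>n. (2 + 2 / \<alpha>) * exp (- (\<alpha> / 2) * real n))" by (simp add: exp_of_nat_mult[symmetric] mult.commute)
  fix n :: nat
  have "real n + 2 \<le> (2 + 2 / \<alpha>) * (1 + \<alpha> / 2 * real n)" using assms by (simp add: field_simps)
  also have "\<dots> \<le> (2 + 2 / \<alpha>) * exp (\<alpha> / 2 * real n)" using assms by (intro mult_left_mono exp_ge_add_one_self) auto
  finally have "(real n + 2) * exp (- \<alpha> * real n) \<le> ((2 + 2 / \<alpha>) * exp (\<alpha> / 2 * real n)) * exp (- \<alpha> * real n)"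
    by (intro mult_right_mono) auto
  also have "\<dots> = (2 + 2 / \<alpha>) * exp (- (\<alpha> / 2) * real n)" by (simp add: exp_add[symmetric] mult.assoc field_simps)
  finally show "norm ((real n + 2) * exp (- \<alpha> * real n)) \<le> (2 + 2 / \<alpha>) * exp (- (\<alpha> / 2) * real n)" by simp
qed

lemma integral_symmetric_split:
  fixes f :: "real \<Rightarrow> real"
  assumes cont: "\<And>A. continuous_on A f"
  shows "integral {- (real N + 1/2)..real N + 1/2} f
     = integral {-1/2..1/2} (\<lambda>y. f y + (\<Sum>n<N. f (y + real (Suc n)) + f (y - real (Suc n))))"
proof (induction N)
  case (Suc N)
  have int: "f integrable_on {a..b}" for a b using cont by (rule integrable_continuous_interval)
  have sh: "integral {-1/2..1/2} (\<lambda>y. f (y + c)) = integral {c - 1/2..c + 1/2} f" for c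
  proof -
    have "(f has_integral integral {c - 1/2..c + 1/2} f) (cbox (c - 1/2) (c + 1/2))" using int by (simp add: has_integral_integral)
    from has_integral_affinity[OF this, of 1 c]
    have "((\<lambda>y. f (y + c)) has_integral integral {c - 1/2..c + 1/2} f) ((\<lambda>x. x - c) ` {c - 1/2..c + 1/2})" by simp
    also have "(\<lambda>x. x - c) ` {c - 1/2..c + 1/2} = {-1/2..1/2}" by (simp add: image_affinity_atLeastAtMost_diff[of 1, simplified])
    finally show ?thesis by (simp add: integral_unique)
  qed
  have cf: "continuous_on A (\<lambda>y. f (y + c))" for A c
  proof -
    have "continuous_on A (\<lambda>y. y + c)" by (intro continuous_intros)
    from continuous_on_compose2[OF cont[of UNIV] this] show ?thesis by simp
  qed
  have cf': "continuous_on A (\<lambda>y. f (y - c))" for A c using cf[of A "-c"] by simp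
  have "integral {- (real (Suc N) + 1/2)..real (Suc N) + 1/2} f
     = integral {- (real (Suc N) + 1/2)..- (real N + 1/2)} f + integral {- (real N + 1/2)..real N + 1/2} f + integral {real N + 1/2..real (Suc N) + 1/2} f"
    using Henstock_Kurzweil_Integration.integral_combine[where a = "- (real (Suc N) + 1/2)" and c = "- (real N + 1/2)" and b = "real N + 1/2" and f = f]
      Henstock_Kurzweil_Integration.integral_combine[where a = "- (real (Suc N) + 1/2)" and c = "real N + 1/2" and b = "real (Suc N) + 1/2" and f = f] int by simp
  also have "integral {- (real (Suc N) + 1/2)..- (real N + 1/2)} f = integral {-1/2..1/2} (\<lambda>y. f (y - real (Suc N)))"
  proof -
    have "- real (Suc N) - 1/2 = - (real (Suc N) + 1/2)" "- real (Suc N) + 1/2 = - (real N + 1/2)" by simp_all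
    with sh[of "- real (Suc N)"] show ?thesis by (simp only: add_uminus_conv_diff)
  qed
  also have "integral {real N + 1/2..real (Suc N) + 1/2} f = integral {-1/2..1/2} (\<lambda>y. f (y + real (Suc N)))"
  proof -
    have "real (Suc N) - 1/2 = real N + 1/2" by simp
    with sh[of "real (Suc N)"] show ?thesis by (simp only:)
  qed
  also note Suc.IH
  also have "integral {-1/2..1/2} (\<lambda>y. f (y - real (Suc N))) + integral {-1/2..1/2} (\<lambda>y. f y + (\<Sum>n<N. f (y + real (Suc n)) + f (y - real (Suc n)))) + integral {-1/2..1/2} (\<lambda>y. f (y + real (Suc N)))
     = integral {-1/2..1/2} (\<lambda>y. (f (y - real (Suc N)) + (f y + (\<Sum>n<N. f (y + real (Suc n)) + f (y - real (Suc n))))) + f (y + real (Suc N)))"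
    by (subst (1 2) integral_add) (intro integrable_continuous_interval continuous_intros cf cf' cont | simp)+
  finally show ?case by (simp add: algebra_simps)
qed simp

text \<open>Poisson summation: P is the Gaussian made periodic, its partial Fourier sums at 0 are
  its integrals against the Dirichlet kernels, and these tend to P 0. The two sides of the identity
  are these two evaluations of P 0.\<close>

lemma theta_inversion_real:
  fixes x :: real
  assumes x: "x > 0"
  shows "1 + 2 * (\<Sum>n. exp (- (pi * (real (Suc n))\<^sup>2 / x))) = sqrt x * (1 + 2 * (\<Sum>n. exp (- (pi * (real (Suc n))\<^sup>2 * x))))"
proof -
  define G where "G y = exp (- (pi * y\<^sup>2 / x))" for y
  define G' where "G' y = - (2 * pi / x) * y * G y" for y
  define T where "T n y = G (y + real (Suc n)) + G (y - real (Suc n))" for n y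
  define T' where "T' n y = G' (y + real (Suc n)) + G' (y - real (Suc n))" for n y
  define P where "P y = G y + (\<Sum>n. T n y)" for y
  define \<alpha> where "\<alpha> = pi / x"
  have \<alpha>: "\<alpha> > 0" using x by (simp add: \<alpha>_def)
  have Gder: "(G has_real_derivative G' y) (at y within A)" for y A
    unfolding G_def G'_def using x by (auto intro!: derivative_eq_intros simp: field_simps)
  have Gcont: "continuous_on A G" for A unfolding G_def by (intro continuous_intros) (use x in auto)
  have Tder: "(T n has_real_derivative T' n y) (at y within A)" for n y A
  proof -
    have "((\<lambda>y. G (y + c)) has_real_derivative G' (y + c)) (at y within A)" for c
      unfolding G_def G'_def using x by (auto intro!: derivative_eq_intros simp: field_simps)
    moreover have "((\<lambda>y. G (y - c)) has_real_derivative G' (y - c)) (at y within A)" for c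
      unfolding G_def G'_def using x by (auto intro!: derivative_eq_intros simp: field_simps)
    ultimately have "((\<lambda>y. G (y + real (Suc n)) + G (y - real (Suc n))) has_real_derivative G' (y + real (Suc n)) + G' (y - real (Suc n))) (at y within A)"
      by (rule DERIV_add)
    thus ?thesis by (simp add: T_def[abs_def] T'_def)
  qed
  have Gle: "G z \<le> exp (- \<alpha> * real n)" if "\<bar>z\<bar> \<ge> real n" for z n
  proof -
    have "real n \<le> (real n)\<^sup>2" by (cases n) (auto simp: power2_eq_square)
    also have "\<dots> \<le> z\<^sup>2" using that by (metis abs_le_square_iff abs_of_nat)
    finally have "pi / x * real n \<le> pi / x * z\<^sup>2" using x by (intro mult_left_mono) auto
    thus ?thesis by (simp add: G_def \<alpha>_def)
  qed
  have Gpos: "G z > 0" for z by (simp add: G_def)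
  have zb: "\<bar>y + real (Suc n)\<bar> \<ge> real n" "\<bar>y - real (Suc n)\<bar> \<ge> real n"
    "\<bar>y + real (Suc n)\<bar> \<le> real n + 2" "\<bar>y - real (Suc n)\<bar> \<le> real n + 2" if "y \<in> {-1..1}" for y n
    using that by auto
  have Tle: "norm (T n y) \<le> 2 * ((real n + 2) * exp (- \<alpha> * real n))" if "y \<in> {-1..1}" for n y
  proof -
    have "norm (T n y) \<le> 2 * (1 * exp (- \<alpha> * real n))"
      using Gle[OF zb(1)[OF that, of n]] Gle[OF zb(2)[OF that, of n]] Gpos[of "y + real (Suc n)"] Gpos[of "y - real (Suc n)"]
      unfolding T_def real_norm_def by linarith
    also have "\<dots> \<le> 2 * ((real n + 2) * exp (- \<alpha> * real n))" by (intro mult_left_mono mult_right_mono) auto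
    finally show ?thesis .
  qed
  have G'le: "norm (G' z) \<le> (2 * pi / x) * ((real n + 2) * exp (- \<alpha> * real n))" if "real n \<le> \<bar>z\<bar>" "\<bar>z\<bar> \<le> real n + 2" for z n
  proof -
    have "norm (G' z) = (2 * pi / x) * (\<bar>z\<bar> * G z)" using x Gpos[of z] by (simp add: G'_def abs_mult)
    also have "\<dots> \<le> (2 * pi / x) * ((real n + 2) * exp (- \<alpha> * real n))"
      using Gle[OF that(1)] that x Gpos[of z] by (intro mult_left_mono mult_mono) auto
    finally show ?thesis .
  qed
  have T'le: "norm (T' n y) \<le> 2 * (2 * pi / x) * ((real n + 2) * exp (- \<alpha> * real n))" if "y \<in> {-1..1}" for n y
    using norm_triangle_mono[OF G'le[OF zb(1,3)[OF that, of n]] G'le[OF zb(2,4)[OF that, of n]]]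
    unfolding T'_def by (simp only: mult.assoc mult_2 distrib_right)
  have sG: "summable (\<lambda>n. C * ((real n + 2) * exp (- \<alpha> * real n)))" for C
    by (intro summable_mult summable_gaussian \<alpha>)
  have uT: "uniform_limit {-1..1} (\<lambda>N y. \<Sum>n<N. T n y) (\<lambda>y. \<Sum>n. T n y) sequentially"
    by (rule Weierstrass_m_test[OF Tle sG])
  have uT': "uniformly_convergent_on {-1..1} (\<lambda>N y. \<Sum>n<N. T' n y)"
    unfolding uniformly_convergent_on_def by (rule exI, rule Weierstrass_m_test[OF T'le sG])
  have sT: "summable (\<lambda>n. T n y)" if "y \<in> {-1..1}" for y
    by (rule summable_comparison_test'[OF sG Tle[OF that]])
  have Pder: "(P has_real_derivative (G' y + (\<Sum>n. T' n y))) (at y)" if "y \<in> {-1<..<1}" for y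
    unfolding P_def[abs_def]
    by (intro DERIV_add Gder has_field_derivative_series'(2)[of "{-1..1}" T T' 0] Tder uT' sT) (use that in auto)
  have Pcont: "continuous_on {-1/2..1/2} P"
    by (intro continuous_at_imp_continuous_on ballI DERIV_isCont[OF Pder]) auto
  have lim1: "(\<lambda>K. integral {-1/2..1/2} (\<lambda>y. P y * dirichlet_kernel K y)) \<longlonglongrightarrow> P 0"
    by (rule dirichlet_kernel_tendsto[OF Pcont Pder]) auto
  \<comment> \<open>The kernel has period 1, so integrating the periodised Gaussian over one period
    amounts to integrating the Gaussian over the line; the cosines in the kernel then pick out
    values of its Fourier transform.\<close>
  have val: "integral {-1/2..1/2} (\<lambda>y. P y * dirichlet_kernel K y)
      = sqrt x * (1 + 2 * (\<Sum>n<K. exp (- (pi * (real (Suc n))\<^sup>2 * x))))" for K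
  proof -
    define f where "f y = G y * dirichlet_kernel K y" for y
    have fcont: "continuous_on A f" for A unfolding f_def by (intro continuous_intros Gcont)
    have "has_bochner_integral lborel (\<lambda>y. G y * cos (2 * pi * 0 * y) + (\<Sum>n<K. 2 * (G y * cos (2 * pi * real (Suc n) * y))))
        (sqrt x * exp (- (pi * 0\<^sup>2 * x)) + (\<Sum>n<K. 2 * (sqrt x * exp (- (pi * (real (Suc n))\<^sup>2 * x)))))"
      unfolding G_def
      by (intro has_bochner_integral_add has_bochner_integral_sum has_bochner_integral_mult_right gaussian_cos_integral x)
    also have "(\<lambda>y. G y * cos (2 * pi * 0 * y) + (\<Sum>n<K. 2 * (G y * cos (2 * pi * real (Suc n) * y)))) = f"
      by (simp add: f_def dirichlet_kernel_def fun_eq_iff sum_distrib_left algebra_simps)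
    also have "sqrt x * exp (- (pi * 0\<^sup>2 * x)) + (\<Sum>n<K. 2 * (sqrt x * exp (- (pi * (real (Suc n))\<^sup>2 * x))))
        = sqrt x * (1 + 2 * (\<Sum>n<K. exp (- (pi * (real (Suc n))\<^sup>2 * x))))"
      by (simp add: sum_distrib_left algebra_simps)
    finally have bi: "has_bochner_integral lborel f (sqrt x * (1 + 2 * (\<Sum>n<K. exp (- (pi * (real (Suc n))\<^sup>2 * x)))))" .
    define S where "S N = {- (real N + 1/2)..real N + 1/2}" for N
    have "(\<lambda>N. LINT y|lborel. indicator (S N) y *\<^sub>R f y) \<longlonglongrightarrow> (LINT y|lborel. f y)"
    proof (rule integral_dominated_convergence[where w = "\<lambda>y. norm (f y)"])
      show "AE y in lborel. (\<lambda>N. indicator (S N) y *\<^sub>R f y) \<longlonglongrightarrow> f y"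
      proof (rule AE_I2)
        fix y :: real
        have "\<forall>\<^sub>F N in sequentially. real N \<ge> \<bar>y\<bar>" by real_asymp
        hence "\<forall>\<^sub>F N in sequentially. indicator (S N) y *\<^sub>R f y = f y"
          by eventually_elim (auto simp: S_def indicator_def)
        thus "(\<lambda>N. indicator (S N) y *\<^sub>R f y) \<longlonglongrightarrow> f y" by (rule tendsto_eventually)
      qed
    qed (use bi in \<open>auto simp: has_bochner_integral_iff S_def indicator_def\<close>)
    moreover have "(LINT y|lborel. indicator (S N) y *\<^sub>R f y) = integral (S N) f" for N
    proof -
      have "set_integrable lborel (S N) f" unfolding S_def by (intro borel_integrable_atLeastAtMost' fcont)
      from set_borel_integral_eq_integral(2)[OF this] show ?thesis by (simp add: set_lebesgue_integral_def)
    qed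
    moreover have "integral (S N) f = integral {-1/2..1/2} (\<lambda>y. (G y + (\<Sum>n<N. T n y)) * dirichlet_kernel K y)" for N
    proof -
      have k: "dirichlet_kernel K (y + real (Suc n)) = dirichlet_kernel K y" "dirichlet_kernel K (y - real (Suc n)) = dirichlet_kernel K y" for y n
        using dirichlet_kernel_shift[of K y "int (Suc n)"] dirichlet_kernel_shift[of K "y - real (Suc n)" "int (Suc n)"] by simp_all
      show ?thesis unfolding S_def integral_symmetric_split[OF fcont] f_def k
        by (simp add: T_def algebra_simps sum_distrib_left)
    qed
    ultimately have l1: "(\<lambda>N. integral {-1/2..1/2} (\<lambda>y. (G y + (\<Sum>n<N. T n y)) * dirichlet_kernel K y)) \<longlonglongrightarrow> (LINT y|lborel. f y)" by simp
    have ul: "uniform_limit {-1/2..1/2} (\<lambda>N y. (G y + (\<Sum>n<N. T n y)) * dirichlet_kernel K y) (\<lambda>y. P y * dirichlet_kernel K y) sequentially"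
    proof (rule uniform_lim_mult)
      show "uniform_limit {-1/2..1/2} (\<lambda>N y. G y + (\<Sum>n<N. T n y)) P sequentially"
        unfolding P_def[abs_def] by (intro uniform_limit_intros uniform_limit_on_subset[OF uT]) auto
      show "uniform_limit {-1/2..1/2} (\<lambda>N. dirichlet_kernel K) (dirichlet_kernel K) sequentially" by (rule uniform_limit_const)
      show "bounded (P ` {-1/2..1/2})" by (intro compact_imp_bounded compact_continuous_image Pcont) auto
      show "bounded (dirichlet_kernel K ` {-1/2..1/2})" by (intro compact_imp_bounded compact_continuous_image continuous_intros) auto
    qed
    have "(\<lambda>N. integral {-1/2..1/2} (\<lambda>y. (G y + (\<Sum>n<N. T n y)) * dirichlet_kernel K y)) \<longlonglongrightarrow> integral {-1/2..1/2} (\<lambda>y. P y * dirichlet_kernel K y)"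
    proof -
      have "continuous_on {-1/2..1/2} (T n)" for n
        by (intro continuous_at_imp_continuous_on ballI DERIV_isCont[OF Tder])
      hence cN: "continuous_on {-1/2..1/2} (\<lambda>y. (G y + (\<Sum>n<N. T n y)) * dirichlet_kernel K y)" for N
        by (intro continuous_intros Gcont)
      obtain I J where IJ: "\<And>N. ((\<lambda>y. (G y + (\<Sum>n<N. T n y)) * dirichlet_kernel K y) has_integral I N) {-1/2..1/2}"
        "((\<lambda>y. P y * dirichlet_kernel K y) has_integral J) {-1/2..1/2}" "I \<longlonglongrightarrow> J"
        by (rule uniform_limit_integral[OF ul cN]) auto
      show ?thesis unfolding integral_unique[OF IJ(1)] integral_unique[OF IJ(2)] by (rule IJ(3))
    qed
    from LIMSEQ_unique[OF l1 this] bi show ?thesis by (simp add: has_bochner_integral_iff)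
  qed
  have "summable (\<lambda>n. exp (- (pi * (real (Suc n))\<^sup>2 * x)))"
  proof (rule summable_comparison_test'[OF summable_gaussian[of "pi * x"]])
    fix n :: nat
    have "real n * 1 \<le> real (Suc n) * real (Suc n)" by (intro mult_mono) auto
    hence "pi * x * real n \<le> pi * x * (real (Suc n))\<^sup>2" using x by (intro mult_left_mono) (auto simp: power2_eq_square)
    hence "exp (- (pi * (real (Suc n))\<^sup>2 * x)) \<le> 1 * exp (- (pi * x) * real n)" by (simp add: algebra_simps)
    also have "\<dots> \<le> (real n + 2) * exp (- (pi * x) * real n)" by (intro mult_right_mono) auto
    finally show "norm (exp (- (pi * (real (Suc n))\<^sup>2 * x))) \<le> (real n + 2) * exp (- (pi * x) * real n)" by simp
  qed (use x in auto)
  hence "(\<lambda>K. sqrt x * (1 + 2 * (\<Sum>n<K. exp (- (pi * (real (Suc n))\<^sup>2 * x))))) \<longlonglongrightarrow> sqrt x * (1 + 2 * (\<Sum>n. exp (- (pi * (real (Suc n))\<^sup>2 * x))))"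
    by (intro tendsto_intros summable_LIMSEQ)
  with lim1 have "P 0 = sqrt x * (1 + 2 * (\<Sum>n. exp (- (pi * (real (Suc n))\<^sup>2 * x))))"
    unfolding val by (rule LIMSEQ_unique)
  moreover have "P 0 = 1 + 2 * (\<Sum>n. exp (- (pi * (real (Suc n))\<^sup>2 / x)))"
  proof -
    have T0: "T n 0 = 2 * exp (- (pi * (real (Suc n))\<^sup>2 / x))" for n by (simp add: T_def G_def del: of_nat_Suc)
    hence "summable (\<lambda>n. 1/2 * (2 * exp (- (pi * (real (Suc n))\<^sup>2 / x))))"
      using sT[of 0] by (intro summable_mult) (simp add: T0)
    hence "(\<Sum>n. 2 * exp (- (pi * (real (Suc n))\<^sup>2 / x))) = 2 * (\<Sum>n. exp (- (pi * (real (Suc n))\<^sup>2 / x)))"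
      by (subst suminf_mult) auto
    thus ?thesis unfolding P_def T0 by (simp add: G_def)
  qed
  ultimately show ?thesis by simp
qed

section \<open>The theta function on the right half plane\<close>

definition pi_sq :: "nat \<Rightarrow> real" where
  "pi_sq n = pi * (real (Suc n))\<^sup>2"

lemma pi_sq_ge: "pi_sq n \<ge> pi * (real n + 1)"
  unfolding pi_sq_def by (intro mult_left_mono) (auto simp: power2_eq_square algebra_simps)

lemma pi_sq_pos: "pi_sq n > 0"
  unfolding pi_sq_def by simp

text \<open>The Jacobi theta function, the sum of exp(-pi n^2 z) over all integers n, is
  \<open>1 + 2 * half_theta z\<close>.\<close>

definition half_theta :: "complex \<Rightarrow> complex" where
  "half_theta z = (\<Sum>n. exp (- (of_real (pi_sq n) * z)))"

lemma norm_exp_pi_sq_le: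
  assumes "Re z \<ge> d" "d > 0"
  shows "norm (exp (- (of_real (pi_sq n) * z))) \<le> (real n + 2) * exp (- (pi * d) * real n)"
proof -
  have "(pi * (real n + 1)) * d \<le> pi_sq n * Re z"
    using assms pi_sq_ge[of n] pi_sq_pos[of n] by (intro mult_mono) auto
  moreover have "pi * d > 0" using assms by simp
  ultimately have "- (pi_sq n * Re z) \<le> - (pi * d) * real n" by (simp add: algebra_simps)
  hence "norm (exp (- (of_real (pi_sq n) * z))) \<le> 1 * exp (- (pi * d) * real n)" by simp
  also have "\<dots> \<le> (real n + 2) * exp (- (pi * d) * real n)" by (intro mult_right_mono) auto
  finally show ?thesis .
qed

lemma summable_half_theta:
  assumes "Re z > 0" shows "summable (\<lambda>n. norm (exp (- (of_real (pi_sq n) * z))))"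
  by (rule summable_comparison_test'[OF summable_gaussian[of "pi * Re z"]])
     (use assms norm_exp_pi_sq_le[OF order.refl assms] in auto)

lemma holomorphic_half_theta: "half_theta holomorphic_on {z. Re z > 0}"
proof (rule holomorphic_uniform_sequence[where f = "\<lambda>N z. \<Sum>n<N. exp (- (of_real (pi_sq n) * z))"])
  show "open {z. Re z > 0}" by (rule open_halfspace_Re_gt)
  show "(\<lambda>z. \<Sum>n<N. exp (- (of_real (pi_sq n) * z))) holomorphic_on {z. Re z > 0}" for N
    by (intro holomorphic_intros)
  fix z :: complex assume "z \<in> {z. Re z > 0}"
  hence z: "Re z > 0" by simp
  define d where "d = Re z / 2"
  have d: "d > 0" using z by (simp add: d_def)
  have inb: "Re s \<ge> d" if "s \<in> cball z d" for s
    using abs_Re_le_cmod[of "s - z"] that by (auto simp: d_def dist_norm norm_minus_commute)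
  have "uniform_limit (cball z d) (\<lambda>N z. \<Sum>n<N. exp (- (of_real (pi_sq n) * z))) half_theta sequentially"
    unfolding half_theta_def
    by (rule Weierstrass_m_test[OF norm_exp_pi_sq_le[OF inb d] summable_gaussian]) (use d in auto)
  moreover have "cball z d \<subseteq> {z. Re z > 0}" using inb d by force
  ultimately show "\<exists>d>0. cball z d \<subseteq> {z. Re z > 0} \<and>
      uniform_limit (cball z d) (\<lambda>N z. \<Sum>n<N. exp (- (of_real (pi_sq n) * z))) half_theta sequentially"
    using d by blast
qed

definition rhalf_theta :: "real \<Rightarrow> real" where
  "rhalf_theta x = (\<Sum>n. exp (- (pi_sq n * x)))"

lemma summable_rhalf_theta: "x > 0 \<Longrightarrow> summable (\<lambda>n. exp (- (pi_sq n * x)))"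
  using summable_half_theta[of "of_real x"] by simp

lemma half_theta_of_real:
  assumes "x > 0" shows "half_theta (of_real x) = of_real (rhalf_theta x)"
proof -
  have "(\<lambda>n. of_real (exp (- (pi_sq n * x)))) sums complex_of_real (rhalf_theta x)"
    unfolding rhalf_theta_def by (intro sums_of_real summable_sums summable_rhalf_theta assms)
  also have "(\<lambda>n. complex_of_real (exp (- (pi_sq n * x)))) = (\<lambda>n. exp (- (of_real (pi_sq n) * of_real x)))"
    by (simp add: exp_of_real[symmetric])
  finally show ?thesis by (simp add: half_theta_def sums_iff)
qed

text \<open>The identity theorem extends \<open>theta_inversion_real\<close> from the positive
  reals; \<open>exp (Ln z / 2)\<close> is the principal square root.\<close>

lemma theta_inversion:
  assumes "Re z > 0"
  shows "1 + 2 * half_theta (1 / z) = exp (Ln z / 2) * (1 + 2 * half_theta z)"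
proof -
  define S where "S = {z. Re z > 0}"
  define f where "f z = 1 + 2 * half_theta (1 / z) - exp (Ln z / 2) * (1 + 2 * half_theta z)" for z
  have inv: "Re (1 / w) > 0" if "w \<in> S" for w
  proof -
    have "w \<noteq> 0" using that by (auto simp: S_def)
    hence "Re (1 / w) = Re w / norm w ^ 2" unfolding cmod_power2 by (simp add: Re_divide)
    thus ?thesis using that \<open>w \<noteq> 0\<close> by (simp add: S_def)
  qed
  have "f z = 0"
  proof (rule analytic_continuation[of f S "complex_of_real ` {0<..}" 1])
    have "(\<lambda>z. 1 / z) holomorphic_on S" by (intro holomorphic_intros) (auto simp: S_def)
    moreover have "(\<lambda>z. 1 / z) ` S \<subseteq> {z. Re z > 0}" using inv by blast
    ultimately have "(half_theta \<circ> (\<lambda>z. 1 / z)) holomorphic_on S"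
      by (rule holomorphic_on_compose_gen[OF _ holomorphic_half_theta])
    hence 1: "(\<lambda>z. half_theta (1 / z)) holomorphic_on S" by (simp add: o_def)
    have 2: "half_theta holomorphic_on S" using holomorphic_half_theta by (simp add: S_def)
    have 3: "Ln holomorphic_on S" by (rule holomorphic_on_Ln) (auto simp: S_def complex_nonpos_Reals_iff)
    show "f holomorphic_on S" unfolding f_def using 3 by (intro holomorphic_intros 1 2 3)  auto
    show "open S" unfolding S_def by (rule open_halfspace_Re_gt)
    show "connected S" unfolding S_def by (intro convex_connected convex_halfspace_Re_gt)
    show "complex_of_real ` {0<..} \<subseteq> S" by (auto simp: S_def)
    show "1 \<in> S" "z \<in> S" using assms by (auto simp: S_def)
    show "1 islimpt complex_of_real ` {0<..}"
      unfolding islimpt_sequential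
    proof (intro exI[of _ "\<lambda>n. of_real (1 + 1 / real (Suc n))"] conjI allI)
      fix n
      have "1 + 1 / real (Suc n) \<noteq> 1" "1 + 1 / real (Suc n) > 0" by (auto simp: add_pos_pos)
      thus "complex_of_real (1 + 1 / real (Suc n)) \<in> complex_of_real ` {0<..} - {1}"
        by (metis Diff_iff empty_iff greaterThan_iff image_eqI insert_iff of_real_eq_1_iff)
      have "(\<lambda>n. complex_of_real (1 + 1 / real (Suc n))) \<longlonglongrightarrow> of_real (1 + 0)"
        by (intro tendsto_intros LIMSEQ_Suc lim_1_over_n)
      thus "(\<lambda>n. complex_of_real (1 + 1 / real (Suc n))) \<longlonglongrightarrow> 1" by simp
    qed
    fix w assume "w \<in> complex_of_real ` {0<..}"
    then obtain x where x: "x > 0" "w = of_real x" by auto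
    have A: "1 + 2 * rhalf_theta (1 / x) = sqrt x * (1 + 2 * rhalf_theta x)"
      using theta_inversion_real[OF x(1)] by (simp add: rhalf_theta_def pi_sq_def)
    have B: "half_theta (1 / w) = of_real (rhalf_theta (1 / x))"
      using half_theta_of_real[of "1 / x"] x by simp
    have E: "exp (Ln w / 2) = of_real (sqrt x)"
    proof -
      have "exp (Ln w / 2) = of_real (exp (ln x / 2))" using x by (simp add: Ln_of_real exp_of_real[symmetric])
      also have "exp (ln x / 2) = sqrt x" using x by (simp add: powr_half_sqrt[symmetric] powr_def)
      finally show ?thesis .
    qed
    have D: "half_theta w = of_real (rhalf_theta x)" using half_theta_of_real x by simp
    have "f w = of_real ((1 + 2 * rhalf_theta (1 / x)) - sqrt x * (1 + 2 * rhalf_theta x))"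
      unfolding f_def B D E by simp
    also have "\<dots> = 0" unfolding A by simp
    finally show "f w = 0" .
  qed
  thus ?thesis by (simp add: f_def)
qed

lemma cnj_half_theta:
  assumes "Re z > 0" shows "cnj (half_theta z) = half_theta (cnj z)"
proof -
  have "summable (\<lambda>n. exp (- (of_real (pi_sq n) * z)))" by (rule summable_norm_cancel[OF summable_half_theta[OF assms]])
  hence "(\<lambda>n. cnj (exp (- (of_real (pi_sq n) * z)))) sums cnj (half_theta z)"
    unfolding half_theta_def sums_cnj by (rule summable_sums)
  also have "(\<lambda>n. cnj (exp (- (of_real (pi_sq n) * z)))) = (\<lambda>n. exp (- (of_real (pi_sq n) * cnj z)))"
    by (simp add: exp_cnj)
  finally show ?thesis by (simp add: half_theta_def sums_iff)
qed

text \<open>On the unit circle 1 / z is the conjugate of z. Inversion therefore says that theta,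
  multiplied by the fourth root of z, equals its own conjugate.\<close>

lemma half_theta_cis_real:
  assumes "\<bar>y\<bar> < pi / 2"
  shows "Im (exp (\<i> * of_real (y / 4)) * (1 + 2 * half_theta (cis y))) = 0"
proof -
  have re: "Re (cis y) > 0" using assms by (auto intro: cos_gt_zero_pi)
  have ln: "Ln (cis y) = \<i> * of_real y" unfolding cis_conv_exp using assms by (subst Ln_exp) auto
  define w where "w = exp (\<i> * of_real (y / 4)) * (1 + 2 * half_theta (cis y))"
  have "cnj w = exp (- (\<i> * of_real (y / 4))) * (1 + 2 * half_theta (cnj (cis y)))"
    unfolding w_def cnj_half_theta[OF re, symmetric] by (simp add: exp_cnj)
  also have "cnj (cis y) = 1 / cis y" by (simp add: cis_cnj cis_inverse[symmetric] inverse_eq_divide del: cis_inverse)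
  also have "1 + 2 * half_theta (1 / cis y) = exp (Ln (cis y) / 2) * (1 + 2 * half_theta (cis y))"
    by (rule theta_inversion[OF re])
  also have "exp (- (\<i> * of_real (y / 4))) * (exp (Ln (cis y) / 2) * (1 + 2 * half_theta (cis y))) = w"
    unfolding ln w_def by (simp add: exp_add[symmetric] mult.assoc[symmetric])
  finally have "cnj w = w" .
  hence "Im w = 0" by (metis Reals_cnj_iff complex_is_Real_iff)
  thus ?thesis by (simp add: w_def)
qed

section \<open>The Mellin transform of the theta function\<close>

text \<open>Euler's integral after the substitution t = exp v, carried out for the real and the
  imaginary part separately.\<close>

lemma integrable_mellin_exp_Gamma:
  fixes a :: complex
  assumes a: "Re a > 0"
  shows "has_bochner_integral lborel (\<lambda>v. exp (a * of_real v - of_real (exp v))) (Gamma a)"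
proof -
  define h where "h v = exp (a * of_real v - of_real (exp v))" for v :: real
  define f where "f t = complex_of_real t powr (a - 1) / of_real (exp t)" for t
  have hf: "exp v *\<^sub>R f (exp v) = h v" for v
  proof -
    have "complex_of_real (exp v) powr (a - 1) = exp ((a - 1) * of_real v)"
      by (simp add: powr_def Ln_of_real)
    hence "exp v *\<^sub>R f (exp v) = exp (of_real v) * (exp ((a - 1) * of_real v) / exp (of_real (exp v)))"
      unfolding f_def scaleR_conv_of_real by (simp only: exp_of_real)
    also have "\<dots> = exp (of_real v + (a - 1) * of_real v - of_real (exp v))" by (simp only: exp_add exp_diff times_divide_eq_right)
    also have "\<dots> = h v" unfolding h_def by (rule arg_cong[of _ _ exp]) (simp add: algebra_simps)
    finally show ?thesis .
  qed
  have meas: "h \<in> borel_measurable lborel"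
  proof -
    have "continuous_on UNIV h" unfolding h_def by (intro continuous_intros)
    thus ?thesis using borel_measurable_continuous_onI by (simp add: measurable_lborel1)
  qed
  have img: "exp ` (UNIV :: real set) = {0<..}" by (auto simp: image_iff) (metis exp_ln)
  have fint: "f absolutely_integrable_on {0<..}" "integral {0<..} f = Gamma a"
    using absolutely_integrable_Gamma_integral'[OF a] Gamma_integral_complex'[OF a] unfolding f_def
    by (auto simp: integral_unique)
  have key: "integrable lborel (\<lambda>v. p (h v)) \<and> integral UNIV (\<lambda>v. p (h v)) = p (Gamma a)" if p: "p = Re \<or> p = Im" for p :: "complex \<Rightarrow> real"
  proof -
    have bl: "bounded_linear p" using p bounded_linear_Re bounded_linear_Im by blast
    have "(\<lambda>t. p (f t)) absolutely_integrable_on {0<..}"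
      using absolutely_integrable_linear[OF fint(1) bl] by (simp add: o_def)
    moreover have "integral {0<..} (\<lambda>t. p (f t)) = p (Gamma a)"
      using integral_linear[OF set_lebesgue_integral_eq_integral(1)[OF fint(1)] bl] fint(2) by (simp add: o_def)
    ultimately have "(\<lambda>t. p (f t)) absolutely_integrable_on (exp ` UNIV) \<and> integral (exp ` UNIV) (\<lambda>t. p (f t)) = p (Gamma a)"
      unfolding img by blast
    hence "(\<lambda>x. \<bar>exp x\<bar> * p (f (exp x))) absolutely_integrable_on UNIV \<and> integral UNIV (\<lambda>x. \<bar>exp x\<bar> * p (f (exp x))) = p (Gamma a)"
      by (subst has_absolute_integral_change_of_variables_1'[where g = exp]) (auto intro!: derivative_eq_intros simp: inj_on_def)
    moreover have "\<bar>exp x\<bar> * p (f (exp x)) = p (h x)" for x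
      using p hf[of x] by (auto simp: hf[symmetric])
    ultimately have "(\<lambda>x. p (h x)) absolutely_integrable_on UNIV" "integral UNIV (\<lambda>x. p (h x)) = p (Gamma a)" by simp_all
    moreover from this(1) have "integrable lebesgue (\<lambda>x. p (h x))" by (simp add: set_integrable_def)
    moreover have "(\<lambda>x. p (h x)) \<in> borel_measurable lborel" using meas p by auto
    ultimately show ?thesis by (simp add: integrable_completion)
  qed
  have hc: "h = (\<lambda>v. of_real (Re (h v)) + \<i> * of_real (Im (h v)))" by (simp add: fun_eq_iff complex_eq)
  have "integrable lborel h" by (subst hc) (use key[of Re] key[of Im] in \<open>auto intro!: Bochner_Integration.integrable_add integrable_mult_right\<close>)
  moreover have "integral\<^sup>L lborel h = Gamma a"
  proof (rule complex_eqI)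
    show "Re (integral\<^sup>L lborel h) = Re (Gamma a)"
      using key[of Re] has_integral_integral_lborel[of "\<lambda>v. Re (h v)"] integral_Re[OF \<open>integrable lborel h\<close>] by (simp add: integral_unique)
    show "Im (integral\<^sup>L lborel h) = Im (Gamma a)"
      using key[of Im] has_integral_integral_lborel[of "\<lambda>v. Im (h v)"] integral_Im[OF \<open>integrable lborel h\<close>] by (simp add: integral_unique)
  qed
  ultimately show ?thesis by (simp add: has_bochner_integral_iff h_def[abs_def])
qed

lemma has_bochner_integral_mellin_exp:
  assumes c: "c > 0"
  shows "has_bochner_integral lborel (\<lambda>v. mellin_exp t c (of_real v))
           (exp (- Complex (1/4) (t/2) * of_real (ln c)) * Gamma (Complex (1/4) (t/2)))"
proof -
  define a where "a = Complex (1/4) (t/2)"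
  have "has_bochner_integral lborel (\<lambda>v. exp (a * of_real (ln c + 1 * v) - of_real (exp (ln c + 1 * v)))) (Gamma a /\<^sub>R \<bar>1\<bar>)"
    by (subst lborel_has_bochner_integral_real_affine_iff[symmetric]) (auto intro!: integrable_mellin_exp_Gamma simp: a_def)
  hence "has_bochner_integral lborel (\<lambda>v. exp (- a * of_real (ln c)) * exp (a * of_real (ln c + 1 * v) - of_real (exp (ln c + 1 * v)))) (exp (- a * of_real (ln c)) * Gamma a)"
    by (intro has_bochner_integral_mult_right) simp
  also have "(\<lambda>v. exp (- a * of_real (ln c)) * exp (a * of_real (ln c + 1 * v) - of_real (exp (ln c + 1 * v)))) = (\<lambda>v. mellin_exp t c (of_real v))"
    using c by (simp add: fun_eq_iff mellin_exp_def a_def exp_add[symmetric] exp_of_real algebra_simps) (simp add: exp_add exp_of_real mult.commute)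
  finally show ?thesis by (simp add: a_def)
qed

lemma integrable_exp_minus_indicator:
  assumes "\<kappa> > 0"
  shows "has_bochner_integral lborel (\<lambda>v::real. indicator {0..} v * exp (- \<kappa> * v)) (1 / \<kappa>)"
proof -
  have "((\<lambda>v::real. exp (- \<kappa> * v)) has_integral 1 / \<kappa>) {0..}"
    using has_integral_exp_minus_to_infinity[OF assms, of 0] by simp
  hence *: "(\<lambda>v::real. exp (- \<kappa> * v)) absolutely_integrable_on {0..}" "integral {0..} (\<lambda>v::real. exp (- \<kappa> * v)) = 1 / \<kappa>"
    by (auto intro!: nonnegative_absolutely_integrable_1 simp: integral_unique integrable_on_def)
  hence "integrable lebesgue (\<lambda>v::real. indicator {0..} v * exp (- \<kappa> * v))" by (simp add: set_integrable_def)
  hence i: "integrable lborel (\<lambda>v::real. indicator {0..} v * exp (- \<kappa> * v))"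
    by (subst (asm) integrable_completion) auto
  hence si: "set_integrable lborel {0..} (\<lambda>v::real. exp (- \<kappa> * v))" by (simp add: set_integrable_def)
  from set_borel_integral_eq_integral(2)[OF this] *(2)
  have "(LINT v::real|lborel. indicator {0..} v * exp (- \<kappa> * v)) = 1 / \<kappa>" by (simp add: set_lebesgue_integral_def)
  with i show ?thesis by (simp add: has_bochner_integral_iff)
qed

text \<open>This lemma and the next turn Lebesgue integrals into limits of an entire primitive along
  the real axis, which is the form that the rotation lemmas take.\<close>

lemma primitive_tendsto_at_top:
  fixes F f :: "real \<Rightarrow> complex"
  assumes der: "\<And>v. (F has_vector_derivative f v) (at v)" and cont: "continuous_on UNIV f"
    and int: "integrable lborel (\<lambda>v. indicator {0..} v *\<^sub>R f v)"
  shows "(F \<longlongrightarrow> F 0 + (LINT v|lborel. indicator {0..} v *\<^sub>R f v)) at_top"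
proof -
  have "((\<lambda>y. F 0 + (LINT v|lborel. indicator {..y} v *\<^sub>R (indicator {0..} v *\<^sub>R f v))) \<longlongrightarrow> F 0 + (LINT v|lborel. indicator {0..} v *\<^sub>R f v)) at_top"
    by (intro tendsto_intros tendsto_integral_at_top int) auto
  moreover have "\<forall>\<^sub>F y in at_top. F 0 + (LINT v|lborel. indicator {..y} v *\<^sub>R (indicator {0..} v *\<^sub>R f v)) = F y"
    using eventually_ge_at_top[of 0]
  proof eventually_elim
    case (elim y)
    have "(LINT v|lborel. indicator {..y} v *\<^sub>R (indicator {0..} v *\<^sub>R f v)) = (LINT v|lborel. indicator {0..y} v *\<^sub>R f v)"
      by (intro Bochner_Integration.integral_cong) (auto simp: indicator_def)
    also have "\<dots> = F y - F 0"
      using elim by (intro integral_FTC_atLeastAtMost has_vector_derivative_at_within[OF der] continuous_on_subset[OF cont]) auto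
    finally show ?case by simp
  qed
  ultimately show ?thesis by (rule Lim_transform_eventually)
qed

lemma primitive_tendsto_at_bot:
  fixes F f :: "real \<Rightarrow> complex"
  assumes der: "\<And>v. (F has_vector_derivative f v) (at v)" and cont: "continuous_on UNIV f"
    and int: "integrable lborel f"
  shows "(F \<longlongrightarrow> F 0 + (LINT v|lborel. indicator {0..} v *\<^sub>R f v) - (LINT v|lborel. f v)) at_bot"
proof -
  have ind: "integrable lborel (\<lambda>v. indicator A v *\<^sub>R f v)" if "A \<in> sets borel" for A
    using that by (intro integrable_mult_indicator int) auto
  have "((\<lambda>v. F (- v)) \<longlongrightarrow> F (- 0) + (LINT v|lborel. indicator {0..} v *\<^sub>R (- f (- v)))) at_top"
  proof (rule primitive_tendsto_at_top)
    fix v :: real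
    have "(uminus has_vector_derivative (-1)) (at v)" by (auto intro!: derivative_eq_intros)
    from vector_diff_chain_at[OF this der] show "((\<lambda>v. F (- v)) has_vector_derivative - f (- v)) (at v)" by (simp add: o_def)
    have "continuous_on UNIV (\<lambda>v. f (- v))" by (intro continuous_on_compose2[OF cont]) (auto intro!: continuous_intros)
    thus "continuous_on UNIV (\<lambda>v. - f (- v))" by (intro continuous_intros)
    have "integrable lborel (\<lambda>v. indicator {..0} (0 + (-1) * v) *\<^sub>R f (0 + (-1) * v))"
      by (subst lborel_integrable_real_affine_iff[where f = "\<lambda>v. indicator {..0} v *\<^sub>R f v"]) (auto intro: ind)
    hence "integrable lborel (\<lambda>v. - (indicator {..0} (- v) *\<^sub>R f (- v)))" by simp
    also have "(\<lambda>v. - (indicator {..0} (- v) *\<^sub>R f (- v))) = (\<lambda>v. indicator {0..} v *\<^sub>R (- f (- v)))"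
      by (auto simp: fun_eq_iff indicator_def)
    finally show "integrable lborel (\<lambda>v. indicator {0..} v *\<^sub>R (- f (- v)))" .
  qed
  also have "(LINT v|lborel. indicator {0..} v *\<^sub>R (- f (- v))) = - (LINT v|lborel. indicator {..0} v *\<^sub>R f v)"
  proof -
    have "(LINT v|lborel. indicator {..0} v *\<^sub>R f v) = (LINT v|lborel. indicator {..0} (0 + (-1) * v) *\<^sub>R f (0 + (-1) * v))"
      using lborel_integral_real_affine[of "-1" "\<lambda>v. indicator {..0} v *\<^sub>R f v" 0] by simp
    also have "\<dots> = (LINT v|lborel. - (indicator {0..} v *\<^sub>R (- f (- v))))"
      by (intro Bochner_Integration.integral_cong) (auto simp: indicator_def)
    also have "\<dots> = - (LINT v|lborel. indicator {0..} v *\<^sub>R (- f (- v)))" by (rule Bochner_Integration.integral_minus)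
    finally show ?thesis by simp
  qed
  also have "(LINT v|lborel. indicator {..0} v *\<^sub>R f v) = (LINT v|lborel. f v) - (LINT v|lborel. indicator {0..} v *\<^sub>R f v)"
  proof -
    have "(LINT v|lborel. f v) = (LINT v|lborel. indicator {..0} v *\<^sub>R f v + indicator {0..} v *\<^sub>R f v)"
    proof (rule integral_cong_AE)
      have "AE v in lborel. v \<noteq> (0::real)" by (rule AE_lborel_singleton)
      thus "AE v in lborel. f v = indicator {..0} v *\<^sub>R f v + indicator {0..} v *\<^sub>R f v"
        by eventually_elim (auto simp: indicator_def)
    qed (use ind int in auto)
    also have "\<dots> = (LINT v|lborel. indicator {..0} v *\<^sub>R f v) + (LINT v|lborel. indicator {0..} v *\<^sub>R f v)"
      by (intro Bochner_Integration.integral_add ind) auto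
    finally show ?thesis by simp
  qed
  finally have "((\<lambda>v. F (- v)) \<longlongrightarrow> F 0 + (LINT v|lborel. indicator {0..} v *\<^sub>R f v) - (LINT v|lborel. f v)) at_top"
    by (simp add: algebra_simps)
  thus ?thesis by (subst filterlim_at_bot_mirror) simp
qed

text \<open>The Mellin transform of theta at the exponent a = s / 2 with s = 1/2 + it. For x = exp v
  near 0, \<open>rhalf_theta x\<close> behaves like x^(-1/2) / 2, which is not integrable against
  x^(a-1); removing this term makes the integral converge at both ends.\<close>

definition mellin_zeta :: "real \<Rightarrow> complex" where
  "mellin_zeta t = (LINT v|lborel. exp (Complex (1/4) (t/2) * of_real v) * of_real (rhalf_theta (exp v) - exp (- v / 2) / 2))"

lemma laplace_exp:
  fixes a :: complex
  assumes a: "Re a > 0"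
  shows "has_bochner_integral lborel (\<lambda>v. indicator {0..} v *\<^sub>R exp (- a * of_real v)) (1 / a)"
proof -
  have a0: "a \<noteq> 0" using a by auto
  have int: "integrable lborel (\<lambda>v. indicator {0..} v *\<^sub>R exp (- a * of_real v))"
  proof (rule Bochner_Integration.integrable_bound)
    show "integrable lborel (\<lambda>v::real. indicator {0..} v * exp (- Re a * v))"
      using integrable_exp_minus_indicator[OF a] by (simp add: has_bochner_integral_iff)
  qed (auto simp: indicator_def)
  have "((\<lambda>v. - exp (- a * of_real v) / a) \<longlongrightarrow> - exp (- a * of_real 0) / a + (LINT v|lborel. indicator {0..} v *\<^sub>R exp (- a * of_real v))) at_top"
  proof (rule primitive_tendsto_at_top[OF _ _ int])
    fix v :: real
    have "((\<lambda>w. - exp (- a * w) / a) has_field_derivative exp (- a * of_real v)) (at (of_real v))"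
      using a0 by (auto intro!: derivative_eq_intros)
    from has_vector_derivative_real_field[OF this]
    show "((\<lambda>v. - exp (- a * of_real v) / a) has_vector_derivative exp (- a * of_real v)) (at v)" .
    show "continuous_on UNIV (\<lambda>v. exp (- a * complex_of_real v))" by (intro continuous_intros)
  qed
  moreover have "((\<lambda>v. - exp (- a * of_real v) / a) \<longlongrightarrow> 0) at_top"
  proof (rule Lim_null_comparison)
    show "\<forall>\<^sub>F v in at_top. norm (- exp (- a * of_real v) / a) \<le> exp (- Re a * v) / norm a"
      by (simp add: norm_divide)
    show "((\<lambda>v. exp (- Re a * v) / norm a) \<longlongrightarrow> 0) at_top" using a a0 by real_asymp
  qed
  ultimately have "- exp (- a * of_real 0) / a + (LINT v|lborel. indicator {0..} v *\<^sub>R exp (- a * of_real v)) = 0"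
    using tendsto_unique trivial_limit_at_top_linorder by blast
  hence "(LINT v|lborel. indicator {0..} v *\<^sub>R exp (- a * of_real v)) = 1 / a" by (simp add: add_eq_0_iff)
  with int show ?thesis by (simp add: has_bochner_integral_iff)
qed

lemma integrable_mellin_exp_indicator:
  assumes c: "c > 0"
  shows "integrable lborel (\<lambda>v. indicator {0..} v *\<^sub>R mellin_exp t c (of_real v))"
  using has_bochner_integral_mellin_exp[OF c, of t]
  by (intro integrable_mult_indicator) (auto simp: has_bochner_integral_iff)

lemma mellin_exp_split:
  "mellin_exp t c w = exp (Complex (1/4) (t/2) * w) * exp (- (of_real c * exp w))"
  by (simp only: mellin_exp_def diff_conv_add_uminus exp_add)

text \<open>For v at least 0 the theta series is dominated by a geometric series times exp(-v), so
  sum and integral commute. The other half line is reached by inversion.\<close>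

lemma sums_half_mellin:
  "(\<lambda>n. LINT v|lborel. indicator {0..} v *\<^sub>R mellin_exp t (pi_sq n) (of_real v)) sums
     (LINT v|lborel. indicator {0..} v *\<^sub>R (exp (Complex (1/4) (t/2) * of_real v) * of_real (rhalf_theta (exp v))))"
  "integrable lborel (\<lambda>v. indicator {0..} v *\<^sub>R (exp (Complex (1/4) (t/2) * of_real v) * of_real (rhalf_theta (exp v))))"
proof -
  define f where "f n v = indicator {0..} v *\<^sub>R mellin_exp t (pi_sq n) (of_real v)" for n and v :: real
  have fint: "integrable lborel (f n)" for n
    unfolding f_def by (rule integrable_mellin_exp_indicator[OF pi_sq_pos])
  have fle: "norm (f n v) \<le> exp (- pi * real n) * (indicator {0..} v * exp (- 1 * v))" for n v
  proof (cases "v \<ge> 0")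
    case True
    have c: "pi_sq n \<ge> 3 * (real n + 1)" "pi_sq n \<ge> pi * real n + 3"
      using pi_sq_ge[of n] pi_gt3 mult_right_mono[of 3 pi "real n + 1"] by (auto simp: algebra_simps)
    \<comment> \<open>From exp v \<ge> 1 + v: the 1 yields decay in n and the v yields decay in
      v.\<close>
    have "pi_sq n * (1 + v) \<le> pi_sq n * exp v" using pi_sq_pos[of n] by (intro mult_left_mono) auto
    moreover have "pi_sq n * v \<ge> 3 * v" using c True by (intro mult_right_mono) auto
    ultimately have "v / 4 - pi_sq n * exp v \<le> - pi * real n + - 1 * v" using True c by (simp add: algebra_simps)
    hence "exp (v / 4 - pi_sq n * exp v) \<le> exp (- pi * real n + - 1 * v)" by (subst exp_le_cancel_iff)
    also have "\<dots> = exp (- pi * real n) * exp (- 1 * v)" by (rule exp_add)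
    finally show ?thesis using True by (simp add: f_def norm_mellin_exp)
  qed (simp add: f_def)
  have sg: "summable (\<lambda>n. exp (- pi * real n))"
  proof -
    have "summable (\<lambda>n. exp (- pi) ^ n)" by (rule summable_geometric) simp
    thus ?thesis by (simp add: exp_of_nat_mult[symmetric] mult.commute)
  qed
  have sn: "summable (\<lambda>n. norm (f n v))" for v
    by (rule summable_comparison_test'[OF summable_mult2[OF sg]]) (use fle[of _ v] in simp)
  have eint: "has_bochner_integral lborel (\<lambda>v::real. indicator {0..} v * exp (- 1 * v)) 1"
    using integrable_exp_minus_indicator[of 1] by simp
  have si: "summable (\<lambda>n. LINT v|lborel. norm (f n v))"
  proof (rule summable_comparison_test'[OF sg])
    fix n :: nat
    have "(LINT v|lborel. norm (f n v)) \<le> (LINT v|lborel. exp (- pi * real n) * (indicator {0..} v * exp (- 1 * v)))"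
      using fint[of n] eint fle by (intro integral_mono) (auto simp: has_bochner_integral_iff)
    also have "\<dots> = exp (- pi * real n)" using eint by (simp add: has_bochner_integral_iff)
    finally show "norm (LINT v|lborel. norm (f n v)) \<le> exp (- pi * real n)" by simp
  qed
  have fs: "(\<Sum>n. f n v) = indicator {0..} v *\<^sub>R (exp (Complex (1/4) (t/2) * of_real v) * of_real (rhalf_theta (exp v)))" for v
  proof (cases "v \<ge> 0")
    case True
    have "(\<lambda>n. exp (- (of_real (pi_sq n) * of_real (exp v)))) sums half_theta (of_real (exp v))"
      unfolding half_theta_def by (intro summable_sums summable_norm_cancel[OF summable_half_theta]) simp
    hence "(\<lambda>n. exp (Complex (1/4) (t/2) * of_real v) * exp (- (of_real (pi_sq n) * of_real (exp v)))) sums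
       (exp (Complex (1/4) (t/2) * of_real v) * of_real (rhalf_theta (exp v)))"
      unfolding half_theta_of_real[OF exp_gt_zero] by (rule sums_mult)
    also have "(\<lambda>n. exp (Complex (1/4) (t/2) * of_real v) * exp (- (of_real (pi_sq n) * of_real (exp v)))) = (\<lambda>n. f n v)"
      using True by (simp add: f_def mellin_exp_split exp_of_real)
    finally show ?thesis using True by (simp add: sums_iff)
  qed (simp add: f_def)
  show "(\<lambda>n. LINT v|lborel. indicator {0..} v *\<^sub>R mellin_exp t (pi_sq n) (of_real v)) sums
     (LINT v|lborel. indicator {0..} v *\<^sub>R (exp (Complex (1/4) (t/2) * of_real v) * of_real (rhalf_theta (exp v))))"
    using sums_integral[OF fint AE_I2[OF sn] si] unfolding fs unfolding f_def .
  show "integrable lborel (\<lambda>v. indicator {0..} v *\<^sub>R (exp (Complex (1/4) (t/2) * of_real v) * of_real (rhalf_theta (exp v))))"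
    using integrable_suminf[OF fint AE_I2[OF sn] si] unfolding fs .
qed

lemma mellin_zeta_fold:
  fixes t :: real
  defines "a \<equiv> Complex (1/4) (t/2)"
  defines "I \<equiv> (LINT v|lborel. indicator {0..} v *\<^sub>R (exp (a * of_real v) * of_real (rhalf_theta (exp v))))"
  shows "has_bochner_integral lborel (\<lambda>v. exp (a * of_real v) * of_real (rhalf_theta (exp v) - exp (- v / 2) / 2))
           (of_real (2 * Re I - Re (1 / a)))"
proof -
  define R where "R v = indicator {0..} v *\<^sub>R (exp (a * of_real v) * of_real (rhalf_theta (exp v)))" for v :: real
  define E where "E v = indicator {0..} v *\<^sub>R exp (- a * of_real v)" for v :: real
  have Ri: "has_bochner_integral lborel R I"
    using sums_half_mellin(2)[of t] by (simp add: R_def[abs_def] I_def a_def has_bochner_integral_iff)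
  have Ei: "has_bochner_integral lborel E (1 / a)" unfolding E_def by (rule laplace_exp) (simp add: a_def)
  have cnj': "has_bochner_integral lborel (\<lambda>v. cnj (f v)) (cnj x)" if "has_bochner_integral lborel f x" for f x
    using that by (rule has_bochner_integral_bounded_linear[OF bounded_linear_cnj])
  have neg: "has_bochner_integral lborel (\<lambda>v. f (- v)) x" if "has_bochner_integral lborel f x" for f :: "real \<Rightarrow> complex" and x
    using lborel_has_bochner_integral_real_affine_iff[of "-1" f x 0] that by simp
  \<comment> \<open>Both R and E live on v \<ge> 0. The first bracket is the integrand for v > 0 and
    the second the one for v < 0; they overlap only at v = 0, whence the equality almost everywhere
    in \<open>H3\<close>.\<close>
  have H1: "has_bochner_integral lborel (\<lambda>v. (R v - 1/2 * cnj (E v)) + (cnj (R (- v)) - 1/2 * E (- v))) ((I - 1/2 * cnj (1 / a)) + (cnj I - 1/2 * (1 / a)))"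
    by (intro has_bochner_integral_add has_bochner_integral_diff has_bochner_integral_mult_right Ri Ei cnj' neg)
  have H2: "(I - 1/2 * cnj (1 / a)) + (cnj I - 1/2 * (1 / a)) = of_real (2 * Re I - Re (1 / a))"
  proof -
    define w where "w = 1 / a"
    have "(I - 1/2 * cnj w) + (cnj I - 1/2 * w) = of_real (2 * Re I - Re w)" by (simp add: complex_eq_iff)
    thus ?thesis by (simp add: w_def)
  qed
  have H3: "AE v in lborel. (R v - 1/2 * cnj (E v)) + (cnj (R (- v)) - 1/2 * E (- v)) = exp (a * of_real v) * of_real (rhalf_theta (exp v) - exp (- v / 2) / 2)"
  proof -
    have "AE v in lborel. v \<noteq> (0::real)" by (rule AE_lborel_singleton)
    thus ?thesis
    proof eventually_elim
      case (elim v)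
      have ca: "cnj a = 1/2 - a" by (simp add: a_def complex_eq_iff)
      show ?case
      proof (cases "v > 0")
        case True
        have "cnj (exp (- a * of_real v)) = exp (a * of_real v) * of_real (exp (- v / 2))"
        proof -
          have "cnj (exp (- a * of_real v)) = exp (- cnj a * of_real v)" by (simp add: exp_cnj)
          also have "- cnj a * of_real v = a * of_real v + of_real (- v / 2)" by (simp add: ca algebra_simps)
          finally show ?thesis by (simp only: exp_add exp_of_real)
        qed
        thus ?thesis using True by (simp add: R_def E_def algebra_simps)
      next
        case False
        hence v: "v < 0" using elim by simp
        define w where "w = - v"
        have w: "w > 0" using v by (simp add: w_def)
        have th: "rhalf_theta (exp v) = exp (w / 2) * rhalf_theta (exp w) + exp (w / 2) / 2 - 1/2"
        proof -
          have "1 + 2 * rhalf_theta (1 / exp w) = sqrt (exp w) * (1 + 2 * rhalf_theta (exp w))"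
            using theta_inversion_real[of "exp w"] by (simp add: rhalf_theta_def pi_sq_def)
          moreover have "sqrt (exp w) = exp (w / 2)"
            by (rule real_sqrt_unique) (auto simp: power2_eq_square exp_add[symmetric])
          moreover have "1 / exp w = exp v" by (simp add: w_def exp_minus inverse_eq_divide)
          ultimately show ?thesis by (simp add: algebra_simps)
        qed
        have e1: "cnj (exp (a * of_real w)) = exp (a * of_real v) * of_real (exp (w / 2))"
        proof -
          have "cnj (exp (a * of_real w)) = exp (cnj a * of_real w)" by (simp add: exp_cnj)
          also have "cnj a * of_real w = a * of_real v + of_real (w / 2)" by (simp add: ca w_def algebra_simps)
          finally show ?thesis by (simp only: exp_add exp_of_real)
        qed
        have "exp (a * of_real v) * of_real (rhalf_theta (exp v) - exp (- v / 2) / 2)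
            = exp (a * of_real v) * of_real (exp (w / 2)) * of_real (rhalf_theta (exp w)) - exp (a * of_real v) / 2"
          unfolding th by (simp add: w_def algebra_simps)
        also have "\<dots> = cnj (R w) - 1/2 * E w"
          using w unfolding e1[symmetric] by (simp add: R_def E_def w_def)
        finally show ?thesis using v by (simp add: R_def E_def w_def)
      qed
    qed
  qed
  have H4: "(\<lambda>v. exp (a * of_real v) * of_real (rhalf_theta (exp v) - exp (- v / 2) / 2)) \<in> borel_measurable lborel"
  proof -
    have "rhalf_theta \<in> borel_measurable borel"
      unfolding rhalf_theta_def by measurable
    thus ?thesis by measurable
  qed
  show ?thesis using has_bochner_integralI_AE[OF H1 H4 H3] unfolding H2 .
qed

lemma alternating_sum_bounds:
  fixes b :: "nat \<Rightarrow> real"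
  assumes "\<And>n. b n \<ge> 0" "\<And>n. b (Suc n) \<le> b n"
  shows "0 \<le> (\<Sum>n<N. (-1)^n * b n) \<and> (\<Sum>n<N. (-1)^n * b n) \<le> b 0"
  using assms
proof (induction N arbitrary: b)
  case (Suc N)
  have "(\<Sum>n<Suc N. (-1)^n * b n) = b 0 - (\<Sum>n<N. (-1)^n * b (Suc n))"
    by (subst sum.lessThan_Suc_shift) (simp add: sum_negf)
  moreover have "0 \<le> (\<Sum>n<N. (-1)^n * b (Suc n)) \<and> (\<Sum>n<N. (-1)^n * b (Suc n)) \<le> b (Suc 0)"
    using Suc.prems by (intro Suc.IH)
  ultimately show ?case using Suc.prems(2)[of 0] by simp
qed simp

text \<open>Twice the sum over even integers is removed, and since (2n)^2 = 4 n^2 this sum is theta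
  at 4 x. The singular part x^(-1/2) / 2 cancels in the combination, so no regularising term is
  left.\<close>

lemma alternating_theta:
  assumes x: "x > 0"
  shows "(\<lambda>n. (-1)^n * exp (- (pi_sq n * x))) sums (rhalf_theta x - 2 * rhalf_theta (4 * x))"
proof -
  define b where "b n = exp (- (pi_sq n * x))" for n
  have sb: "b sums rhalf_theta x" unfolding b_def rhalf_theta_def by (intro summable_sums summable_rhalf_theta x)
  have "(\<lambda>n. exp (- (pi_sq n * (4 * x)))) sums rhalf_theta (4 * x)"
    unfolding rhalf_theta_def using x by (intro summable_sums summable_rhalf_theta) auto
  hence "(\<lambda>n. 2 * exp (- (pi_sq n * (4 * x)))) sums (2 * rhalf_theta (4 * x))" by (rule sums_mult)
  also have "(\<lambda>n. 2 * exp (- (pi_sq n * (4 * x)))) = (\<lambda>n. (1 - (-1)^(2*n+1)) * b (2*n+1))"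
  proof
    fix n
    have "pi_sq (2*n+1) = pi_sq n * 4" by (simp add: pi_sq_def power2_eq_square algebra_simps)
    thus "2 * exp (- (pi_sq n * (4 * x))) = (1 - (-1)^(2*n+1)) * b (2*n+1)" by (simp add: b_def mult_ac)
  qed
  finally have "(\<lambda>n. (1 - (-1)^n) * b n) sums (2 * rhalf_theta (4 * x))"
  proof (subst (asm) sums_mono_reindex[where g = "\<lambda>n. 2*n+1" and f = "\<lambda>n. (1 - (-1)^n) * b n"])
    show "strict_mono (\<lambda>n::nat. 2*n+1)" by (rule strict_monoI) simp
    fix n :: nat assume "n \<notin> range (\<lambda>n. 2*n+1)"
    have "even n"
    proof (rule ccontr)
      assume "odd n"
      then obtain k where "n = 2 * k + 1" by (elim oddE)
      with \<open>n \<notin> range (\<lambda>n. 2*n+1)\<close> show False by blast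
    qed
    thus "(1 - (-1)^n) * b n = 0" by simp
  qed
  from sums_diff[OF sb this] show ?thesis by (simp add: b_def algebra_simps)
qed

text \<open>The series for \<open>eta\<close> converges only conditionally here, so there is no
  absolute majorant for the sum of integrals. But the partial sums of an alternating series with
  decreasing terms stay below the first term, which allows dominated convergence.\<close>

lemma integral_mellin_alternating:
  fixes t :: real
  defines "a \<equiv> Complex (1/4) (t/2)"
  shows "(LINT v|lborel. exp (a * of_real v) * of_real (rhalf_theta (exp v) - 2 * rhalf_theta (4 * exp v)))
      = exp (- a * of_real (ln pi)) * Gamma a * eta (Complex (1/2) t)"
proof -
  define P where "P N v = (\<Sum>n<N. (-1)^n * mellin_exp t (pi_sq n) (of_real v))" for N and v :: real
  define A where "A = exp (- a * of_real (ln pi)) * Gamma a"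
  define L where "L v = exp (a * of_real v) * of_real (rhalf_theta (exp v) - 2 * rhalf_theta (4 * exp v))" for v :: real
  have hbi: "has_bochner_integral lborel (\<lambda>v. mellin_exp t (pi_sq n) (of_real v)) (exp (- a * of_real (ln (pi_sq n))) * Gamma a)" for n
    unfolding a_def by (rule has_bochner_integral_mellin_exp[OF pi_sq_pos])
  have val: "exp (- a * of_real (ln (pi_sq n))) * Gamma a = A * of_nat (Suc n) powr (- Complex (1/2) t)" for n
  proof -
    have "ln (pi_sq n) = ln pi + 2 * ln (real (Suc n))" unfolding pi_sq_def
      by (subst ln_mult) (auto simp: ln_realpow)
    hence "- a * of_real (ln (pi_sq n)) = - a * of_real (ln pi) + (- Complex (1/2) t) * of_real (ln (real (Suc n)))"
      by (simp add: a_def complex_eq_iff algebra_simps)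
    moreover have "of_nat (Suc n) powr (- Complex (1/2) t) = exp ((- Complex (1/2) t) * of_real (ln (real (Suc n))))"
    proof -
      have "Ln (of_nat (Suc n)) = of_real (ln (real (Suc n)))"
        by (metis Ln_of_real of_nat_0_less_iff of_real_of_nat_eq zero_less_Suc)
      thus ?thesis unfolding powr_def by (metis of_nat_neq_0)
    qed
    ultimately show ?thesis by (simp only: exp_add A_def mult_ac)
  qed
  have Pint: "has_bochner_integral lborel (P N) (\<Sum>n<N. (-1)^n * (A * of_nat (Suc n) powr (- Complex (1/2) t)))" for N
    unfolding P_def val[symmetric] by (intro has_bochner_integral_sum has_bochner_integral_mult_right hbi)
  have Peq: "P N v = exp (a * of_real v) * of_real (\<Sum>n<N. (-1)^n * exp (- (pi_sq n * exp v)))" for N v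
    unfolding P_def of_real_sum sum_distrib_left
    by (intro sum.cong refl) (simp add: mellin_exp_split a_def exp_of_real[symmetric] mult_ac)
  have Plim: "(\<lambda>N. P N v) \<longlonglongrightarrow> L v" for v
    unfolding Peq L_def using alternating_theta[of "exp v"] unfolding sums_def
    by (intro tendsto_intros) auto
  have Pmeas: "P N \<in> borel_measurable lborel" for N by (rule borel_measurable_has_bochner_integral[OF Pint])
  have Lmeas: "L \<in> borel_measurable lborel" by (rule borel_measurable_LIMSEQ_metric[OF Pmeas Plim])
  have "(\<lambda>N. LINT v|lborel. P N v) \<longlonglongrightarrow> (LINT v|lborel. L v)"
  proof (rule integral_dominated_convergence[OF Lmeas Pmeas])
    show "integrable lborel (\<lambda>v. norm (mellin_exp t (pi_sq 0) (complex_of_real v)))"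
      using hbi[of 0] by (intro integrable_norm) (simp add: has_bochner_integral_iff)
    show "AE v in lborel. (\<lambda>N. P N v) \<longlonglongrightarrow> L v" by (rule AE_I2[OF Plim])
    show "AE v in lborel. norm (P N v) \<le> norm (mellin_exp t (pi_sq 0) (complex_of_real v))" for N
    proof (rule AE_I2)
      fix v :: real
      have "0 \<le> (\<Sum>n<N. (-1)^n * exp (- (pi_sq n * exp v))) \<and> (\<Sum>n<N. (-1)^n * exp (- (pi_sq n * exp v))) \<le> exp (- (pi_sq 0 * exp v))"
        by (rule alternating_sum_bounds) (auto simp: pi_sq_def)
      hence "\<bar>\<Sum>n<N. (-1)^n * exp (- (pi_sq n * exp v))\<bar> \<le> exp (- (pi_sq 0 * exp v))" by simp
      hence "norm (exp (a * of_real v)) * \<bar>\<Sum>n<N. (-1)^n * exp (- (pi_sq n * exp v))\<bar> \<le> norm (exp (a * of_real v)) * exp (- (pi_sq 0 * exp v))"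
        by (intro mult_left_mono) auto
      also have "\<dots> = norm (mellin_exp t (pi_sq 0) (complex_of_real v))"
        unfolding mellin_exp_split norm_mult a_def by (simp add: exp_of_real)
      finally show "norm (P N v) \<le> norm (mellin_exp t (pi_sq 0) (complex_of_real v))"
        unfolding Peq norm_mult norm_of_real .
    qed
  qed
  moreover have "(LINT v|lborel. P N v) = A * (\<Sum>n<N. eta_term (Complex (1/2) t) n)" for N
    using Pint[of N] by (simp add: has_bochner_integral_iff sum_distrib_left eta_term_def mult_ac)
  moreover have "(\<lambda>N. A * (\<Sum>n<N. eta_term (Complex (1/2) t) n)) \<longlonglongrightarrow> A * eta (Complex (1/2) t)"
    unfolding eta_def by (intro tendsto_intros summable_LIMSEQ summable_eta_term) simp
  ultimately have "(LINT v|lborel. L v) = A * eta (Complex (1/2) t)" using LIMSEQ_unique by simp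
  thus ?thesis by (simp add: L_def A_def)
qed

section \<open>Zeta on the critical line as a Mellin transform, and reality of Z\<close>

definition eta_factor :: "real \<Rightarrow> complex" where
  "eta_factor t = 1 - 2 powr (1 - Complex (1/2) t)"

lemma eta_factor_eq: "eta_factor t = 1 - of_real (sqrt 2) * exp (- \<i> * of_real (t * ln 2))"
proof -
  have "(2::complex) powr (1 - Complex (1/2) t) = exp ((1 - Complex (1/2) t) * of_real (ln 2))"
    by (simp add: powr_def Ln_of_real[of 2, simplified])
  also have "(1 - Complex (1/2) t) * of_real (ln 2) = of_real (ln 2 / 2) + (- \<i> * of_real (t * ln 2))"
    by (simp add: complex_eq_iff)
  also have "exp \<dots> = of_real (exp (ln 2 / 2)) * exp (- \<i> * of_real (t * ln 2))" by (simp only: exp_add exp_of_real)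
  also have "exp (ln 2 / 2) = sqrt (2::real)" by (simp add: powr_half_sqrt[symmetric] powr_def)
  finally show ?thesis by (simp add: eta_factor_def)
qed

lemma eta_factor_nonzero: "eta_factor t \<noteq> 0"
proof
  assume "eta_factor t = 0"
  hence "norm (of_real (sqrt 2) * exp (- \<i> * of_real (t * ln 2))) = 1" unfolding eta_factor_eq by simp
  thus False by (simp add: norm_mult)
qed

lemma zeta_crit_eq: "zeta_crit t = eta (Complex (1/2) t) / eta_factor t"
  by (simp add: zeta_crit_def eta_def eta_term_def eta_factor_def Let_def)

text \<open>Shifting v by ln 4 replaces theta at x by theta at 4 x. Subtracting the suitable
  multiple of the shifted integral produces the alternating theta function inside and the factor 1 -
  2 * 4^(-a), which is \<open>eta_factor t\<close>, outside.\<close>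

lemma zeta_crit_mellin:
  fixes t :: real
  defines "a \<equiv> Complex (1/4) (t/2)"
  shows "exp (- a * of_real (ln pi)) * Gamma a * zeta_crit t = mellin_zeta t"
proof -
  define Q where "Q v = exp (a * of_real v) * of_real (rhalf_theta (exp v) - exp (- v / 2) / 2)" for v
  obtain M where M: "has_bochner_integral lborel Q M"
    using mellin_zeta_fold[of t] unfolding Q_def a_def by blast
  hence Mz: "M = mellin_zeta t" unfolding mellin_zeta_def Q_def a_def by (simp add: has_bochner_integral_iff)
  have "has_bochner_integral lborel (\<lambda>v. Q (ln 4 + 1 * v)) (M /\<^sub>R \<bar>1\<bar>)"
    using M by (subst lborel_has_bochner_integral_real_affine_iff[symmetric]) auto
  hence "has_bochner_integral lborel (\<lambda>v. Q v - 2 * exp (- a * of_real (ln 4)) * Q (ln 4 + 1 * v)) (M - 2 * exp (- a * of_real (ln 4)) * M)"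
    using M by (intro has_bochner_integral_diff has_bochner_integral_mult_right) simp_all
  also have "(\<lambda>v. Q v - 2 * exp (- a * of_real (ln 4)) * Q (ln 4 + 1 * v)) = (\<lambda>v. exp (a * of_real v) * of_real (rhalf_theta (exp v) - 2 * rhalf_theta (4 * exp v)))"
  proof
    fix v :: real
    have "exp (- a * of_real (ln 4)) * exp (a * of_real (ln 4 + 1 * v)) = exp (a * of_real v)"
      by (simp add: exp_add[symmetric] algebra_simps)
    moreover have "exp (- (ln 4 + 1 * v) / 2) = exp (- v / 2) / 2"
    proof -
      have "ln (4::real) = 2 * ln 2" using ln_realpow[of 2 2] by simp
      hence eq: "- (ln 4 + 1 * v) / 2 = - v / 2 - ln 2" by (simp add: field_simps)
      show ?thesis unfolding eq exp_diff by simp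
    qed
    moreover have "exp (ln 4 + 1 * v) = 4 * exp v" by (simp add: exp_add)
    ultimately have "2 * exp (- a * of_real (ln 4)) * Q (ln 4 + 1 * v) = 2 * (exp (a * of_real v) * of_real (rhalf_theta (4 * exp v) - exp (- v / 2) / 2 / 2))"
      unfolding Q_def by (simp only: mult.assoc[symmetric]) (simp only: mult.assoc)
    thus "Q v - 2 * exp (- a * of_real (ln 4)) * Q (ln 4 + 1 * v) = exp (a * of_real v) * of_real (rhalf_theta (exp v) - 2 * rhalf_theta (4 * exp v))"
      unfolding Q_def by (simp add: algebra_simps)
  qed
  finally have "M - 2 * exp (- a * of_real (ln 4)) * M = exp (- a * of_real (ln pi)) * Gamma a * eta (Complex (1/2) t)"
    using integral_mellin_alternating[of t] by (simp add: has_bochner_integral_iff a_def)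
  moreover have "1 - 2 * exp (- a * of_real (ln 4)) = eta_factor t"
  proof -
    have "ln (4::real) = 2 * ln 2" using ln_realpow[of 2 2] by simp
    hence "- a * of_real (ln 4) = of_real (- (ln 2 / 2)) + (- \<i> * of_real (t * ln 2))" by (simp add: a_def complex_eq_iff)
    hence "exp (- a * of_real (ln 4)) = of_real (exp (- (ln 2 / 2))) * exp (- \<i> * of_real (t * ln 2))"
      by (simp only: exp_add exp_of_real)
    moreover have "2 * exp (- (ln 2 / 2)) = sqrt (2::real)"
    proof -
      have "exp (ln 2 / 2) = sqrt (2::real)" by (simp add: powr_half_sqrt[symmetric] powr_def)
      thus ?thesis by (simp add: exp_minus field_simps)
    qed
    hence "2 * complex_of_real (exp (- (ln 2 / 2))) = of_real (sqrt 2)" by (metis of_real_mult of_real_numeral)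
    ultimately show ?thesis unfolding eta_factor_eq by (simp add: mult.assoc[symmetric])
  qed
  ultimately have "eta_factor t * M = exp (- a * of_real (ln pi)) * Gamma a * eta (Complex (1/2) t)"
    by (metis left_diff_distrib mult_1)
  thus ?thesis using eta_factor_nonzero[of t] Mz by (simp add: zeta_crit_eq field_simps)
qed

lemma cis_rs_theta: "exp (\<i> * of_real (rs_theta t)) * of_real (exp (- ln pi / 4) * norm (Gamma (Complex (1/4) (t/2))))
   = exp (- Complex (1/4) (t/2) * of_real (ln pi)) * Gamma (Complex (1/4) (t/2))"
proof -
  define a where "a = Complex (1/4) (t/2)"
  have "a \<notin> \<int>\<^sub>\<le>\<^sub>0" by (auto simp: a_def complex_eq_iff elim!: nonpos_Ints_cases)
  hence G: "Gamma a = exp (ln_Gamma a)" by (simp add: Gamma_complex_altdef)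
  have "exp (- a * of_real (ln pi)) * Gamma a = exp (- a * of_real (ln pi) + ln_Gamma a)" by (simp only: G exp_add)
  also have "- a * of_real (ln pi) + ln_Gamma a = \<i> * of_real (rs_theta t) + of_real (- ln pi / 4 + Re (ln_Gamma a))"
    by (simp add: complex_eq_iff rs_theta_def a_def)
  also have "exp \<dots> = exp (\<i> * of_real (rs_theta t)) * of_real (exp (- ln pi / 4) * norm (Gamma a))"
    by (simp only: exp_add exp_of_real G norm_exp_eq_Re)
  finally show ?thesis by (simp add: a_def)
qed

lemma mellin_zeta_real: "Im (mellin_zeta t) = 0"
  using mellin_zeta_fold[of t] unfolding mellin_zeta_def by (simp add: has_bochner_integral_iff)

text \<open>\<open>hardy_Z\<close> is defined by a real part. Nothing is lost by this: up to a
  positive factor the product is \<open>mellin_zeta t\<close>, which is real by folding.\<close>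

lemma hardy_Z_complex: "exp (\<i> * of_real (rs_theta t)) * zeta_crit t = of_real (hardy_Z t)"
proof -
  define a where "a = Complex (1/4) (t/2)"
  define r where "r = exp (- ln pi / 4) * norm (Gamma a)"
  have "a \<notin> \<int>\<^sub>\<le>\<^sub>0" by (auto simp: a_def complex_eq_iff elim!: nonpos_Ints_cases)
  hence r: "r > 0" by (simp add: r_def Gamma_eq_zero_iff)
  define W where "W = exp (\<i> * of_real (rs_theta t)) * zeta_crit t"
  have "of_real r * W = mellin_zeta t"
    unfolding zeta_crit_mellin[symmetric] cis_rs_theta[symmetric] r_def a_def W_def by (simp add: mult_ac)
  hence "Im (of_real r * W) = 0" using mellin_zeta_real[of t] by simp
  hence "Im W = 0" using r by simp
  thus ?thesis by (simp add: hardy_Z_def complex_eq_iff W_def)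
qed

text \<open>The cut of all Gamma integrals is moved from w = 0 to w = i \<phi>. The sum of the real
  parts changes by an elementary function only, since its derivative in the angle contains theta on
  the unit circle, where \<open>half_theta_cis_real\<close> applies.
  \<open>Lp n - F n (i \<phi>)\<close> is the n-th integral beyond the cut, and
  \<open>Lp n - Lm n\<close> the complete one.\<close>

lemma mellin_zeta_rotated:
  fixes t \<phi> :: real
  assumes t: "t \<ge> 0" and \<phi>: "0 \<le> \<phi>" "\<phi> < pi / 2"
  defines "a \<equiv> Complex (1/4) (t/2)"
  obtains F Lp Lm S where
    "\<And>n w. (F n has_field_derivative mellin_exp t (pi_sq n) w) (at w)"
    "\<And>n. ((\<lambda>v. F n (of_real v)) \<longlongrightarrow> Lp n) at_top"
    "\<And>n. ((\<lambda>v. F n (of_real v)) \<longlongrightarrow> Lm n) at_bot"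
    "\<And>n. Lp n - Lm n = exp (- a * of_real (ln pi)) * Gamma a * of_nat (Suc n) powr (- Complex (1/2) t)"
    "(\<lambda>n. Re (Lp n - F n (\<i> * of_real \<phi>))) sums S"
    "mellin_zeta t = of_real (2 * S - Re (exp (\<i> * a * of_real \<phi>) / a))"
proof -
  have "\<exists>F. \<forall>w. (F has_field_derivative mellin_exp t (pi_sq n) w) (at w)" for n
  proof -
    have "mellin_exp t (pi_sq n) holomorphic_on UNIV" unfolding mellin_exp_def by (intro holomorphic_intros)
    from holomorphic_convex_primitive'[OF convex_UNIV open_UNIV this] show ?thesis by auto
  qed
  then obtain F where F: "\<And>n w. (F n has_field_derivative mellin_exp t (pi_sq n) w) (at w)" by metis
  define g where "g n v = mellin_exp t (pi_sq n) (of_real v)" for n and v :: real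
  define J where "J n = (LINT v|lborel. indicator {0..} v *\<^sub>R g n v)" for n
  define I where "I = (LINT v|lborel. indicator {0..} v *\<^sub>R (exp (a * of_real v) * of_real (rhalf_theta (exp v))))"
  have gint: "has_bochner_integral lborel (g n) (exp (- a * of_real (ln (pi_sq n))) * Gamma a)" for n
    unfolding g_def a_def by (rule has_bochner_integral_mellin_exp[OF pi_sq_pos])
  have gcont: "continuous_on UNIV (g n)" for n unfolding g_def mellin_exp_def by (intro continuous_intros)
  have Fr: "((\<lambda>v. F n (of_real v)) has_vector_derivative g n v) (at v)" for n v
    unfolding g_def by (rule has_vector_derivative_real_field[OF F])
  define Lp where "Lp n = F n 0 + J n" for n
  define Lm where "Lm n = F n 0 + J n - exp (- a * of_real (ln (pi_sq n))) * Gamma a" for n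
  have Lp: "((\<lambda>v. F n (of_real v)) \<longlongrightarrow> Lp n) at_top" for n
    using primitive_tendsto_at_top[OF Fr gcont, of n] integrable_mellin_exp_indicator[OF pi_sq_pos, of t n]
    by (simp add: Lp_def J_def g_def)
  have Lm: "((\<lambda>v. F n (of_real v)) \<longlongrightarrow> Lm n) at_bot" for n
    using primitive_tendsto_at_bot[OF Fr gcont, of n] gint[of n]
    by (simp add: Lm_def J_def has_bochner_integral_iff)
  have diff: "Lp n - Lm n = exp (- a * of_real (ln pi)) * Gamma a * of_nat (Suc n) powr (- Complex (1/2) t)" for n
  proof -
    have "ln (pi_sq n) = ln pi + 2 * ln (real (Suc n))" unfolding pi_sq_def
      by (subst ln_mult) (auto simp: ln_realpow)
    hence "- a * of_real (ln (pi_sq n)) = - a * of_real (ln pi) + (- Complex (1/2) t) * of_real (ln (real (Suc n)))"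
      by (simp add: a_def complex_eq_iff algebra_simps)
    moreover have "of_nat (Suc n) powr (- Complex (1/2) t) = exp ((- Complex (1/2) t) * of_real (ln (real (Suc n))))"
    proof -
      have "Ln (of_nat (Suc n)) = of_real (ln (real (Suc n)))"
        by (metis Ln_of_real of_nat_0_less_iff of_real_of_nat_eq zero_less_Suc)
      thus ?thesis unfolding powr_def by (metis of_nat_neq_0)
    qed
    ultimately have "exp (- a * of_real (ln (pi_sq n))) * Gamma a = exp (- a * of_real (ln pi)) * Gamma a * of_nat (Suc n) powr (- Complex (1/2) t)"
      by (simp only: exp_add mult_ac)
    thus ?thesis by (simp add: Lp_def Lm_def)
  qed
  have JI: "(\<lambda>n. Re (J n)) sums Re I"
    using sums_half_mellin(1)[of t] unfolding J_def g_def I_def a_def by (rule sums_Re)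
  define u where "u n y = Re (F n (\<i> * of_real y) - F n 0)" for n y
  define u' where "u' n y = Re (\<i> * mellin_exp t (pi_sq n) (\<i> * of_real y))" for n y
  have uder: "(u n has_real_derivative u' n y) (at y within A)" for n y A
  proof -
    have "((\<lambda>w. F n (\<i> * w) - F n 0) has_field_derivative \<i> * mellin_exp t (pi_sq n) (\<i> * of_real y)) (at (of_real y))"
      by (auto intro!: derivative_eq_intros DERIV_chain2[OF F])
    from has_field_derivative_Re[OF has_vector_derivative_real_field[OF this]]
    have "((\<lambda>y. Re (F n (\<i> * of_real y) - F n 0)) has_real_derivative u' n y) (at y)" by (simp add: u'_def)
    hence "(u n has_real_derivative u' n y) (at y)" unfolding u_def[abs_def] .
    thus ?thesis by (rule has_field_derivative_at_within)
  qed
  have u'le: "norm (u' n y) \<le> (real n + 2) * exp (- (pi * cos \<phi>) * real n)" if "y \<in> {0..\<phi>}" for n y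
  proof -
    have c: "cos y \<ge> cos \<phi>" "cos \<phi> > 0" using that \<phi> by (auto intro!: cos_monotone_0_pi_le cos_gt_zero_pi)
    have "norm (u' n y) \<le> norm (mellin_exp t (pi_sq n) (\<i> * of_real y))"
      unfolding u'_def using abs_Re_le_cmod[of "\<i> * mellin_exp t (pi_sq n) (\<i> * of_real y)"] by (simp add: norm_mult)
    also have "\<dots> = exp (- (t / 2 * y) - pi_sq n * cos y)" by (simp add: norm_mellin_exp)
    also have "\<dots> \<le> norm (exp (- (of_real (pi_sq n) * cis y)))" using t that by simp
    also have "\<dots> \<le> (real n + 2) * exp (- (pi * cos \<phi>) * real n)"
      by (rule norm_exp_pi_sq_le) (use c in auto)
    finally show ?thesis .
  qed
  \<comment> \<open>In exp(i a y) times \<open>half_theta\<close>, written as half of (1 + 2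
    \<open>half_theta\<close>) minus one half, the first part is real and disappears under Re after
    multiplication by i.\<close>
  have u'sum: "(\<Sum>n. u' n y) = - (1/2) * Re (\<i> * exp (\<i> * a * of_real y))" if y: "y \<in> {0..\<phi>}" for y
  proof -
    have aux: "Re (\<i> * (of_real c * w)) = - (c * Im w)" for c w by simp
    have cy: "cos y > 0" using y \<phi> by (intro cos_gt_zero_pi) auto
    have "(\<lambda>n. exp (- (of_real (pi_sq n) * cis y))) sums half_theta (cis y)"
      unfolding half_theta_def by (intro summable_sums summable_norm_cancel[OF summable_half_theta]) (use cy in simp)
    hence "(\<lambda>n. Re ((\<i> * exp (a * (\<i> * of_real y))) * exp (- (of_real (pi_sq n) * cis y)))) sums Re ((\<i> * exp (a * (\<i> * of_real y))) * half_theta (cis y))"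
      by (intro sums_Re sums_mult)
    also have "(\<lambda>n. Re ((\<i> * exp (a * (\<i> * of_real y))) * exp (- (of_real (pi_sq n) * cis y)))) = (\<lambda>n. u' n y)"
      by (simp add: u'_def mellin_exp_split a_def cis_conv_exp mult.assoc)
    finally have "(\<Sum>n. u' n y) = Re ((\<i> * exp (a * (\<i> * of_real y))) * half_theta (cis y))" by (simp add: sums_iff)
    also have "\<dots> = 1/2 * Re (\<i> * (exp (a * (\<i> * of_real y)) * (1 + 2 * half_theta (cis y)))) - 1/2 * Re (\<i> * exp (a * (\<i> * of_real y)))"
      by (simp add: algebra_simps)
    also have "exp (a * (\<i> * of_real y)) * (1 + 2 * half_theta (cis y)) = of_real (exp (- t * y / 2)) * (exp (\<i> * of_real (y / 4)) * (1 + 2 * half_theta (cis y)))"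
    proof -
      have "a * (\<i> * of_real y) = of_real (- t * y / 2) + \<i> * of_real (y / 4)" by (simp add: a_def complex_eq_iff)
      thus ?thesis by (simp only: exp_add exp_of_real mult.assoc)
    qed
    also have "Re (\<i> * (of_real (exp (- t * y / 2)) * (exp (\<i> * of_real (y / 4)) * (1 + 2 * half_theta (cis y))))) = - (exp (- t * y / 2) * Im (exp (\<i> * of_real (y / 4)) * (1 + 2 * half_theta (cis y))))"
      by (rule aux)
    also have "Im (exp (\<i> * of_real (y / 4)) * (1 + 2 * half_theta (cis y))) = 0" by (rule half_theta_cis_real) (use y \<phi> in auto)
    finally show ?thesis by (simp add: mult_ac)
  qed
  have ul: "uniform_limit {0..\<phi>} (\<lambda>N y. \<Sum>n<N. u' n y) (\<lambda>y. \<Sum>n. u' n y) sequentially"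
  proof (rule Weierstrass_m_test[OF u'le])
    have "cos \<phi> > 0" using \<phi> by (intro cos_gt_zero_pi) auto
    thus "summable (\<lambda>n. (real n + 2) * exp (- (pi * cos \<phi>) * real n))" by (intro summable_gaussian) auto
  qed
  have "\<exists>U. \<forall>y\<in>{0..\<phi>}. (\<lambda>n. u n y) sums U y \<and> (U has_real_derivative (\<Sum>n. u' n y)) (at y within {0..\<phi>})"
    by (rule has_field_derivative_series[OF _ uder ul, of 0]) (use \<phi> in \<open>auto simp: u_def\<close>)
  then obtain U where U: "\<And>y. y \<in> {0..\<phi>} \<Longrightarrow> (\<lambda>n. u n y) sums U y"
    "\<And>y. y \<in> {0..\<phi>} \<Longrightarrow> (U has_real_derivative (\<Sum>n. u' n y)) (at y within {0..\<phi>})" by blast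
  have a0: "a \<noteq> 0" by (auto simp: a_def complex_eq_iff)
  \<comment> \<open>Its derivative is the negative of the one just computed, so U + V is
    constant.\<close>
  define V where "V y = 1/2 * Re (exp (\<i> * a * of_real y) / a)" for y
  have V: "(V has_real_derivative 1/2 * Re (\<i> * exp (\<i> * a * of_real y))) (at y within A)" for y A
  proof -
    have "((\<lambda>w. exp (\<i> * a * w) / a) has_field_derivative \<i> * exp (\<i> * a * of_real y)) (at (of_real y))"
      using a0 by (auto intro!: derivative_eq_intros)
    from has_field_derivative_Re[OF has_vector_derivative_real_field[OF this]]
    have "(V has_real_derivative 1/2 * Re (\<i> * exp (\<i> * a * of_real y))) (at y)"
      unfolding V_def[abs_def] by (rule DERIV_cmult)
    thus ?thesis by (rule has_field_derivative_at_within)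
  qed
  have "\<exists>c. \<forall>y\<in>{0..\<phi>}. U y + V y = c"
  proof (rule has_field_derivative_zero_constant)
    fix y assume y: "y \<in> {0..\<phi>}"
    show "((\<lambda>y. U y + V y) has_field_derivative 0) (at y within {0..\<phi>})"
      using DERIV_add[OF U(2)[OF y] V] unfolding u'sum[OF y] by simp
  qed auto
  then obtain c where "\<And>y. y \<in> {0..\<phi>} \<Longrightarrow> U y + V y = c" by blast
  hence "U \<phi> + V \<phi> = U 0 + V 0" using \<phi> by auto
  moreover have "U 0 = 0" using U(1)[of 0] \<phi> by (auto simp: u_def sums_iff)
  moreover have "V 0 = 1/2 * Re (1 / a)" by (simp add: V_def)
  ultimately have U\<phi>: "U \<phi> = 1/2 * Re (1 / a) - V \<phi>" by simp
  have "(\<lambda>n. Re (J n) - u n \<phi>) sums (Re I - U \<phi>)" using \<phi> by (intro sums_diff JI U(1)) auto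
  moreover have "(\<lambda>n. Re (J n) - u n \<phi>) = (\<lambda>n. Re (Lp n - F n (\<i> * of_real \<phi>)))" by (simp add: u_def Lp_def algebra_simps)
  ultimately have S: "(\<lambda>n. Re (Lp n - F n (\<i> * of_real \<phi>))) sums (Re I - U \<phi>)" by simp
  have "mellin_zeta t = of_real (2 * Re I - Re (1 / a))"
    using mellin_zeta_fold[of t] unfolding mellin_zeta_def I_def a_def by (simp add: has_bochner_integral_iff)
  also have "2 * Re I - Re (1 / a) = 2 * (Re I - U \<phi>) - Re (exp (\<i> * a * of_real \<phi>) / a)"
    unfolding U\<phi> by (simp add: V_def)
  finally show ?thesis using that[OF F Lp Lm diff S] by blast
qed

section \<open>Holomorphy of Hardy's function\<close>

lemma cnj_ln_Gamma:
  assumes "Re z > 0"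
  shows "cnj (ln_Gamma z) = ln_Gamma (cnj z)"
proof -
  have cLn: "cnj (Ln w) = Ln (cnj w)" if "Re w > 0" for w
    using that by (intro cnj_Ln) (auto simp: complex_nonpos_Reals_iff)
  have nz: "w \<notin> \<int>\<^sub>\<le>\<^sub>0" if "Re w > 0" for w :: complex
    using that by (auto elim!: nonpos_Ints_cases)
  have eq: "cnj (ln_Gamma_series z n) = ln_Gamma_series (cnj z) n" if "n > 0" for n
  proof -
    have "cnj (Ln (of_nat n)) = Ln (of_nat n)" using cLn[of "of_nat n"] that by simp
    moreover have "cnj (Ln (z / of_nat k + 1)) = Ln (cnj z / of_nat k + 1)" for k
      using assms by (subst cLn) (auto intro!: add_nonneg_pos divide_nonneg_nonneg)
    ultimately show ?thesis using cLn[OF assms] by (simp add: ln_Gamma_series_def)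
  qed
  have "(\<lambda>n. cnj (ln_Gamma_series z n)) \<longlonglongrightarrow> cnj (ln_Gamma z)"
    using assms by (intro tendsto_cnj ln_Gamma_complex_LIMSEQ nz)
  moreover have "(\<lambda>n. cnj (ln_Gamma_series z n)) \<longlonglongrightarrow> ln_Gamma (cnj z)"
  proof (subst tendsto_cong)
    show "\<forall>\<^sub>F n in sequentially. cnj (ln_Gamma_series z n) = ln_Gamma_series (cnj z) n"
      using eventually_gt_at_top[of 0] by eventually_elim (rule eq)
    show "ln_Gamma_series (cnj z) \<longlonglongrightarrow> ln_Gamma (cnj z)"
      using assms by (intro ln_Gamma_complex_LIMSEQ nz) simp
  qed
  ultimately show ?thesis by (rule LIMSEQ_unique)
qed

text \<open>The largest symmetric strip on which the arguments 1/4 + iz/2 and 1/4 - iz/2 of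
  \<open>ln_Gamma\<close> and the argument 1/2 + iz of \<open>eta\<close> stay in the right half
  plane; the denominator of zeta has no zero there.\<close>

definition hardy_strip :: "complex set" where
  "hardy_strip = {z. - (1/2) < Im z \<and> Im z < 1/2}"

text \<open>An imaginary part is not holomorphic. On the real axis the two arguments are conjugate,
  so the difference quotient there equals Im of \<open>ln_Gamma\<close>, and it makes sense off the
  axis.\<close>

definition rs_theta_ext :: "complex \<Rightarrow> complex" where
  "rs_theta_ext z = - (z / 2) * of_real (ln pi) + (ln_Gamma (1/4 + \<i> * z / 2) - ln_Gamma (1/4 - \<i> * z / 2)) / (2 * \<i>)"

definition hardy_Z_ext :: "complex \<Rightarrow> complex" where
  "hardy_Z_ext z = exp (\<i> * rs_theta_ext z) * (eta (1/2 + \<i> * z) / (1 - 2 powr (1/2 - \<i> * z)))"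

lemma open_hardy_strip: "open hardy_strip"
  unfolding hardy_strip_def by (intro open_Collect_conj open_halfspace_Im_gt open_halfspace_Im_lt)

lemma connected_hardy_strip: "connected hardy_strip"
proof -
  have "hardy_strip = {z. Im z > - (1/2)} \<inter> {z. Im z < 1/2}" by (auto simp: hardy_strip_def)
  thus ?thesis by (metis convex_Int convex_connected convex_halfspace_Im_gt convex_halfspace_Im_lt)
qed

lemma of_real_in_hardy_strip: "of_real x \<in> hardy_strip"
  by (simp add: hardy_strip_def)

lemma holomorphic_hardy_Z_ext: "hardy_Z_ext holomorphic_on hardy_strip"
proof -
  have lnG: "(\<lambda>z. ln_Gamma (1/4 + c * z / 2)) holomorphic_on hardy_strip" if "c = \<i> \<or> c = - \<i>" for c
  proof -
    have "(ln_Gamma \<circ> (\<lambda>z. 1/4 + c * z / 2)) holomorphic_on hardy_strip"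
    proof (rule holomorphic_on_compose_gen)
      show "(ln_Gamma :: complex \<Rightarrow> complex) holomorphic_on {z. Re z > 0}"
        by (rule holomorphic_ln_Gamma) (auto simp: complex_nonpos_Reals_iff)
      show "(\<lambda>z. 1/4 + c * z / 2) holomorphic_on hardy_strip" by (intro holomorphic_intros) auto
      show "(\<lambda>z. 1/4 + c * z / 2) ` hardy_strip \<subseteq> {z. Re z > 0}"
        using that by (auto simp: hardy_strip_def)
    qed
    thus ?thesis by (simp add: o_def)
  qed
  have "(eta \<circ> (\<lambda>z. 1/2 + \<i> * z)) holomorphic_on hardy_strip"
    by (rule holomorphic_on_compose_gen[OF _ holomorphic_eta])
       (auto simp: hardy_strip_def intro!: holomorphic_intros)
  hence e: "(\<lambda>z. eta (1/2 + \<i> * z)) holomorphic_on hardy_strip" by (simp add: o_def)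
  have nz: "1 - 2 powr (1/2 - \<i> * z) \<noteq> 0" if "z \<in> hardy_strip" for z
  proof
    assume "1 - 2 powr (1/2 - \<i> * z) = 0"
    hence "norm (2 powr (1/2 - \<i> * z)) = 1" by simp
    moreover have "norm ((2::complex) powr (1/2 - \<i> * z)) = 2 powr (1/2 + Im z)"
      using norm_powr_real_powr[of 2 "1/2 - \<i> * z"] by simp
    moreover have "(2::real) powr (1/2 + Im z) > 2 powr 0" using that by (intro powr_less_mono) (auto simp: hardy_strip_def)
    ultimately show False by simp
  qed
  have l2: "(\<lambda>z. ln_Gamma (1/4 - \<i> * z / 2)) holomorphic_on hardy_strip" using lnG[of "-\<i>"] by simp
  have th: "rs_theta_ext holomorphic_on hardy_strip"
    unfolding rs_theta_ext_def using lnG[of \<i>] by (intro holomorphic_intros l2) auto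
  show ?thesis unfolding hardy_Z_ext_def using nz by (intro holomorphic_intros th e) auto
qed

lemma hardy_Z_ext_of_real: "hardy_Z_ext (of_real x) = of_real (hardy_Z x)"
proof -
  define w where "w = Complex (1/4) (x/2)"
  have w1: "1/4 + \<i> * of_real x / 2 = w" by (simp add: w_def complex_eq_iff)
  have w2: "1/4 - \<i> * of_real x / 2 = cnj w" by (simp add: w_def complex_eq_iff)
  have "ln_Gamma w - ln_Gamma (cnj w) = 2 * \<i> * of_real (Im (ln_Gamma w))"
    using cnj_ln_Gamma[of w] by (simp add: w_def complex_eq_iff)
  hence "rs_theta_ext (of_real x) = of_real (rs_theta x)"
    unfolding rs_theta_ext_def w1 w2 by (simp add: rs_theta_def w_def)
  moreover have "1/2 + \<i> * of_real x = Complex (1/2) x" by (simp add: complex_eq_iff)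
  moreover have "1 - 2 powr (1/2 - \<i> * of_real x) = eta_factor x"
  proof -
    have "1 - Complex (1/2) x = 1/2 - \<i> * of_real x" by (simp add: complex_eq_iff)
    thus ?thesis by (simp add: eta_factor_def)
  qed
  ultimately have "hardy_Z_ext (of_real x) = exp (\<i> * of_real (rs_theta x)) * zeta_crit x"
    by (simp add: hardy_Z_ext_def zeta_crit_eq)
  thus ?thesis by (simp add: hardy_Z_complex)
qed

lemma hardy_Z_derivs:
  "(deriv ^^ k) hardy_Z differentiable (at x)"
  using higher_deriv_of_real_restrict[OF holomorphic_hardy_Z_ext open_hardy_strip of_real_in_hardy_strip hardy_Z_ext_of_real] by blast

lemma has_real_derivative_hardy_Z: "(hardy_Z has_real_derivative deriv hardy_Z x) (at x)"
  using hardy_Z_derivs[of 0 x] by (simp add: DERIV_deriv_iff_real_differentiable)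

lemma continuous_on_deriv_hardy_Z: "continuous_on A (deriv hardy_Z)"
  using hardy_Z_derivs[of 1] by (intro continuous_at_imp_continuous_on ballI differentiable_imp_continuous_within) auto

lemma hardy_Z_monotone_if_no_odd_order_zero:
  assumes "\<And>x. a < x \<Longrightarrow> x < b \<Longrightarrow> \<not> odd_order_zero (deriv hardy_Z) x"
  shows "(\<forall>x\<in>{a<..<b}. deriv hardy_Z x \<ge> 0) \<or> (\<forall>x\<in>{a<..<b}. deriv hardy_Z x \<le> 0)"
proof (rule no_odd_order_zero_imp_const_sign)
  show "deriv hardy_Z_ext holomorphic_on hardy_strip"
    by (rule holomorphic_deriv[OF holomorphic_hardy_Z_ext open_hardy_strip])
  show "deriv hardy_Z_ext (of_real x) = of_real (deriv hardy_Z x)" for x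
    using higher_deriv_of_real_restrict[OF holomorphic_hardy_Z_ext open_hardy_strip of_real_in_hardy_strip hardy_Z_ext_of_real, of 1 x] by simp
qed (use assms open_hardy_strip connected_hardy_strip of_real_in_hardy_strip in auto)

section \<open>Approximation of zeta on the critical line\<close>

text \<open>Two decay rates for the same path. The first stays useful when c meets the critical
  value t / 2 and rests on the cubic term of arctan; the second uses only arctan u \<le> u and is
  better once c is far above t / 2.\<close>

lemma upper_rotated_bound:
  fixes F :: "complex \<Rightarrow> complex"
  assumes F: "\<And>w. (F has_field_derivative mellin_exp t c w) (at w)"
    and Lp: "((\<lambda>v. F (of_real v)) \<longlongrightarrow> Lp) at_top"
    and t: "t \<ge> 4" and c: "c \<ge> t / 2"
  defines "\<phi> \<equiv> pi / 2 - 1 / t"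
  shows "norm (Lp - F (\<i> * of_real \<phi>)) \<le> 100 * exp (- pi * t / 4) * t powr (-1/3)"
    and "c > t / 2 \<Longrightarrow> norm (Lp - F (\<i> * of_real \<phi>)) \<le> 100 * exp (- pi * t / 4) / (c - t / 2)"
proof -
  \<comment> \<open>The width of the transition at c = t / 2: with t u0^3 = 1 the constant loss in
    the exponent is 1/4, while the rate t u0^2 / 4 is of order t^(1/3).\<close>
  define u0 where "u0 = t powr (-1/3)"
  have e1: "exp (1::real) \<le> 3" by (rule exp_le)
  have u0: "u0 > 0" "u0 \<le> 1" using t powr_mono[of "-1/3" 0 t] by (auto simp: u0_def)
  have "u0 ^ 3 = t powr (-1)" unfolding u0_def using t by (subst powr_power) auto
  hence tu3: "t * u0 ^ 3 = 1" using t by (simp add: powr_minus_divide)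
  have c0: "c > 0" using t c by simp
  have *: "t / 2 * arctan u - c * u \<le> 1/4 - t * u0^2 / 4 * u" if "u \<ge> 0" for u
  proof -
    have "t / 2 * (u - arctan u) \<ge> t / 2 * (u0^2 / 2 * (u - u0))"
      using sub_arctan_ge[OF that, of u0] u0 t by (intro mult_left_mono) auto
    moreover have "t / 2 * (u0^2 / 2 * (u - u0)) = t * u0^2 / 4 * u - (t * u0^3) / 4"
      by (simp add: power2_eq_square power3_eq_cube field_simps)
    moreover have "c * u \<ge> t / 2 * u" using c that by (intro mult_right_mono) auto
    moreover have "t / 2 * (u - arctan u) = t / 2 * u - t / 2 * arctan u" by (rule right_diff_distrib)
    ultimately show ?thesis unfolding tu3 by linarith
  qed
  have "norm (Lp - F (\<i> * of_real \<phi>)) \<le> exp (1/2 + 1/4 - pi * t / 4) / (t * u0^2 / 4)"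
    unfolding \<phi>_def by (rule upper_rotated_le[OF F Lp t c0 _ *]) (use u0 t in auto)
  also have "\<dots> = 4 * exp (3/4) * exp (- pi * t / 4) * u0"
  proof -
    define y where "y = t * u0^2"
    have y: "y > 0" "u0 * y = 1" using tu3 u0 t by (auto simp: y_def power3_eq_cube power2_eq_square mult_ac)
    hence u0y: "u0 = 1 / y" by (simp add: eq_divide_eq)
    have "exp (1/2 + 1/4 - pi * t / 4) = exp (3/4) * exp (- pi * t / 4)" by (simp add: exp_add[symmetric])
    thus ?thesis unfolding y_def[symmetric] unfolding u0y by simp
  qed
  also have "\<dots> \<le> 100 * exp (- pi * t / 4) * u0"
  proof (intro mult_right_mono)
    have "exp (3/4) \<le> exp (1::real)" by simp
    also note e1
    finally show "4 * exp (3/4) \<le> (100::real)" by simp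
  qed (use u0 in auto)
  finally show "norm (Lp - F (\<i> * of_real \<phi>)) \<le> 100 * exp (- pi * t / 4) * t powr (-1/3)" by (simp add: u0_def)
  assume ct: "c > t / 2"
  have "norm (Lp - F (\<i> * of_real \<phi>)) \<le> exp (1/2 + 0 - pi * t / 4) / (c - t / 2)"
    unfolding \<phi>_def
  proof (rule upper_rotated_le[OF F Lp t c0])
    fix u :: real assume u: "u \<ge> 0"
    have "t / 2 * arctan u \<le> t / 2 * u" using arctan_le_self[OF u] t by (intro mult_left_mono) auto
    thus "t / 2 * arctan u - c * u \<le> 0 - (c - t / 2) * u" by (simp add: algebra_simps)
  qed (use ct in auto)
  also have "exp (1/2 + 0 - pi * t / 4) = exp (1/2) * exp (- pi * t / 4)" by (simp add: exp_add[symmetric])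
  also have "exp (1/2) * exp (- pi * t / 4) / (c - t / 2) \<le> 100 * exp (- pi * t / 4) / (c - t / 2)"
  proof (intro divide_right_mono mult_right_mono)
    have "exp (1/2) \<le> exp (1::real)" by simp
    also note e1
    finally show "exp (1/2) \<le> (100::real)" by simp
  qed (use ct in auto)
  finally show "norm (Lp - F (\<i> * of_real \<phi>)) \<le> 100 * exp (- pi * t / 4) / (c - t / 2)" .
qed

text \<open>The mirror image below t / 2, with sine in place of arctan. The first bound does not
  deteriorate as c approaches t / 2.\<close>

lemma lower_rotated_bound:
  fixes F :: "complex \<Rightarrow> complex"
  assumes F: "\<And>w. (F has_field_derivative mellin_exp t c w) (at w)"
    and Lm: "((\<lambda>v. F (of_real v)) \<longlongrightarrow> Lm) at_bot"
    and t: "t \<ge> 4" and c: "c > 0" "c < t / 2"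
  defines "\<phi> \<equiv> pi / 2 - 1 / t"
  shows "norm (F (\<i> * of_real \<phi>) - Lm) \<le> 100 * exp (- pi * t / 4) * t powr (-1/3)"
    and "norm (F (\<i> * of_real \<phi>) - Lm) \<le> 100 * exp (- pi * t / 4) / (t / 2 - c)"
proof -
  define u0 where "u0 = t powr (-1/3)"
  have e1: "exp (1::real) \<le> 3" by (rule exp_le)
  have e2: "exp (2::real) \<le> 9" using mult_mono[OF e1 e1] by (simp add: exp_add[symmetric])
  have u0: "u0 > 0" "u0 \<le> 1" using t powr_mono[of "-1/3" 0 t] by (auto simp: u0_def)
  have "u0 ^ 3 = t powr (-1)" unfolding u0_def using t by (subst powr_power) auto
  hence tu3: "t * u0 ^ 3 = 1" using t by (simp add: powr_minus_divide)
  have *: "c * sin u - t / 2 * u \<le> 1/8 - t * u0^2 / 8 * u" if "u \<ge> 0" "u \<le> pi" for u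
  proof -
    have "t / 2 * (u - sin u) \<ge> t / 2 * (u0^2 / 4 * (u - u0))"
      using sub_sin_ge[OF that, of u0] u0 t by (intro mult_left_mono) auto
    moreover have "t / 2 * (u0^2 / 4 * (u - u0)) = t * u0^2 / 8 * u - (t * u0^3) / 8"
      by (simp add: power2_eq_square power3_eq_cube field_simps)
    moreover have "c * sin u \<le> t / 2 * sin u" using c that sin_ge_zero by (intro mult_right_mono) auto
    moreover have "t / 2 * (u - sin u) = t / 2 * u - t / 2 * sin u" by (rule right_diff_distrib)
    ultimately show ?thesis unfolding tu3 by linarith
  qed
  have "norm (F (\<i> * of_real \<phi>) - Lm) \<le> (exp (1 + 1/8) + 2) * exp (- pi * t / 4) / (t * u0^2 / 8)"
    unfolding \<phi>_def
  proof (rule lower_rotated_le[OF F Lm t c(1) _ _ _ *])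
    have "u0\<^sup>2 \<le> 1" using u0 by (intro power_le_one) auto
    hence "t * u0\<^sup>2 \<le> t * 1" using t by (intro mult_left_mono) auto
    thus "t * u0\<^sup>2 / 8 \<le> t / 2" using t by simp
  qed (use u0 t in auto)
  also have "\<dots> = 8 * (exp (1 + 1/8) + 2) * exp (- pi * t / 4) * u0"
  proof -
    define y where "y = t * u0^2"
    have y: "y > 0" "u0 * y = 1" using tu3 u0 t by (auto simp: y_def power3_eq_cube power2_eq_square mult_ac)
    hence u0y: "u0 = 1 / y" by (simp add: eq_divide_eq)
    show ?thesis unfolding y_def[symmetric] unfolding u0y using y by (simp add: field_simps)
  qed
  also have "\<dots> \<le> 100 * exp (- pi * t / 4) * u0"
  proof (intro mult_right_mono)
    have "exp (1 + 1/8) \<le> exp (2::real)" by simp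
    also note e2
    finally show "8 * (exp (1 + 1/8) + 2) \<le> (100::real)" by simp
  qed (use u0 in auto)
  finally show "norm (F (\<i> * of_real \<phi>) - Lm) \<le> 100 * exp (- pi * t / 4) * t powr (-1/3)" by (simp add: u0_def)
  have "norm (F (\<i> * of_real \<phi>) - Lm) \<le> (exp (1 + 0) + 2) * exp (- pi * t / 4) / (t / 2 - c)"
    unfolding \<phi>_def
  proof (rule lower_rotated_le[OF F Lm t c(1)])
    fix u :: real assume u: "u \<ge> 0" "u \<le> pi"
    have "c * sin u \<le> c * u" using sin_x_le_x[OF u(1)] c by (intro mult_left_mono) auto
    thus "c * sin u - t / 2 * u \<le> 0 - (t / 2 - c) * u" by (simp add: algebra_simps)
  qed (use c in auto)
  also have "\<dots> \<le> 100 * exp (- pi * t / 4) / (t / 2 - c)"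
    using e1 c by (intro divide_right_mono mult_right_mono) auto
  finally show "norm (F (\<i> * of_real \<phi>) - Lm) \<le> 100 * exp (- pi * t / 4) / (t / 2 - c)" .
qed

text \<open>The error allowed for an integer at distance at least j from sqrt(t / 2 pi), relative to
  t^(-1/4). Summability keeps the total error free of logarithms.\<close>

definition decay_weight :: "nat \<Rightarrow> real" where
  "decay_weight j = (if j = 0 then 1 else real j powr (-3/2))"

lemma summable_decay_weight: "summable decay_weight"
proof -
  have "summable (\<lambda>n. real n powr (-3/2))" by (subst summable_real_powr_iff) auto
  hence "summable (\<lambda>n. real (Suc n) powr (-3/2))" by (subst summable_Suc_iff)
  hence "summable (\<lambda>n. decay_weight (Suc n))" by (simp add: decay_weight_def)
  thus ?thesis by (subst (asm) summable_Suc_iff)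
qed

lemma decay_weight_nonneg: "decay_weight j \<ge> 0"
  by (simp add: decay_weight_def)

text \<open>One has pi m^2 - t / 2 = pi (m - N0) (m + N0), and m + N0 is at least j and at least N0,
  hence at least sqrt(j N0). For j > 0 this gives t^(1/4) j^(3/2) as a lower bound of the modulus;
  for j = 0 the bound with t^(-1/3) is enough.\<close>

lemma decay_weight_bound:
  fixes m N0 t x :: real
  assumes t: "t \<ge> 4" and N0: "N0 = sqrt (t / (2 * pi))" and m: "m \<ge> 0" "\<bar>m - N0\<bar> \<ge> real j"
    and x1: "x \<le> K * t powr (-1/3)" and x2: "\<bar>pi * m\<^sup>2 - t / 2\<bar> > 0 \<Longrightarrow> x \<le> K / \<bar>pi * m\<^sup>2 - t / 2\<bar>" and K: "K \<ge> 0"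
  shows "x \<le> K * t powr (-1/4) * decay_weight j"
proof (cases "j = 0")
  case True
  have "K * t powr (-1/3) \<le> K * t powr (-1/4)" using t K by (intro mult_left_mono powr_mono) auto
  thus ?thesis using x1 True by (simp add: decay_weight_def)
next
  case False
  hence j: "real j \<ge> 1" by simp
  have N00: "N0 > 0" using N0 t by simp
  have N02: "N0\<^sup>2 = t / (2 * pi)" using N0 t by simp
  have eq: "\<bar>pi * m\<^sup>2 - t / 2\<bar> = pi * (\<bar>m - N0\<bar> * (m + N0))"
  proof -
    have "pi * m\<^sup>2 - t / 2 = pi * (m\<^sup>2 - N0\<^sup>2)" unfolding N02 by (simp add: field_simps)
    also have "m\<^sup>2 - N0\<^sup>2 = (m - N0) * (m + N0)" by (simp add: power2_eq_square algebra_simps)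
    finally show ?thesis using m N00 by (simp add: abs_mult)
  qed
  have "sqrt (real j * N0) \<le> m + N0"
  proof (rule real_le_lsqrt)
    have "real j * N0 \<le> (m + N0) * (m + N0)" using m N00 by (intro mult_mono) auto
    thus "real j * N0 \<le> (m + N0)\<^sup>2" by (simp add: power2_eq_square)
  qed (use m N00 in auto)
  hence lo: "pi * (\<bar>m - N0\<bar> * (m + N0)) \<ge> pi * (real j * sqrt (real j * N0))"
    using m N00 by (intro mult_left_mono mult_mono) auto
  have sN: "pi * sqrt N0 \<ge> t powr (1/4)"
  proof -
    have "sqrt N0 = (t / (2 * pi)) powr (1/4)" using t by (simp add: N0 powr_half_sqrt[symmetric] powr_powr)
    hence "pi * sqrt N0 = pi * (t powr (1/4) / (2 * pi) powr (1/4))" using t by (simp add: powr_divide)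
    moreover have "(2 * pi) powr (1/4) \<le> pi"
    proof -
      have "2 * pi \<le> pi ^ 4" 
      proof -
        have "2 * pi \<le> pi * pi" using pi_ge_two by (intro mult_right_mono) auto
        also have "\<dots> \<le> (pi * pi) * (pi * pi)" using pi_ge_two mult_mono[of 1 pi 1 pi] by (intro mult_le_cancel_left1[THEN iffD2]) auto
        finally show ?thesis by (simp add: power4_eq_xxxx mult.assoc)
      qed
      hence "(2 * pi) powr (1/4) \<le> (pi ^ 4) powr (1/4)" by (intro powr_mono2) auto
      also have "\<dots> = pi" by (simp add: powr_powr flip: powr_numeral)
      finally show ?thesis .
    qed
    moreover from this have "t powr (1/4) * (2 * pi) powr (1/4) \<le> t powr (1/4) * pi" by (intro mult_left_mono) auto
    ultimately show ?thesis by (simp add: pos_le_divide_eq mult.commute)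
  qed
  have "pi * (real j * sqrt (real j * N0)) = (pi * sqrt N0) * (real j powr (3/2))"
  proof -
    have "real j powr (3/2) = real j powr (1 + 1/2)" by simp
    also have "\<dots> = real j * sqrt (real j)" using j by (simp only: powr_add) (simp add: powr_half_sqrt)
    finally show ?thesis by (simp add: real_sqrt_mult)
  qed
  also have "\<dots> \<ge> t powr (1/4) * real j powr (3/2)" using sN by (intro mult_right_mono) auto
  finally have big: "\<bar>pi * m\<^sup>2 - t / 2\<bar> \<ge> t powr (1/4) * real j powr (3/2)" using lo eq by linarith
  have pos: "t powr (1/4) * real j powr (3/2) > 0" using t j by simp
  have "x \<le> K / \<bar>pi * m\<^sup>2 - t / 2\<bar>" using big pos by (intro x2) linarith
  also have "\<dots> \<le> K / (t powr (1/4) * real j powr (3/2))" by (rule divide_left_mono[OF big K mult_pos_pos[OF less_le_trans[OF pos big] pos]])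
  also have "\<dots> = K * t powr (-1/4) * decay_weight j" using False t by (simp add: decay_weight_def powr_minus_divide)
  finally show ?thesis .
qed

text \<open>A one-sided approximate functional equation. For integers up to N the integral beyond
  the cut is the complete one, which is a Dirichlet term, minus a small lower part; for the others
  it is small itself. The factor 2 is the one in front of S in
  \<open>mellin_zeta_rotated\<close>.\<close>

lemma norm_zeta_crit_le:
  obtains K where "K > 0" "\<And>t N. t \<ge> 4 \<Longrightarrow> real N < sqrt (t / (2 * pi)) \<Longrightarrow> sqrt (t / (2 * pi)) \<le> real N + 1 \<Longrightarrow>
    norm (zeta_crit t) \<le> 2 * norm (\<Sum>n<N. of_nat (Suc n) powr (- Complex (1/2) t)) + K"
proof -
  define W where "W = suminf decay_weight"
  have W0: "W \<ge> 0" unfolding W_def by (intro suminf_nonneg summable_decay_weight decay_weight_nonneg)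
  define K where "K = (400 * W + 4) * exp (3 + ln pi / 4)"
  have "norm (zeta_crit t) \<le> 2 * norm (\<Sum>n<N. of_nat (Suc n) powr (- Complex (1/2) t)) + K"
    if t: "t \<ge> 4" and N: "real N < sqrt (t / (2 * pi))" "sqrt (t / (2 * pi)) \<le> real N + 1" for t N
  proof -
    define N0 where "N0 = sqrt (t / (2 * pi))"
    have N02: "N0\<^sup>2 = t / (2 * pi)" "N0 > 0" using t by (auto simp: N0_def)
    define a where "a = Complex (1/4) (t/2)"
    define A where "A = exp (- a * of_real (ln pi)) * Gamma a"
    define \<phi> where "\<phi> = pi / 2 - 1 / t"
    define D where "D = (\<Sum>n<N. of_nat (Suc n) powr (- Complex (1/2) t))"
    \<comment> \<open>The order of magnitude of the Gamma factor A; every error is measured by it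
      and the bound is finally divided by |A|.\<close>
    define X where "X = exp (- pi * t / 4) * t powr (-1/4)"
    have it: "1 / t \<le> 1 / 4" "1 / t > 0" using t by (auto simp: divide_simps)
    have \<phi>: "0 \<le> \<phi>" "\<phi> < pi / 2" unfolding \<phi>_def using it pi_gt3 by linarith+
    have t0: "t \<ge> 0" using t by simp
    from mellin_zeta_rotated[OF t0 \<phi>] obtain F Lp Lm S where
      F: "\<And>n w. (F n has_field_derivative mellin_exp t (pi_sq n) w) (at w)" and
      Lp: "\<And>n. ((\<lambda>v. F n (of_real v)) \<longlongrightarrow> Lp n) at_top" and
      Lm: "\<And>n. ((\<lambda>v. F n (of_real v)) \<longlongrightarrow> Lm n) at_bot" and
      diff: "\<And>n. Lp n - Lm n = A * of_nat (Suc n) powr (- Complex (1/2) t)" and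
      S: "(\<lambda>n. Re (Lp n - F n (\<i> * of_real \<phi>))) sums S" and
      mz: "mellin_zeta t = of_real (2 * S - Re (exp (\<i> * a * of_real \<phi>) / a))"
      unfolding a_def A_def by blast
    have psq: "pi_sq n = pi * (real (Suc n))\<^sup>2" for n by (simp add: pi_sq_def)
    have lower: "norm (F n (\<i> * of_real \<phi>) - Lm n) \<le> 100 * X * decay_weight (N - Suc n)" if n: "n < N" for n
    proof -
      have lt: "real (Suc n) < N0" using n N by (simp add: N0_def)
      hence "(real (Suc n))\<^sup>2 < N0\<^sup>2" by (intro power_strict_mono) auto
      hence c: "pi_sq n < t / 2" unfolding psq N02 by (simp add: field_simps)
      note b = lower_rotated_bound[OF F[of n] Lm[of n] t pi_sq_pos c, folded \<phi>_def]
      have "norm (F n (\<i> * of_real \<phi>) - Lm n) \<le> 100 * exp (- pi * t / 4) * t powr (-1/4) * decay_weight (N - Suc n)"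
      proof (rule decay_weight_bound[OF t N0_def, of "real (Suc n)"])
        show "real (N - Suc n) \<le> \<bar>real (Suc n) - N0\<bar>" using n N by (simp add: N0_def of_nat_diff)
        show "norm (F n (\<i> * of_real \<phi>) - Lm n) \<le> 100 * exp (- pi * t / 4) / \<bar>pi * (real (Suc n))\<^sup>2 - t / 2\<bar>"
          using b(2) c unfolding psq[symmetric] by simp
      qed (use b(1) in auto)
      thus ?thesis by (simp add: X_def mult.assoc)
    qed
    have upper: "norm (Lp n - F n (\<i> * of_real \<phi>)) \<le> 100 * X * decay_weight (n - N)" if n: "n \<ge> N" for n
    proof -
      have le: "N0 \<le> real (Suc n)" using n N by (simp add: N0_def)
      hence "N0\<^sup>2 \<le> (real (Suc n))\<^sup>2" using N02 by (intro power_mono) auto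
      hence c: "t / 2 \<le> pi_sq n" unfolding psq N02 by (simp add: field_simps)
      note b = upper_rotated_bound[OF F[of n] Lp[of n] t c, folded \<phi>_def]
      have "norm (Lp n - F n (\<i> * of_real \<phi>)) \<le> 100 * exp (- pi * t / 4) * t powr (-1/4) * decay_weight (n - N)"
      proof (rule decay_weight_bound[OF t N0_def, of "real (Suc n)"])
        show "real (n - N) \<le> \<bar>real (Suc n) - N0\<bar>" using n N by (simp add: N0_def of_nat_diff)
        show "norm (Lp n - F n (\<i> * of_real \<phi>)) \<le> 100 * exp (- pi * t / 4) / \<bar>pi * (real (Suc n))\<^sup>2 - t / 2\<bar>"
          if "\<bar>pi * (real (Suc n))\<^sup>2 - t / 2\<bar> > 0"
          using b(2) c that unfolding psq[symmetric] by simp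
      qed (use b(1) in auto)
      thus ?thesis by (simp add: X_def mult.assoc)
    qed
    have X0: "X > 0" using t by (simp add: X_def)
    have dsum: "(\<Sum>n<M. decay_weight n) \<le> W" for M
      unfolding W_def by (intro sum_le_suminf summable_decay_weight) (auto simp: decay_weight_nonneg)
    have "(\<lambda>n. Re (Lp (n + N) - F (n + N) (\<i> * of_real \<phi>))) sums (S - (\<Sum>n<N. Re (Lp n - F n (\<i> * of_real \<phi>))))"
      by (rule sums_split_initial_segment[OF S])
    moreover have "norm (\<Sum>n. Re (Lp (n + N) - F (n + N) (\<i> * of_real \<phi>))) \<le> (\<Sum>n. 100 * X * decay_weight n)"
    proof (rule norm_suminf_le)
      fix n show "norm (Re (Lp (n + N) - F (n + N) (\<i> * of_real \<phi>))) \<le> 100 * X * decay_weight n"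
        using upper[of "n + N"] abs_Re_le_cmod[of "Lp (n + N) - F (n + N) (\<i> * of_real \<phi>)"] by simp
    qed (intro summable_mult summable_decay_weight)
    ultimately have tail: "\<bar>S - (\<Sum>n<N. Re (Lp n - F n (\<i> * of_real \<phi>)))\<bar> \<le> 100 * X * W"
      by (simp add: sums_iff suminf_mult[OF summable_decay_weight] W_def)
    \<comment> \<open>The complete integrals add up to \<open>A * D\<close>; what remains are the
      lower parts, each bounded by \<open>lower\<close>.\<close>
    have "(\<Sum>n<N. Re (Lp n - F n (\<i> * of_real \<phi>))) = Re (A * D) - Re (\<Sum>n<N. F n (\<i> * of_real \<phi>) - Lm n)"
    proof -
      have "A * D = (\<Sum>n<N. Lp n - Lm n)" by (simp add: D_def sum_distrib_left diff)
      thus ?thesis by (simp add: sum_subtractf)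
    qed
    moreover have "\<bar>Re (A * D)\<bar> \<le> norm A * norm D" using abs_Re_le_cmod[of "A * D"] by (simp add: norm_mult)
    moreover have "\<bar>Re (\<Sum>n<N. F n (\<i> * of_real \<phi>) - Lm n)\<bar> \<le> 100 * X * W"
    proof -
      have "\<bar>Re (\<Sum>n<N. F n (\<i> * of_real \<phi>) - Lm n)\<bar> \<le> norm (\<Sum>n<N. F n (\<i> * of_real \<phi>) - Lm n)" by (rule abs_Re_le_cmod)
      also have "\<dots> \<le> (\<Sum>n<N. 100 * X * decay_weight (N - Suc n))"
        by (rule order.trans[OF norm_sum sum_mono]) (use lower in auto)
      also have "\<dots> = 100 * X * (\<Sum>n<N. decay_weight n)"
        unfolding sum_distrib_left[symmetric] by (subst sum.nat_diff_reindex) simp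
      also have "\<dots> \<le> 100 * X * W" using X0 dsum by (intro mult_left_mono) auto
      finally show ?thesis .
    qed
    ultimately have Sle: "\<bar>S\<bar> \<le> norm A * norm D + 200 * X * W" using tail by linarith
    have pole: "\<bar>Re (exp (\<i> * a * of_real \<phi>) / a)\<bar> \<le> 4 * X"
    proof -
      have "\<bar>Re (exp (\<i> * a * of_real \<phi>) / a)\<bar> \<le> norm (exp (\<i> * a * of_real \<phi>) / a)" by (rule abs_Re_le_cmod)
      also have "\<dots> = exp (- t / 2 * \<phi>) / norm a" by (simp add: norm_divide a_def)
      \<comment> \<open>At this angle the pole term has the exponential size exp(-pi t / 4) of A,
        and 1 / |a| contributes the further factor 1 / t.\<close>
      also have "- t / 2 * \<phi> = 1/2 + - pi * t / 4" using t by (simp add: \<phi>_def field_simps)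
      also have "exp (1/2 + - pi * t / 4) / norm a \<le> exp (1/2 + - pi * t / 4) / (t / 2)"
        using abs_Im_le_cmod[of a] t by (intro divide_left_mono mult_pos_pos) (auto simp: a_def)
      also have "\<dots> = 2 * exp (1/2) * exp (- pi * t / 4) * t powr (-1)" using t by (simp only: exp_add) (simp add: powr_minus_divide)
      also have "\<dots> \<le> 2 * 2 * exp (- pi * t / 4) * t powr (-1/4)"
      proof (intro mult_mono powr_mono)
        have "(exp (1/2))\<^sup>2 = exp (1::real)" by (simp add: power2_eq_square exp_add[symmetric])
        also have "\<dots> \<le> 2\<^sup>2" using exp_le by simp
        finally show "exp (1/2) \<le> (2::real)" by (rule power2_le_imp_le) simp
      qed (use t in auto)
      finally show ?thesis by (simp add: X_def)
    qed
    have "norm (mellin_zeta t) = \<bar>2 * S - Re (exp (\<i> * a * of_real \<phi>) / a)\<bar>" unfolding mz by (rule norm_of_real)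
    also have "\<dots> \<le> 2 * (norm A * norm D) + (400 * W + 4) * X" using Sle pole by (simp add: algebra_simps)
    finally have mzle: "norm (mellin_zeta t) \<le> 2 * (norm A * norm D) + (400 * W + 4) * X" .
    have A_ge: "exp (- (3 + ln pi / 4)) * X \<le> norm A"
    proof -
      have "exp (- ln pi / 4) * (exp (-3) * t powr (-1/4) * exp (- pi * t / 4)) \<le> exp (- ln pi / 4) * norm (Gamma a)"
        unfolding a_def by (intro mult_left_mono norm_Gamma_quarter_ge t) auto
      also have "\<dots> = norm A" by (simp add: A_def norm_mult a_def)
      also have "exp (- ln pi / 4) * (exp (-3) * t powr (-1/4) * exp (- pi * t / 4)) = exp (- (3 + ln pi / 4)) * X"
      proof -
        have "exp (- (3 + ln pi / 4)) = exp (-3) * exp (- ln pi / 4)" by (simp add: exp_add[symmetric])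
        thus ?thesis unfolding X_def by (simp only: mult_ac)
      qed
      finally show ?thesis .
    qed
    hence A0: "norm A > 0" using X0 by (meson exp_gt_zero less_le_trans mult_pos_pos)
    have "X \<le> exp (3 + ln pi / 4) * norm A" using A_ge by (simp add: exp_minus field_simps)
    hence "(400 * W + 4) * X \<le> (400 * W + 4) * (exp (3 + ln pi / 4) * norm A)" using W0 by (intro mult_left_mono) auto
    hence "norm (mellin_zeta t) \<le> norm A * (2 * norm D + K)" using mzle by (simp add: K_def algebra_simps)
    moreover have "norm (mellin_zeta t) = norm A * norm (zeta_crit t)"
      unfolding zeta_crit_mellin[symmetric] A_def a_def by (simp add: norm_mult)
    ultimately show ?thesis using A0 by (simp add: D_def)
  qed
  moreover have "K > 0" using W0 by (simp add: K_def add_nonneg_pos)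
  ultimately show ?thesis using that by blast
qed

section \<open>From the hypothesis to the Dirichlet sum: partial summation over dyadic
  blocks\<close>

lemma norm_weighted_sum_le:
  fixes c :: "nat \<Rightarrow> complex" and w :: "nat \<Rightarrow> real"
  assumes dec: "\<And>n. m \<le> n \<Longrightarrow> w (Suc n) \<le> w n" and nonneg: "\<And>n. m \<le> n \<Longrightarrow> w n \<ge> 0"
    and B: "\<And>k. m \<le> k \<Longrightarrow> k \<le> M \<Longrightarrow> norm (\<Sum>n=m..<k. c n) \<le> B"
    and k: "m \<le> k" "k \<le> M"
  shows "norm (\<Sum>n=m..<k. of_real (w n) * c n) \<le> w m * B"
proof -
  define C where "C k = (\<Sum>n=m..<k. c n)" for k
  have B0: "B \<ge> 0" using B[of m] k by simp
  \<comment> \<open>Partial summation by induction: once the boundary term \<open>w k * C k\<close>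
    is removed, each step adds one difference of weights times a partial sum.\<close>
  have *: "norm ((\<Sum>n=m..<k. of_real (w n) * c n) - of_real (w k) * C k) \<le> (w m - w k) * B"
    using k
  proof (induction k rule: dec_induct)
    case base
    show ?case by (simp add: C_def)
  next
    case (step k)
    have CS: "C (Suc k) = C k + c k" using step by (simp add: C_def)
    have "(\<Sum>n=m..<Suc k. of_real (w n) * c n) - of_real (w (Suc k)) * C (Suc k)
        = ((\<Sum>n=m..<k. of_real (w n) * c n) - of_real (w k) * C k) + of_real (w k - w (Suc k)) * C (Suc k)"
      using step by (simp add: CS algebra_simps)
    also have "norm \<dots> \<le> (w m - w k) * B + (w k - w (Suc k)) * B"
    proof (rule norm_triangle_mono)
      show "norm ((\<Sum>n=m..<k. of_real (w n) * c n) - of_real (w k) * C k) \<le> (w m - w k) * B" using step by simp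
      have "norm (of_real (w k - w (Suc k)) * C (Suc k)) = (w k - w (Suc k)) * norm (C (Suc k))"
        using dec[of k] step by (simp add: norm_mult flip: of_real_diff)
      also have "\<dots> \<le> (w k - w (Suc k)) * B"
        using dec[of k] step B[of "Suc k"] unfolding C_def by (intro mult_left_mono) auto
      finally show "norm (of_real (w k - w (Suc k)) * C (Suc k)) \<le> (w k - w (Suc k)) * B" .
    qed
    finally show ?case by (simp add: algebra_simps)
  qed
  have "norm (of_real (w k) * C k) \<le> w k * B"
    using nonneg[of k] B[of k] k unfolding C_def norm_mult by (simp add: mult_left_mono)
  hence "norm (((\<Sum>n=m..<k. of_real (w n) * c n) - of_real (w k) * C k) + of_real (w k) * C k) \<le> (w m - w k) * B + w k * B"
    using * by (intro norm_triangle_mono)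
  thus ?thesis by (simp add: algebra_simps)
qed

lemma of_nat_powr_critical:
  assumes "n > 0"
  shows "(of_nat n :: complex) powr (- Complex (1/2) t) = of_real (real n powr (-1/2)) * cnj (of_nat n powr (\<i> * of_real t))"
proof -
  have Ln: "Ln (of_nat n) = of_real (ln (real n))"
    using assms by (metis Ln_of_real of_nat_0_less_iff of_real_of_nat_eq)
  have "- Complex (1/2) t * of_real (ln (real n)) = of_real (-1/2 * ln (real n)) + cnj (\<i> * of_real t * of_real (ln (real n)))"
    by (simp add: complex_eq_iff)
  hence "exp (- Complex (1/2) t * of_real (ln (real n))) = of_real (exp (-1/2 * ln (real n))) * cnj (exp (\<i> * of_real t * of_real (ln (real n))))"
    by (simp only: exp_add exp_of_real exp_cnj)
  thus ?thesis using assms by (simp add: powr_def Ln)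
qed

lemma half_le_ln2: "1 / 2 \<le> ln (2::real)"
proof -
  have "(exp (1/2))\<^sup>2 = exp (1::real)" by (simp add: power2_eq_square exp_add[symmetric])
  also have "\<dots> \<le> 2\<^sup>2" using exp_le by simp
  finally have "exp (1/2) \<le> (2::real)" by (rule power2_le_imp_le) simp
  thus ?thesis by (subst ln_ge_iff) auto
qed

text \<open>On a block starting at a = 2^j the weight n^(-1/2) cancels the factor sqrt a of the
  hypothesis, so each of the O(ln t) dyadic blocks contributes at most A t^\<Delta>.\<close>

lemma critical_sum_le:
  assumes A: "A > 0" and t: "t \<ge> 4" and N: "real N < sqrt (t / (2 * pi))"
    and hyp: "\<And>a b. 0 < a \<Longrightarrow> a \<le> b \<Longrightarrow> b \<le> 2 * a \<Longrightarrow> b \<le> sqrt (t / (2 * pi)) \<Longrightarrow>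
           norm (\<Sum>n\<in>{n::nat. 0 < n \<and> a \<le> real n \<and> real n < b}. (of_nat n :: complex) powr (\<i> * of_real t))
             < A * sqrt a * t powr \<Delta>"
  shows "norm (\<Sum>n<N. of_nat (Suc n) powr (- Complex (1/2) t)) \<le> 4 * A * t powr \<Delta> * ln t + 1"
proof -
  define f where "f n = (of_nat n :: complex) powr (- Complex (1/2) t)" for n
  define g where "g n = cnj ((of_nat n :: complex) powr (\<i> * of_real t))" for n
  define w where "w n = real n powr (-1/2)" for n
  have fg: "f n = of_real (w n) * g n" if "n > 0" for n
    unfolding f_def g_def w_def by (rule of_nat_powr_critical[OF that])
  have block: "norm (\<Sum>n=2^j..<k. f n) \<le> A * t powr \<Delta>" if k: "2^j \<le> k" "k \<le> 2^Suc j" "k \<le> N" for j k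
  proof -
    have part: "norm (\<Sum>n=2^j..<k'. g n) \<le> A * sqrt (2^j) * t powr \<Delta>" if k': "2^j \<le> k'" "k' \<le> k" for k'
    proof -
      have p: "(2::nat)^j > 0" by simp
      have set: "{n::nat. 0 < n \<and> real (2^j) \<le> real n \<and> real n < real k'} = {2^j..<k'}"
      proof -
        have "0 < n" if "2^j \<le> n" for n :: nat using that p by linarith
        thus ?thesis by (auto simp del: of_nat_power)
      qed
      have "norm (\<Sum>n\<in>{n::nat. 0 < n \<and> real (2^j) \<le> real n \<and> real n < real k'}. (of_nat n :: complex) powr (\<i> * of_real t)) < A * sqrt (real (2^j)) * t powr \<Delta>"
      proof (rule hyp)
        show "real k' \<le> 2 * real (2^j)" using k k' by (metis le_trans of_nat_le_iff of_nat_mult of_nat_numeral power_Suc)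
        show "real k' \<le> sqrt (t / (2 * pi))" using N k k' by linarith
      qed (use k' in auto)
      hence "norm (\<Sum>n=2^j..<k'. (of_nat n :: complex) powr (\<i> * of_real t)) \<le> A * sqrt (2^j) * t powr \<Delta>"
        unfolding set by simp
      moreover have "(\<Sum>n=2^j..<k'. g n) = cnj (\<Sum>n=2^j..<k'. (of_nat n :: complex) powr (\<i> * of_real t))"
        by (simp add: g_def)
      ultimately show ?thesis by (simp only: complex_mod_cnj)
    qed
    have pos: "n > 0" if "(2::nat)^j \<le> n" for n using that by (metis less_le_trans zero_less_numeral zero_less_power)
    have "norm (\<Sum>n=2^j..<k. of_real (w n) * g n) \<le> w (2^j) * (A * sqrt (2^j) * t powr \<Delta>)"
    proof (rule norm_weighted_sum_le[OF _ _ part k(1) order.refl])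
      fix n :: nat assume "2^j \<le> n"
      from pos[OF this] show "w (Suc n) \<le> w n" unfolding w_def by (intro powr_mono2') auto
      show "w n \<ge> 0" by (simp add: w_def)
    qed
    also have "(\<Sum>n=2^j..<k. of_real (w n) * g n) = (\<Sum>n=2^j..<k. f n)"
      by (intro sum.cong refl) (use fg pos in auto)
    also have "w (2^j) * (A * sqrt (2^j) * t powr \<Delta>) = (w (2^j) * sqrt (2^j)) * (A * t powr \<Delta>)" by (simp only: mult_ac)
    also have "w (2^j) * sqrt (2^j) = 1"
      by (simp add: w_def powr_minus powr_half_sqrt)
    finally show ?thesis by simp
  qed
  have dy: "norm (\<Sum>n=1..<k. f n) \<le> real j * (A * t powr \<Delta>)" if "1 \<le> k" "k \<le> 2^j" "k \<le> N" for j k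
    using that
  proof (induction j arbitrary: k)
    case (Suc j)
    show ?case
    proof (cases "k \<le> 2^j")
      case True
      with Suc have "norm (\<Sum>n=1..<k. f n) \<le> real j * (A * t powr \<Delta>)" by simp
      also have "\<dots> \<le> real (Suc j) * (A * t powr \<Delta>)" using A by (intro mult_right_mono) auto
      finally show ?thesis .
    next
      case False
      hence "(\<Sum>n=1..<k. f n) = (\<Sum>n=1..<2^j. f n) + (\<Sum>n=2^j..<k. f n)"
        by (intro sum.atLeastLessThan_concat[symmetric]) auto
      moreover have "norm (\<Sum>n=1..<2^j. f n) \<le> real j * (A * t powr \<Delta>)" using Suc False by (intro Suc.IH) auto
      moreover have "norm (\<Sum>n=2^j..<k. f n) \<le> A * t powr \<Delta>" using Suc.prems False by (intro block) auto
      ultimately have "norm (\<Sum>n=1..<k. f n) \<le> real j * (A * t powr \<Delta>) + A * t powr \<Delta>"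
        by (metis norm_triangle_mono)
      thus ?thesis by (simp add: algebra_simps)
    qed
  qed simp
  show ?thesis
  proof (cases "N = 0")
    case True
    thus ?thesis using A t by simp
  next
    case False
    \<comment> \<open>A number of doublings that passes t and therefore N.\<close>
    define j where "j = nat \<lceil>log 2 t\<rceil>"
    have lt: "log 2 t > 0" using t by simp
    have "t = 2 powr log 2 t" using t by simp
    also have "\<dots> \<le> 2 powr real j" unfolding j_def by (intro powr_mono) linarith+
    also have "\<dots> = 2 ^ j" by (simp add: powr_realpow)
    finally have tj: "t \<le> 2 ^ j" .
    have "sqrt (t / (2 * pi)) \<le> t"
    proof (rule real_le_lsqrt)
      have "t / (2 * pi) \<le> t / 1" using t pi_gt3 by (intro divide_left_mono) auto
      also have "\<dots> \<le> t\<^sup>2" using t by (simp add: power2_eq_square)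
      finally show "t / (2 * pi) \<le> t\<^sup>2" .
    qed (use t in auto)
    hence "real N \<le> 2 ^ j" using N tj by linarith
    hence Nj: "N \<le> 2 ^ j" by (metis of_nat_le_iff of_nat_numeral of_nat_power)
    have jle: "real j \<le> 4 * ln t"
    proof -
      have "real j \<le> log 2 t + 1" using lt unfolding j_def by linarith
      moreover have "log 2 t \<le> ln t / (1/2)"
        unfolding log_def using half_le_ln2 t by (intro divide_left_mono) auto
      moreover have "1 \<le> ln t"
        using exp_le t by (subst ln_ge_iff) auto
      ultimately show ?thesis by simp
    qed
    have "(\<Sum>n<N. of_nat (Suc n) powr (- Complex (1/2) t)) = (\<Sum>n<N. f (Suc n))" by (simp add: f_def)
    also have "\<dots> = (\<Sum>n=1..<Suc N. f n)"
      unfolding One_nat_def sum.shift_bounds_Suc_ivl by (simp add: atLeast0LessThan)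
    \<comment> \<open>The hypothesis covers half-open ranges [a, b) with b at most sqrt(t / 2 pi).
      As N + 1 may exceed this, n = N is split off and bounded trivially by 1.\<close>
    also have "\<dots> = (\<Sum>n=1..<N. f n) + f N" using False by simp
    finally have eq: "(\<Sum>n<N. of_nat (Suc n) powr (- Complex (1/2) t)) = (\<Sum>n=1..<N. f n) + f N" .
    have "norm (\<Sum>n=1..<N. f n) \<le> real j * (A * t powr \<Delta>)" using False Nj by (intro dy) auto
    also have "\<dots> \<le> (4 * ln t) * (A * t powr \<Delta>)" using jle A by (intro mult_right_mono) auto
    finally have 1: "norm (\<Sum>n=1..<N. f n) \<le> 4 * A * t powr \<Delta> * ln t" by (simp add: mult_ac)
    have "norm (f N) = real N powr (-1/2)"
      unfolding f_def using norm_powr_real_powr[of "of_nat N" "- Complex (1/2) t"] by simp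
    also have "\<dots> \<le> 1" using False powr_mono[of "-1/2" 0 "real N"] by simp
    finally show ?thesis unfolding eq using 1 norm_triangle_mono by blast
  qed
qed

section \<open>Iterated window means\<close>

text \<open>The window lies to the right of x, so the k-fold iterate at x depends only on the values
  between x and x + k h.\<close>

definition window_mean :: "real \<Rightarrow> (real \<Rightarrow> complex) \<Rightarrow> real \<Rightarrow> complex" where
  "window_mean h f x = integral {0..h} (\<lambda>u. f (x + u)) / of_real h"

lemma continuous_on_window_mean:
  assumes "continuous_on UNIV f"
  shows "continuous_on UNIV (window_mean h f)"
proof -
  have "continuous_on (UNIV \<times> cbox 0 h) (\<lambda>(x, u). f (x + u))"
    unfolding case_prod_unfold
    by (rule continuous_on_compose2[OF assms]) (auto intro!: continuous_intros)
  hence "continuous_on UNIV (\<lambda>x. integral (cbox 0 h) (\<lambda>u. f (x + u)))"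
    by (rule integral_continuous_on_param)
  thus ?thesis unfolding window_mean_def
    by (cases "h = 0") (auto intro!: continuous_intros)
qed

lemma continuous_on_window_mean_funpow:
  "continuous_on UNIV f \<Longrightarrow> continuous_on UNIV ((window_mean h ^^ k) f)"
  by (induction k) (auto intro: continuous_on_window_mean)

lemma integrable_window:
  fixes f :: "real \<Rightarrow> 'a::banach"
  assumes "continuous_on UNIV f"
  shows "(\<lambda>u. f (x + u)) integrable_on {0..h}"
  by (rule integrable_continuous_real, rule continuous_on_compose2[OF assms])
     (auto intro!: continuous_intros)

lemma norm_window_mean_le:
  assumes "continuous_on UNIV f" "h > 0" and B: "\<And>u. x \<le> u \<Longrightarrow> u \<le> x + h \<Longrightarrow> norm (f u) \<le> B"
  shows "norm (window_mean h f x) \<le> B"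
proof -
  have "norm (integral {0..h} (\<lambda>u. f (x + u))) \<le> B * (h - 0)"
    by (rule integral_bound, use assms in simp, rule continuous_on_compose2[OF assms(1)])
       (auto intro!: continuous_intros B)
  thus ?thesis using assms(2) by (simp add: window_mean_def norm_divide divide_simps)
qed

lemma norm_window_mean_funpow_le:
  assumes "continuous_on UNIV f" "h > 0"
    and "\<And>u. x \<le> u \<Longrightarrow> u \<le> x + real k * h \<Longrightarrow> norm (f u) \<le> B"
  shows "norm ((window_mean h ^^ k) f x) \<le> B"
  using assms
proof (induction k arbitrary: f)
  case (Suc k)
  have "norm ((window_mean h ^^ k) (window_mean h f) x) \<le> B"
  proof (rule Suc.IH)
    fix u assume u: "x \<le> u" "u \<le> x + real k * h"
    show "norm (window_mean h f u) \<le> B"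
      by (rule norm_window_mean_le) (use Suc.prems u in \<open>auto simp: algebra_simps\<close>)
  qed (use Suc.prems continuous_on_window_mean in auto)
  thus ?case by (simp only: funpow_Suc_right o_apply)
qed auto

lemma window_mean_diff:
  assumes "continuous_on UNIV f" "continuous_on UNIV g"
  shows "window_mean h (\<lambda>x. f x - g x) = (\<lambda>x. window_mean h f x - window_mean h g x)"
  unfolding window_mean_def
  by (rule ext, subst integral_diff) (auto intro: integrable_window assms simp: diff_divide_distrib)

lemma window_mean_funpow_diff:
  assumes "continuous_on UNIV f" "continuous_on UNIV g"
  shows "(window_mean h ^^ k) (\<lambda>x. f x - g x) = (\<lambda>x. (window_mean h ^^ k) f x - (window_mean h ^^ k) g x)"
proof (induction k)
  case (Suc k)
  show ?case
    unfolding funpow.simps o_apply Suc.IH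
    by (rule window_mean_diff) (intro continuous_on_window_mean_funpow assms)+
qed auto

lemma has_integral_window_deriv:
  fixes g :: "real \<Rightarrow> complex"
  assumes "\<And>x. (g has_vector_derivative g' x) (at x)" "h > 0"
  shows "((\<lambda>u. g' (x + u)) has_integral g (x + h) - g x) {0..h}"
proof -
  have "((\<lambda>u. g' (x + u)) has_integral g (x + h) - g (x + 0)) {0..h}"
  proof (rule fundamental_theorem_of_calculus)
    fix u
    have "((\<lambda>u. g (x + u)) has_vector_derivative 1 *\<^sub>R g' (x + u)) (at u within {0..h})"
      by (rule vector_diff_chain_within[where g = g and f = "\<lambda>u. x + u", unfolded o_def])
         (auto intro!: derivative_eq_intros intro: has_vector_derivative_at_within[OF assms(1)])
    thus "((\<lambda>u. g (x + u)) has_vector_derivative g' (x + u)) (at u within {0..h})" by simp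
  qed (use assms in auto)
  thus ?thesis by simp
qed

text \<open>For l = ln n this is n^(-ix), the oscillating factor of a Dirichlet term.\<close>

definition freq_wave :: "real \<Rightarrow> real \<Rightarrow> complex" where
  "freq_wave l x = exp (- \<i> * of_real (l * x))"

lemma freq_wave_0 [simp]: "freq_wave 0 x = 1"
  and norm_freq_wave [simp]: "norm (freq_wave l x) = 1"
  and freq_wave_add: "freq_wave (l + l') x = freq_wave l x * freq_wave l' x"
  unfolding freq_wave_def exp_add[symmetric] by (simp_all add: algebra_simps)

lemma has_vector_derivative_freq_wave [derivative_intros]:
  "(freq_wave l has_vector_derivative (- \<i> * of_real l * freq_wave l x)) (at x within A)"
proof -
  have "((\<lambda>z. exp (- \<i> * (of_real l * z))) has_field_derivative (- \<i> * of_real l * freq_wave l x)) (at (of_real x))"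
    by (auto intro!: derivative_eq_intros simp: freq_wave_def)
  from has_vector_derivative_at_within[OF has_vector_derivative_real_field[OF this]]
  show ?thesis by (simp add: freq_wave_def[abs_def])
qed

lemma continuous_on_freq_wave [continuous_intros]: "continuous_on A (freq_wave l)"
  unfolding freq_wave_def by (intro continuous_intros)

text \<open>The eigenvalue of \<open>window_mean h\<close> on \<open>freq_wave l\<close>; iterating
  the mean raises it to a power.\<close>

definition wave_damping :: "real \<Rightarrow> real \<Rightarrow> complex" where
  "wave_damping h l = (if l = 0 then 1 else (freq_wave l h - 1) / (- \<i> * of_real (l * h)))"

lemma norm_wave_damping_le:
  assumes "h > 0" "l \<ge> 1/2"
  shows "norm (wave_damping h l) \<le> 4 / h"
proof -
  have "norm (freq_wave l h - 1) \<le> 2" using norm_triangle_ineq4[of "freq_wave l h" 1] by simp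
  hence "norm (wave_damping h l) \<le> 2 / (l * h)"
    using assms by (simp add: wave_damping_def norm_divide norm_mult divide_right_mono)
  also have "\<dots> \<le> 2 / (1/2 * h)" using assms by (intro divide_left_mono mult_right_mono) auto
  finally show ?thesis by simp
qed

lemma window_mean_freq_wave:
  assumes "h > 0"
  shows "window_mean h (freq_wave l) x = wave_damping h l * freq_wave l x"
proof (cases "l = 0")
  case True
  thus ?thesis using assms by (simp add: window_mean_def wave_damping_def scaleR_conv_of_real)
next
  case False
  have "window_mean h (freq_wave l) x
      = (freq_wave l (x + h) / (- \<i> * of_real l) - freq_wave l x / (- \<i> * of_real l)) / of_real h"
  unfolding window_mean_def
  proof (rule arg_cong[where f = "\<lambda>z. z / of_real h"], rule integral_unique, rule has_integral_window_deriv[OF _ assms])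
    fix x
    have "((\<lambda>x. freq_wave l x / (- \<i> * of_real l)) has_vector_derivative (- \<i> * of_real l * freq_wave l x) / (- \<i> * of_real l)) (at x)"
      by (rule has_vector_derivative_divide[OF has_vector_derivative_freq_wave])
    thus "((\<lambda>x. freq_wave l x / (- \<i> * of_real l)) has_vector_derivative freq_wave l x) (at x)"
      using False by simp
  qed
  moreover have "freq_wave l (x + h) = freq_wave l x * freq_wave l h"
    unfolding freq_wave_def exp_add[symmetric] by (simp add: algebra_simps)
  moreover have quot: "(A * B / c - A / c) / H = (B - 1) / (c * H) * A" for A B c H :: complex
    unfolding divide_inverse inverse_mult_distrib by (simp only: left_diff_distrib right_diff_distrib mult_1 mult_ac)
  ultimately show ?thesis using False
    by (simp only: wave_damping_def of_real_mult quot mult.assoc if_False)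
qed

lemma window_mean_wave_sum:
  assumes "h > 0" "finite J"
  shows "window_mean h (\<lambda>x. \<Sum>j\<in>J. a j * freq_wave (l j) x) = (\<lambda>x. \<Sum>j\<in>J. (a j * wave_damping h (l j)) * freq_wave (l j) x)"
proof
  fix x
  have "window_mean h (\<lambda>x. \<Sum>j\<in>J. a j * freq_wave (l j) x) x = (\<Sum>j\<in>J. a j * window_mean h (freq_wave (l j)) x)"
    unfolding window_mean_def
  proof (subst integral_sum[OF assms(2)])
    show "(\<lambda>u. a j * freq_wave (l j) (x + u)) integrable_on {0..h}" for j
      by (rule integrable_window[where f = "\<lambda>x. a j * freq_wave (l j) x"]) (intro continuous_intros)
  qed (simp add: sum_divide_distrib)
  thus "window_mean h (\<lambda>x. \<Sum>j\<in>J. a j * freq_wave (l j) x) x = (\<Sum>j\<in>J. (a j * wave_damping h (l j)) * freq_wave (l j) x)"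
    by (simp add: window_mean_freq_wave[OF assms(1)] mult.assoc)
qed

lemma window_mean_funpow_wave_sum:
  assumes "h > 0" "finite J"
  shows "(window_mean h ^^ k) (\<lambda>x. \<Sum>j\<in>J. a j * freq_wave (l j) x) = (\<lambda>x. \<Sum>j\<in>J. (a j * wave_damping h (l j) ^ k) * freq_wave (l j) x)"
proof (induction k)
  case (Suc k)
  show ?case
    unfolding funpow.simps o_apply Suc.IH window_mean_wave_sum[OF assms] by (simp add: mult_ac)
qed simp

text \<open>The constant wave has eigenvalue 1 and survives all means. The bound 1/2 on the other
  frequencies is a lower bound for ln 2, the smallest positive one that occurs.\<close>

lemma norm_window_mean_funpow_wave_sum_le:
  assumes h: "h > 0" and J: "finite J" "j0 \<in> J" and l0: "l j0 = 0" and l: "\<And>j. j \<in> J - {j0} \<Longrightarrow> l j \<ge> 1/2"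
  shows "norm ((window_mean h ^^ k) (\<lambda>x. \<Sum>j\<in>J. a j * freq_wave (l j) x) x - a j0)
           \<le> (\<Sum>j\<in>J - {j0}. norm (a j)) * (4 / h) ^ k"
proof -
  have "(window_mean h ^^ k) (\<lambda>x. \<Sum>j\<in>J. a j * freq_wave (l j) x) x - a j0
      = (\<Sum>j\<in>J - {j0}. (a j * wave_damping h (l j) ^ k) * freq_wave (l j) x)"
    unfolding window_mean_funpow_wave_sum[OF h J(1)]
    by (subst sum.remove[OF J]) (simp add: l0 wave_damping_def)
  also have "norm \<dots> \<le> (\<Sum>j\<in>J - {j0}. norm (a j) * (4 / h) ^ k)"
  proof (rule order.trans[OF norm_sum sum_mono])
    fix j assume "j \<in> J - {j0}"
    hence "norm (wave_damping h (l j)) ^ k \<le> (4 / h) ^ k"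
      by (intro power_mono norm_wave_damping_le h l) auto
    thus "norm (a j * wave_damping h (l j) ^ k * freq_wave (l j) x) \<le> norm (a j) * (4 / h) ^ k"
      by (simp add: norm_mult norm_power mult_left_mono)
  qed
  finally show ?thesis by (simp add: sum_distrib_right)
qed

text \<open>The mean of D' is a difference quotient of D. Hence F only has to be close to some
  derivative D', whose own size does not enter.\<close>

lemma norm_window_mean_minus_difference_quotient_le:
  assumes D: "\<And>x. (D has_vector_derivative D' x) (at x)" and h: "h > 0"
    and F: "continuous_on UNIV F" and B: "\<And>u. x \<le> u \<Longrightarrow> u \<le> x + h \<Longrightarrow> norm (F u - D' u) \<le> B"
  shows "norm (window_mean h F x - (D (x + h) - D x) / of_real h) \<le> B"
proof -
  have B0: "B \<ge> 0" using B[of x] h by (smt (verit) norm_ge_zero)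
  have "((\<lambda>u. F (x + u) - D' (x + u)) has_integral integral {0..h} (\<lambda>u. F (x + u)) - (D (x + h) - D x)) (cbox 0 h)"
    using has_integral_diff[OF integrable_integral[OF integrable_window[OF F]] has_integral_window_deriv[OF D h]] by simp
  from has_integral_bound[OF B0 this] have "norm (integral {0..h} (\<lambda>u. F (x + u)) - (D (x + h) - D x)) \<le> B * h"
    using B h by auto
  moreover have "window_mean h F x - (D (x + h) - D x) / of_real h = (integral {0..h} (\<lambda>u. F (x + u)) - (D (x + h) - D x)) / of_real h"
    by (simp add: window_mean_def diff_divide_distrib)
  ultimately show ?thesis using h by (simp add: norm_divide divide_simps)
qed

section \<open>The derivative of Z as a finite sum of waves\<close>

lemma eta_factor_freq_wave: "eta_factor t = 1 - of_real (sqrt 2) * freq_wave (ln 2) t"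
  by (simp add: eta_factor_eq freq_wave_def mult.commute)

definition eta_factor' :: "real \<Rightarrow> complex" where
  "eta_factor' t = of_real (sqrt 2) * \<i> * of_real (ln 2) * freq_wave (ln 2) t"

lemma has_vector_derivative_eta_factor [derivative_intros]:
  "(eta_factor has_vector_derivative eta_factor' t) (at t within A)"
  unfolding eta_factor_freq_wave[abs_def] eta_factor'_def
  by (auto intro!: derivative_eq_intros)

lemma norm_eta_factor_le: "norm (eta_factor t) \<le> 3"
proof -
  have "norm (eta_factor t) \<le> 1 + sqrt 2"
    unfolding eta_factor_freq_wave by (rule order.trans[OF norm_triangle_ineq4]) (simp add: norm_mult)
  also have "sqrt 2 \<le> (2::real)" by (rule real_le_lsqrt) auto
  finally show ?thesis by simp
qed

lemma norm_eta_factor'_le: "2 * norm (eta_factor' t) \<le> 3"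
proof -
  have "sqrt 2 \<le> (3/2::real)" by (rule real_le_lsqrt) (auto simp: power2_eq_square)
  moreover have "ln (2::real) \<le> 1" using ln_le_minus_one[of 2] by simp
  ultimately have "sqrt 2 * ln 2 \<le> 3/2 * (1::real)" by (intro mult_mono) auto
  thus ?thesis by (simp add: eta_factor'_def norm_mult)
qed

lemma eta_critical_eq: "eta (Complex (1/2) t) = exp (- \<i> * of_real (rs_theta t)) * of_real (hardy_Z t) * eta_factor t"
proof -
  have "exp (- \<i> * of_real (rs_theta t)) * exp (\<i> * of_real (rs_theta t)) = 1" by (simp add: exp_add[symmetric])
  hence "zeta_crit t = exp (- \<i> * of_real (rs_theta t)) * of_real (hardy_Z t)"
    unfolding hardy_Z_complex[symmetric] by (metis mult.assoc mult_1)
  thus ?thesis using zeta_crit_eq[of t] eta_factor_nonzero[of t] by (simp add: field_simps)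
qed

text \<open>Differentiating \<open>eta\<close> = exp(-i theta) Z P isolates exp(-i theta) Z' P but
  leaves exp(-i theta) Z P', which is \<open>eta\<close> P' / P. The second factor P removes this
  denominator.\<close>

definition twisted_deriv :: "real \<Rightarrow> complex" where
  "twisted_deriv t = exp (- \<i> * of_real (rs_theta t)) * of_real (deriv hardy_Z t) * (eta_factor t)\<^sup>2"

definition eta_partial :: "nat \<Rightarrow> real \<Rightarrow> complex" where
  "eta_partial M t = (\<Sum>n<M. eta_term (Complex (1/2) t) n)"

text \<open>The expression of \<open>twisted_deriv\<close> through \<open>eta\<close>, with
  \<open>eta\<close> replaced by its partial sum and the derivative of theta by a constant \<tau>;
  this makes it a finite combination of waves.\<close>

definition twisted_partial :: "nat \<Rightarrow> real \<Rightarrow> real \<Rightarrow> complex" where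
  "twisted_partial M \<tau> t = (\<Sum>n<M. eta_term (Complex (1/2) t) n *
     (\<i> * of_real (\<tau> - ln (real (Suc n))) * eta_factor t - eta_factor' t))"

lemma eta_term_freq_wave:
  "eta_term (Complex (1/2) t) n = (-1) ^ n * of_real (real (Suc n) powr (-1/2)) * freq_wave (ln (real (Suc n))) t"
proof -
  have "cnj (of_nat (Suc n) powr (\<i> * of_real t)) = freq_wave (ln (real (Suc n))) t"
  proof -
    have "Ln (of_nat (Suc n)) = of_real (ln (real (Suc n)))"
      by (metis Ln_of_real of_nat_0_less_iff of_real_of_nat_eq zero_less_Suc)
    hence "of_nat (Suc n) powr (\<i> * of_real t) = exp (\<i> * of_real t * of_real (ln (real (Suc n))))"
      by (simp add: powr_def del: of_nat_Suc)
    thus ?thesis by (simp add: freq_wave_def exp_cnj mult_ac del: of_nat_Suc)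
  qed
  thus ?thesis unfolding eta_term_def using of_nat_powr_critical[of "Suc n" t] by simp
qed

lemma has_vector_derivative_eta_partial:
  "(eta_partial M has_vector_derivative (\<Sum>n<M. - \<i> * of_real (ln (real (Suc n))) * eta_term (Complex (1/2) t) n)) (at t)"
  unfolding eta_partial_def eta_term_freq_wave
  by (rule has_vector_derivative_sum, rule has_vector_derivative_eq_rhs,
      rule has_vector_derivative_mult_right, rule has_vector_derivative_freq_wave) (simp add: mult_ac)

lemma continuous_on_rs_theta: "continuous_on A rs_theta"
  using has_real_derivative_rs_theta by (meson DERIV_isCont continuous_at_imp_continuous_on)

lemma continuous_on_eta_factor: "continuous_on A eta_factor"
  unfolding eta_factor_freq_wave[abs_def] by (intro continuous_intros)

lemma continuous_on_twisted_deriv: "continuous_on A twisted_deriv"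
  unfolding twisted_deriv_def
  by (intro continuous_intros continuous_on_rs_theta continuous_on_deriv_hardy_Z continuous_on_eta_factor)

lemma continuous_on_twisted_partial: "continuous_on A (twisted_partial M \<tau>)"
  unfolding twisted_partial_def eta_term_freq_wave eta_factor'_def
  by (intro continuous_intros continuous_on_eta_factor)

lemma norm_twisted_deriv_le: "norm (twisted_deriv t) \<le> 9 * \<bar>deriv hardy_Z t\<bar>"
proof -
  have "norm (eta_factor t) ^ 2 \<le> 3 ^ 2" by (intro power_mono norm_eta_factor_le) auto
  hence "\<bar>deriv hardy_Z t\<bar> * norm (eta_factor t) ^ 2 \<le> \<bar>deriv hardy_Z t\<bar> * 9"
    by (intro mult_left_mono) auto
  thus ?thesis by (simp add: twisted_deriv_def norm_mult norm_power)
qed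

text \<open>Write \<open>P\<close> for \<open>eta_factor\<close>. Since \<open>eta P = exp(-\<i>\<theta>) Z P\<^sup>2\<close>, the function \<open>exp(-\<i>\<theta>) Z' P\<^sup>2\<close> equals
  \<open>(eta P)' + \<i> \<theta>' eta P - 2 P' eta\<close>. Truncating \<open>eta\<close> here needs no bound on the derivative of the tail,
  because the mean of \<open>(eta P)'\<close> is a difference quotient.\<close>

lemma norm_window_mean_twisted_le:
  assumes h: "h > 0"
    and e: "\<And>u. x \<le> u \<Longrightarrow> u \<le> x + h \<Longrightarrow> norm (eta (Complex (1/2) u) - eta_partial M u) \<le> e"
    and \<delta>: "\<And>u. x \<le> u \<Longrightarrow> u \<le> x + h \<Longrightarrow> \<bar>rs_theta' u - \<tau>\<bar> * \<bar>hardy_Z u\<bar> \<le> \<delta>"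
  shows "norm (window_mean h (\<lambda>t. twisted_deriv t - twisted_partial M \<tau> t) x) \<le> 6 * e / h + 9 * \<delta> + 3 * \<bar>\<tau>\<bar> * e + 3 * e"
proof -
  define E where "E t = eta (Complex (1/2) t)" for t
  define P where "P = eta_factor"
  \<comment> \<open>The derivative of the tail occurs only inside the derivative of D, so after
    taking the mean only the size 3 e of D itself matters.\<close>
  define D where "D t = (E t - eta_partial M t) * P t" for t
  define \<epsilon> where "\<epsilon> t = exp (- \<i> * of_real (rs_theta t))" for t
  define z where "z = (\<lambda>t. complex_of_real (hardy_Z t))"
  define E' where "E' t = (- \<i> * of_real (rs_theta' t) * \<epsilon> t * z t + \<epsilon> t * of_real (deriv hardy_Z t)) * P t + \<epsilon> t * z t * eta_factor' t" for t
  have e': "(\<epsilon> has_vector_derivative (- \<i> * of_real (rs_theta' t) * \<epsilon> t)) (at t)" for t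
  proof -
    have "((\<lambda>t. - \<i> * of_real (rs_theta t)) has_vector_derivative (- \<i> * of_real (rs_theta' t))) (at t)"
      by (intro has_vector_derivative_mult_right has_vector_derivative_of_real)
         (rule has_real_derivative_rs_theta)
    from field_vector_diff_chain_at[OF this DERIV_exp] show ?thesis
      by (simp add: o_def \<epsilon>_def[abs_def])
  qed
  have z': "(z has_vector_derivative of_real (deriv hardy_Z t)) (at t)" for t
    unfolding z_def by (intro has_vector_derivative_of_real has_real_derivative_hardy_Z)
  have P': "(P has_vector_derivative eta_factor' t) (at t)" for t
    unfolding P_def by (rule has_vector_derivative_eta_factor)
  have Eeq: "E = (\<lambda>t. \<epsilon> t * z t * P t)" unfolding E_def \<epsilon>_def z_def P_def eta_critical_eq by simp
  have E'd: "(E has_vector_derivative E' t) (at t)" for t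
    unfolding Eeq E'_def by (rule has_vector_derivative_eq_rhs, rule has_vector_derivative_mult, rule has_vector_derivative_mult,
      rule e', rule z', rule P') (simp add: algebra_simps)
  define D' where "D' t = (E' t - (\<Sum>n<M. - \<i> * of_real (ln (real (Suc n))) * eta_term (Complex (1/2) t) n)) * P t + (E t - eta_partial M t) * eta_factor' t" for t
  have D': "(D has_vector_derivative D' t) (at t)" for t
    unfolding D_def D'_def
    by (rule has_vector_derivative_eq_rhs, rule has_vector_derivative_mult, rule has_vector_derivative_diff,
      rule E'd, rule has_vector_derivative_eta_partial, rule P') (simp add: algebra_simps)
  have part: "twisted_partial M \<tau> t = \<i> * of_real \<tau> * eta_partial M t * P t
      + (\<Sum>n<M. - \<i> * of_real (ln (real (Suc n))) * eta_term (Complex (1/2) t) n) * P t - eta_partial M t * eta_factor' t" for t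
    unfolding twisted_partial_def eta_partial_def P_def sum_distrib_left sum_distrib_right sum.distrib[symmetric] sum_subtractf[symmetric]
    by (rule sum.cong) (auto simp: algebra_simps)
  have tw: "twisted_deriv t = E' t * P t - E t * eta_factor' t + \<i> * of_real (rs_theta' t) * E t * P t" for t
    unfolding E'_def Eeq twisted_deriv_def \<epsilon>_def[symmetric] P_def[symmetric] by (simp add: algebra_simps power2_eq_square)
  \<comment> \<open>Three harmless terms remain: the variation of the derivative of theta, and the
    undifferentiated tail multiplied by \<tau> P and by 2 P'.\<close>
  have diff: "twisted_deriv t - twisted_partial M \<tau> t - D' t = \<i> * of_real (rs_theta' t - \<tau>) * (E t * P t)
      + \<i> * of_real \<tau> * (E t - eta_partial M t) * P t - 2 * eta_factor' t * (E t - eta_partial M t)" for t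
    unfolding tw part D'_def by (simp add: algebra_simps)
  have e0: "e \<ge> 0" using e[of x] h by (smt (verit) norm_ge_zero)
  have nP: "norm (P t) \<le> 3" for t unfolding P_def by (rule norm_eta_factor_le)
  have main: "norm (twisted_deriv u - twisted_partial M \<tau> u - D' u) \<le> 9 * \<delta> + 3 * \<bar>\<tau>\<bar> * e + 3 * e" if u: "x \<le> u" "u \<le> x + h" for u
  proof -
    note eu = e[OF u, folded E_def]
    have "norm (E u * P u) \<le> \<bar>hardy_Z u\<bar> * (3 * 3)"
    proof -
      have "norm (E u * P u) = \<bar>hardy_Z u\<bar> * (norm (P u) * norm (P u))"
        by (simp add: Eeq norm_mult z_def \<epsilon>_def)
      also have "\<dots> \<le> \<bar>hardy_Z u\<bar> * (3 * 3)" by (intro mult_left_mono mult_mono nP) auto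
      finally show ?thesis .
    qed
    hence "\<bar>rs_theta' u - \<tau>\<bar> * norm (E u * P u) \<le> \<bar>rs_theta' u - \<tau>\<bar> * (\<bar>hardy_Z u\<bar> * (3 * 3))" by (intro mult_left_mono) auto
    also have "\<dots> \<le> 9 * \<delta>" using \<delta>[OF u] by simp
    finally have 1: "norm (\<i> * of_real (rs_theta' u - \<tau>) * (E u * P u)) \<le> 9 * \<delta>"
      by (simp only: norm_mult norm_of_real) simp
    have "(\<bar>\<tau>\<bar> * norm (E u - eta_partial M u)) * norm (P u) \<le> (\<bar>\<tau>\<bar> * e) * 3"
      using e0 eu by (intro mult_mono nP) auto
    hence 2: "norm (\<i> * of_real \<tau> * (E u - eta_partial M u) * P u) \<le> 3 * \<bar>\<tau>\<bar> * e" by (simp add: norm_mult)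
    have "(2 * norm (eta_factor' u)) * norm (E u - eta_partial M u) \<le> 3 * e"
      using e0 eu by (intro mult_mono norm_eta_factor'_le) auto
    hence 3: "norm (2 * eta_factor' u * (E u - eta_partial M u)) \<le> 3 * e" by (simp add: norm_mult)
    show ?thesis unfolding diff using 1 2 3
      by (meson norm_triangle_mono norm_triangle_ineq4 order.trans add_mono)
  qed
  have nD: "norm (D u) \<le> 3 * e" if u: "x \<le> u" "u \<le> x + h" for u
  proof -
    have "norm (D u) \<le> e * 3" unfolding D_def norm_mult using e[OF u, folded E_def] e0
      by (intro mult_mono nP) auto
    thus ?thesis by simp
  qed
  have "norm (D (x + h) - D x) \<le> 6 * e"
    using nD[of x] nD[of "x + h"] h norm_triangle_ineq4[of "D (x + h)" "D x"] by simp
  hence "norm ((D (x + h) - D x) / of_real h) \<le> 6 * e / h"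
    using h by (simp add: norm_divide divide_right_mono)
  moreover have "norm (window_mean h (\<lambda>t. twisted_deriv t - twisted_partial M \<tau> t) x - (D (x + h) - D x) / of_real h)
      \<le> 9 * \<delta> + 3 * \<bar>\<tau>\<bar> * e + 3 * e"
    by (rule norm_window_mean_minus_difference_quotient_le[OF D' h _ main])
       (intro continuous_intros continuous_on_twisted_deriv continuous_on_twisted_partial)
  ultimately show ?thesis
    using norm_triangle_sub[of "window_mean h (\<lambda>t. twisted_deriv t - twisted_partial M \<tau> t) x" "(D (x + h) - D x) / of_real h"]
    by linarith
qed

text \<open>Each integer n yields two waves, with frequencies ln n and ln n + ln 2; the boolean in
  the index tells them apart. P and its derivative both feed the second wave, hence the summand ln 2
  in its coefficient. Only the index \<open>(0, False)\<close> has frequency 0, with coefficient i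
  \<tau>.\<close>

lemma norm_window_mean_twisted_partial_le:
  assumes h: "h > 0" and M: "M > 0"
  shows "norm ((window_mean h ^^ k) (twisted_partial M \<tau>) x - \<i> * of_real \<tau>)
           \<le> real M * (3 * \<bar>\<tau>\<bar> + 3 * real M + 2) * (4 / h) ^ k"
proof -
  define L where "L n = ln (real (Suc n))" for n
  define c where "c n = (-1 :: complex) ^ n * of_real (real (Suc n) powr (-1/2))" for n
  define a where "a = (\<lambda>(n, b). if b then - c n * of_real (sqrt 2) * \<i> * of_real (\<tau> - L n + ln 2) else c n * \<i> * of_real (\<tau> - L n))"
  define l where "l = (\<lambda>(n, b). L n + (if b then ln 2 else 0))"
  define J where "J = {..<M} \<times> (UNIV :: bool set)"
  have J: "finite J" "(0, False) \<in> J" using M by (auto simp: J_def)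
  have sum_J: "(\<Sum>j\<in>J. F j) = (\<Sum>n<M. F (n, False) + F (n, True))" for F :: "nat \<times> bool \<Rightarrow> 'b::comm_monoid_add"
  proof -
    have "(\<Sum>j\<in>J. F j) = (\<Sum>(n, b)\<in>J. F (n, b))" by simp
    thus ?thesis unfolding J_def sum.cartesian_product[symmetric] by (simp add: UNIV_bool add.commute)
  qed
  have tp: "twisted_partial M \<tau> = (\<lambda>t. \<Sum>j\<in>J. a j * freq_wave (l j) t)"
  proof
    fix t
    have "(\<Sum>j\<in>J. a j * freq_wave (l j) t) = (\<Sum>n<M. a (n, False) * freq_wave (l (n, False)) t + a (n, True) * freq_wave (l (n, True)) t)"
      by (rule sum_J)
    also have "\<dots> = twisted_partial M \<tau> t"
      unfolding twisted_partial_def eta_term_freq_wave L_def[symmetric] c_def[symmetric] eta_factor_freq_wave eta_factor'_def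
      by (intro sum.cong) (auto simp: a_def l_def freq_wave_add algebra_simps)
    finally show "twisted_partial M \<tau> t = (\<Sum>j\<in>J. a j * freq_wave (l j) t)" by simp
  qed
  have l0: "l (0, False) = 0" by (simp add: l_def L_def)
  have l1: "l j \<ge> 1/2" if "j \<in> J - {(0, False)}" for j
  proof -
    obtain n b where j: "j = (n, b)" by (cases j)
    have L0: "L n \<ge> 0" by (simp add: L_def)
    show ?thesis
    proof (cases b)
      case False
      hence "n \<ge> 1" using that j by (cases n) auto
      hence "ln 2 \<le> L n" unfolding L_def by (intro ln_mono) auto
      thus ?thesis using half_le_ln2 False j by (simp add: l_def)
    qed (use half_le_ln2 L0 j in \<open>simp add: l_def\<close>)
  qed
  have "(\<Sum>j\<in>J - {(0, False)}. norm (a j)) \<le> (\<Sum>j\<in>J. norm (a j))"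
    using J by (intro sum_mono2) auto
  also have "\<dots> = (\<Sum>n<M. norm (a (n, False)) + norm (a (n, True)))"
    by (rule sum_J)
  also have "\<dots> \<le> (\<Sum>n<M. 3 * \<bar>\<tau>\<bar> + 3 * real M + 2)"
  proof (rule sum_mono)
    fix n assume n: "n \<in> {..<M}"
    have c1: "norm (c n) \<le> 1"
      using powr_mono[of "-1/2" 0 "real (Suc n)"] by (simp add: c_def norm_mult norm_power)
    have L: "L n \<ge> 0" "L n \<le> real M"
      using ln_le_minus_one[of "real (Suc n)"] n by (auto simp: L_def)
    have "ln (2::real) \<le> 1" using ln_le_minus_one[of 2] by simp
    hence b: "\<bar>\<tau> - L n\<bar> \<le> \<bar>\<tau>\<bar> + real M" "\<bar>\<tau> - L n + ln 2\<bar> \<le> \<bar>\<tau>\<bar> + real M + 1"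
      using L half_le_ln2 by linarith+
    have "norm (a (n, False)) = norm (c n) * \<bar>\<tau> - L n\<bar>" by (simp add: a_def norm_mult flip: of_real_diff)
    also have "\<dots> \<le> 1 * (\<bar>\<tau>\<bar> + real M)" using c1 b by (intro mult_mono) auto
    finally have 1: "norm (a (n, False)) \<le> \<bar>\<tau>\<bar> + real M" by simp
    have "norm (a (n, True)) = norm (c n) * sqrt 2 * \<bar>\<tau> - L n + ln 2\<bar>"
      by (simp only: a_def norm_mult split if_True norm_minus_cancel norm_of_real norm_ii) simp
    also have "\<dots> \<le> (1 * 2) * (\<bar>\<tau>\<bar> + real M + 1)"
      using c1 b by (intro mult_mono real_le_lsqrt) auto
    finally show "norm (a (n, False)) + norm (a (n, True)) \<le> 3 * \<bar>\<tau>\<bar> + 3 * real M + 2" using 1 by simp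
  qed
  also have "\<dots> = real M * (3 * \<bar>\<tau>\<bar> + 3 * real M + 2)" by simp
  finally have S: "(\<Sum>j\<in>J - {(0, False)}. norm (a j)) \<le> real M * (3 * \<bar>\<tau>\<bar> + 3 * real M + 2)" .
  have a0: "a (0, False) = \<i> * of_real \<tau>" by (simp add: a_def c_def L_def)
  have "norm ((window_mean h ^^ k) (twisted_partial M \<tau>) x - \<i> * of_real \<tau>) \<le> (\<Sum>j\<in>J - {(0, False)}. norm (a j)) * (4 / h) ^ k"
    unfolding tp a0[symmetric] by (rule norm_window_mean_funpow_wave_sum_le) (use h J l0 l1 in auto)
  also have "\<dots> \<le> real M * (3 * \<bar>\<tau>\<bar> + 3 * real M + 2) * (4 / h) ^ k"
    using S h by (intro mult_right_mono) auto
  finally show ?thesis .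
qed

section \<open>Growth of Z under the hypothesis, and the final comparison\<close>

lemma hardy_Z_growth:
  fixes \<Delta> :: real
  assumes \<Delta>: "0 < \<Delta>"
    and hyp: "\<exists>A>0. \<forall>\<^sub>F t in at_top. \<forall>a b :: real.
           0 < a \<and> a \<le> b \<and> b \<le> 2 * a \<and> b \<le> sqrt (t / (2 * pi)) \<longrightarrow>
           norm (\<Sum>n\<in>{n::nat. 0 < n \<and> a \<le> real n \<and> real n < b}.
                   (of_nat n :: complex) powr (\<i> * of_real t))
             < A * sqrt a * t powr \<Delta>"
  obtains C t0 where "C > 0" "\<And>t. t \<ge> t0 \<Longrightarrow> \<bar>hardy_Z t\<bar> \<le> C * t powr \<Delta> * ln t"
proof -
  from hyp obtain A t1 where A: "A > 0" and t1: "\<And>t a b. t \<ge> t1 \<Longrightarrow> 0 < a \<Longrightarrow> a \<le> b \<Longrightarrow> b \<le> 2 * a \<Longrightarrow> b \<le> sqrt (t / (2 * pi)) \<Longrightarrow>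
           norm (\<Sum>n\<in>{n::nat. 0 < n \<and> a \<le> real n \<and> real n < b}. (of_nat n :: complex) powr (\<i> * of_real t))
             < A * sqrt a * t powr \<Delta>"
    unfolding eventually_at_top_linorder by blast
  obtain K where K: "K > 0" "\<And>t N. t \<ge> 4 \<Longrightarrow> real N < sqrt (t / (2 * pi)) \<Longrightarrow> sqrt (t / (2 * pi)) \<le> real N + 1 \<Longrightarrow>
    norm (zeta_crit t) \<le> 2 * norm (\<Sum>n<N. of_nat (Suc n) powr (- Complex (1/2) t)) + K"
    using norm_zeta_crit_le by blast
  have "\<bar>hardy_Z t\<bar> \<le> (8 * A + 2 + K) * t powr \<Delta> * ln t" if t: "t \<ge> max 4 t1" for t
  proof -
    \<comment> \<open>The ceiling minus one, instead of the floor, keeps N strictly below the square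
      root even when that is an integer.\<close>
    define N where "N = nat (\<lceil>sqrt (t / (2 * pi))\<rceil> - 1)"
    have "sqrt (t / (2 * pi)) > 0" using t by simp
    hence N: "real N < sqrt (t / (2 * pi))" "sqrt (t / (2 * pi)) \<le> real N + 1"
      unfolding N_def by linarith+
    have g1: "1 \<le> t powr \<Delta> * ln t"
    proof -
      have "1 \<le> t powr \<Delta>" using t \<Delta> by (intro ge_one_powr_ge_zero) auto
      moreover have "1 \<le> ln t" using exp_le t by (subst ln_ge_iff) auto
      ultimately show ?thesis using mult_mono[of 1 "t powr \<Delta>" 1 "ln t"] by simp
    qed
    have "\<bar>hardy_Z t\<bar> = norm (zeta_crit t)"
    proof -
      have "norm (exp (\<i> * of_real (rs_theta t)) * zeta_crit t) = norm (complex_of_real (hardy_Z t))"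
        unfolding hardy_Z_complex ..
      thus ?thesis by (simp add: norm_mult)
    qed
    also have "\<dots> \<le> 2 * norm (\<Sum>n<N. of_nat (Suc n) powr (- Complex (1/2) t)) + K"
      using t by (intro K(2) N) auto
    also have "norm (\<Sum>n<N. of_nat (Suc n) powr (- Complex (1/2) t)) \<le> 4 * A * t powr \<Delta> * ln t + 1"
      using t by (intro critical_sum_le A N t1) auto
    also have "2 * (4 * A * t powr \<Delta> * ln t + 1) + K = 8 * A * (t powr \<Delta> * ln t) + (2 + K) * 1" by simp
    also have "(2 + K) * 1 \<le> (2 + K) * (t powr \<Delta> * ln t)" using g1 K by (intro mult_left_mono) auto
    finally show ?thesis by (simp add: algebra_simps)
  qed
  thus ?thesis using A K(1) that[of "8 * A + 2 + K" "max 4 t1"] by simp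
qed

lemma norm_window_mean_twisted_deriv_le:
  assumes h: "h > 0" and B: "\<bar>hardy_Z x\<bar> \<le> B" "\<bar>hardy_Z (x + h)\<bar> \<le> B"
    and sgn: "(\<forall>u\<in>{x<..<x+h}. deriv hardy_Z u \<ge> 0) \<or> (\<forall>u\<in>{x<..<x+h}. deriv hardy_Z u \<le> 0)"
  shows "norm (window_mean h twisted_deriv x) \<le> 18 * B / h"
proof -
  obtain s where s: "s = 1 \<or> s = -1" "\<And>u. u \<in> {x<..<x+h} \<Longrightarrow> s * deriv hardy_Z u \<ge> 0"
    using sgn by (metis mult_1 mult_minus_left neg_0_le_iff_le)
  \<comment> \<open>The sign is known on the open interval only; continuity extends it to the
    endpoints of the window.\<close>
  have ge0: "s * deriv hardy_Z u \<ge> 0" if "x \<le> u" "u \<le> x + h" for u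
  proof (rule continuous_ge_on_closure[where S = "{x<..<x+h}" and f = "\<lambda>u. s * deriv hardy_Z u"])
    show "u \<in> closure {x<..<x+h}" using h that by (simp add: closure_greaterThanLessThan)
  qed (use s(2) in \<open>auto intro!: continuous_intros continuous_on_deriv_hardy_Z\<close>)
  have int: "((\<lambda>u. 9 * (s * deriv hardy_Z (x + u))) has_integral 9 * (s * hardy_Z (x + h)) - 9 * (s * hardy_Z (x + 0))) {0..h}"
  proof (rule fundamental_theorem_of_calculus)
    fix u
    have "((\<lambda>u. 9 * (s * hardy_Z (x + u))) has_real_derivative 9 * (s * (deriv hardy_Z (x + u) * (0 + 1)))) (at u within {0..h})"
      by (intro DERIV_cmult DERIV_chain2[OF has_real_derivative_hardy_Z] DERIV_add DERIV_const DERIV_ident)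
    thus "((\<lambda>u. 9 * (s * hardy_Z (x + u))) has_vector_derivative 9 * (s * deriv hardy_Z (x + u))) (at u within {0..h})"
      by (simp add: has_real_derivative_iff_has_vector_derivative)
  qed (use h in auto)
  have "norm (integral {0..h} (\<lambda>u. twisted_deriv (x + u))) \<le> integral {0..h} (\<lambda>u. 9 * (s * deriv hardy_Z (x + u)))"
  proof (rule integral_norm_bound_integral)
    show "(\<lambda>u. twisted_deriv (x + u)) integrable_on {0..h}"
      by (rule integrable_window) (rule continuous_on_twisted_deriv)
    fix u assume "u \<in> {0..h}"
    hence "\<bar>deriv hardy_Z (x + u)\<bar> = s * deriv hardy_Z (x + u)"
      using ge0[of "x + u"] s(1) by (auto simp: abs_if)
    thus "norm (twisted_deriv (x + u)) \<le> 9 * (s * deriv hardy_Z (x + u))"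
      using norm_twisted_deriv_le[of "x + u"] by simp
  qed (use int in blast)
  also have "\<dots> = 9 * (s * hardy_Z (x + h)) - 9 * (s * hardy_Z x)" using integral_unique[OF int] by simp
  also have "\<dots> \<le> 18 * B" using B s(1) by auto
  finally show ?thesis using h by (simp add: window_mean_def norm_divide divide_right_mono)
qed

text \<open>The k-fold means of f and g at T are compared. The innermost mean supplies the estimates
  that use monotonicity and the difference quotient; the remaining k - 1 means preserve these
  bounds. All k of them serve to damp the waves of g.\<close>

lemma abs_rs_theta'_le_if_constant_sign:
  assumes T: "T \<ge> 4" and h: "h \<ge> 1" and k: "k \<ge> 1" "real k * h \<le> T"
    and B: "\<And>u. T \<le> u \<Longrightarrow> u \<le> 2 * T \<Longrightarrow> \<bar>hardy_Z u\<bar> \<le> B"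
    and sgn: "(\<forall>u\<in>{T<..<T + real k * h}. deriv hardy_Z u \<ge> 0) \<or> (\<forall>u\<in>{T<..<T + real k * h}. deriv hardy_Z u \<le> 0)"
    and damp: "(4 / h) ^ k \<le> 1 / T ^ 9"
  shows "\<bar>rs_theta' T\<bar> \<le> 18 * B / h + (70 + 24 * \<bar>rs_theta' T\<bar>) / T + 9 * ((real k * h + 16) / T * B)"
proof -
  define \<tau> where "\<tau> = rs_theta' T"
  \<comment> \<open>The tail of \<open>eta\<close> after T^4 terms is at most 6 T times
    T^(-2).\<close>
  define M where "M = nat \<lceil>T ^ 4\<rceil>"
  have T4: "T ^ 4 \<ge> 1" using T by simp
  have M: "T ^ 4 \<le> real M" "real M \<le> 2 * T ^ 4" "M > 0"
    unfolding M_def using T4 by linarith+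
  define \<delta> where "\<delta> = (real k * h + 16) / T * B"
  define f where "f = twisted_deriv"
  define g where "g = twisted_partial M \<tau>"
  define m where "m = k - 1"
  have km: "k = Suc m" using k by (simp add: m_def)
  have cf: "continuous_on UNIV f" and cg: "continuous_on UNIV g"
    unfolding f_def g_def by (rule continuous_on_twisted_deriv continuous_on_twisted_partial)+
  have B0: "B \<ge> 0" using B[of T] T by simp
  have tail: "norm (eta (Complex (1/2) u) - eta_partial M u) \<le> 6 / T" if u: "T \<le> u" "u \<le> 2 * T" for u
  proof -
    have ns: "norm (Complex (1/2) u) \<le> 1/2 + 2 * T"
      using cmod_le[of "Complex (1/2) u"] u T by simp
    have "norm (eta (Complex (1/2) u) - eta_partial M u) \<le> (1 + norm (Complex (1/2) u) / Re (Complex (1/2) u)) * real (Suc M) powr (- Re (Complex (1/2) u))"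
      unfolding eta_partial_def by (rule norm_eta_diff_le) simp
    also have "\<dots> \<le> (6 * T) * (T ^ 4) powr (-1/2)"
    proof (rule mult_mono)
      show "1 + norm (Complex (1/2) u) / Re (Complex (1/2) u) \<le> 6 * T" using ns T by simp
      show "real (Suc M) powr (- Re (Complex (1/2) u)) \<le> (T ^ 4) powr (-1/2)"
        using M T4 T by (simp, intro powr_mono2') auto
    qed (use T in auto)
    also have "(T ^ 4) powr (-1/2) = 1 / T\<^sup>2"
    proof -
      have "(T ^ 4) powr (-1/2) = (T powr 4) powr (-1/2)" using T by simp
      also have "\<dots> = T powr (-2)" by (simp only: powr_powr) simp
      finally show ?thesis using T by (simp add: powr_minus_divide)
    qed
    finally show ?thesis using T by (simp add: power2_eq_square)
  qed
  have ub: "y + h \<le> T + real k * h" if "y \<le> T + real m * h" for y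
    using that by (simp add: km algebra_simps)
  have "norm ((window_mean h ^^ k) f T) \<le> 18 * B / h"
    unfolding km funpow_Suc_right o_apply
  proof (rule norm_window_mean_funpow_le)
    fix y assume y: "T \<le> y" "y \<le> T + real m * h"
    note yh = ub[OF y(2)]
    show "norm (window_mean h f y) \<le> 18 * B / h"
      unfolding f_def by (rule norm_window_mean_twisted_deriv_le) (use h y yh k B sgn in auto)
  qed (use h cf continuous_on_window_mean in auto)
  moreover have "norm ((window_mean h ^^ k) f T - (window_mean h ^^ k) g T) \<le> (54 + 18 * \<bar>\<tau>\<bar>) / T + 9 * \<delta>"
  proof -
    have "norm ((window_mean h ^^ k) (\<lambda>x. f x - g x) T) \<le> (54 + 18 * \<bar>\<tau>\<bar>) / T + 9 * \<delta>"
      unfolding km funpow_Suc_right o_apply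
    proof (rule norm_window_mean_funpow_le)
      fix y assume y: "T \<le> y" "y \<le> T + real m * h"
      note yh = ub[OF y(2)]
      have "norm (window_mean h (\<lambda>x. f x - g x) y) \<le> 6 * (6 / T) / h + 9 * \<delta> + 3 * \<bar>\<tau>\<bar> * (6 / T) + 3 * (6 / T)"
        unfolding f_def g_def
      proof (rule norm_window_mean_twisted_le)
        fix u assume u: "y \<le> u" "u \<le> y + h"
        hence uT: "T \<le> u" "u \<le> 2 * T" "u - T \<le> real k * h" using y yh k by linarith+
        show "norm (eta (Complex (1/2) u) - eta_partial M u) \<le> 6 / T" by (rule tail) (use uT in auto)
        have "\<bar>rs_theta' u - \<tau>\<bar> \<le> (u - T + 16) / T"
          unfolding \<tau>_def by (rule rs_theta'_diff_le) (use T uT in auto)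
        also have "\<dots> \<le> (real k * h + 16) / T" using uT T by (intro divide_right_mono) auto
        finally show "\<bar>rs_theta' u - \<tau>\<bar> * \<bar>hardy_Z u\<bar> \<le> \<delta>"
          unfolding \<delta>_def using B[OF uT(1,2)] by (intro mult_mono) auto
      qed (use h in auto)
      also have "6 * (6 / T) / h \<le> 36 / T"
      proof -
        have "36 / T / h \<le> 36 / T / 1" using h T by (intro divide_left_mono) auto
        thus ?thesis by simp
      qed
      finally show "norm (window_mean h (\<lambda>x. f x - g x) y) \<le> (54 + 18 * \<bar>\<tau>\<bar>) / T + 9 * \<delta>"
        by (simp add: add_divide_distrib)
    qed (use h in \<open>auto intro!: continuous_on_window_mean continuous_on_diff cf cg\<close>)
    thus ?thesis by (simp add: window_mean_funpow_diff[OF cf cg])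
  qed
  moreover have "norm ((window_mean h ^^ k) g T - \<i> * of_real \<tau>) \<le> (16 + 6 * \<bar>\<tau>\<bar>) / T"
  proof -
    have "norm ((window_mean h ^^ k) g T - \<i> * of_real \<tau>) \<le> real M * (3 * \<bar>\<tau>\<bar> + 3 * real M + 2) * (4 / h) ^ k"
      unfolding g_def using h M by (intro norm_window_mean_twisted_partial_le) auto
    \<comment> \<open>The number of terms and the size of the coefficients give T^8 up to a factor
      linear in |\<tau>|; the damping T^(-9) leaves 1 / T.\<close>
    also have "\<dots> \<le> (2 * T ^ 4) * (3 * \<bar>\<tau>\<bar> + 6 * T ^ 4 + 2) * (1 / T ^ 9)"
      using M h T by (intro mult_mono damp) auto
    also have "\<dots> \<le> (2 * T ^ 4) * ((3 * \<bar>\<tau>\<bar> + 8) * T ^ 4) * (1 / T ^ 9)"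
    proof (intro mult_right_mono mult_left_mono)
      have "(3 * \<bar>\<tau>\<bar> + 2) * 1 \<le> (3 * \<bar>\<tau>\<bar> + 2) * T ^ 4" using T4 by (intro mult_left_mono) auto
      thus "3 * \<bar>\<tau>\<bar> + 6 * T ^ 4 + 2 \<le> (3 * \<bar>\<tau>\<bar> + 8) * T ^ 4" by (simp add: algebra_simps)
    qed (use T in auto)
    also have "\<dots> = (16 + 6 * \<bar>\<tau>\<bar>) / T"
      using T by (simp add: field_simps eval_nat_numeral)
    finally show ?thesis .
  qed
  ultimately have "norm (\<i> * complex_of_real \<tau>) \<le> 18 * B / h + ((54 + 18 * \<bar>\<tau>\<bar>) / T + 9 * \<delta>) + (16 + 6 * \<bar>\<tau>\<bar>) / T"
    using norm_triangle_sub[of "\<i> * of_real \<tau>" "(window_mean h ^^ k) g T"]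
      norm_triangle_sub[of "(window_mean h ^^ k) g T" "(window_mean h ^^ k) f T"]
    by (simp add: norm_minus_commute)
  hence "\<bar>\<tau>\<bar> \<le> 18 * B / h + (70 + 24 * \<bar>\<tau>\<bar>) / T + 9 * \<delta>" by (simp add: norm_mult add_divide_distrib)
  thus ?thesis unfolding \<tau>_def \<delta>_def .
qed

theorem mainTheorem1:
  fixes \<Delta> :: real
  assumes "0 < \<Delta>" and "\<Delta> < 1/6"
    and "\<exists>A>0. \<forall>\<^sub>F t in at_top. \<forall>a b :: real.
           0 < a \<and> a \<le> b \<and> b \<le> 2 * a \<and> b \<le> sqrt (t / (2 * pi)) \<longrightarrow>
           norm (\<Sum>n\<in>{n::nat. 0 < n \<and> a \<le> real n \<and> real n < b}.
                   (of_nat n :: complex) powr (\<i> * of_real t))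
             < A * sqrt a * t powr \<Delta>"
  shows "\<forall>\<psi> :: real \<Rightarrow> real. (\<forall>T. 0 < \<psi> T) \<longrightarrow> filterlim \<psi> at_top at_top \<longrightarrow>
           (\<forall>\<^sub>F T in at_top. \<exists>t. T < t \<and> t < T + T powr \<Delta> * \<psi> T \<and>
              odd_order_zero (deriv hardy_Z) t)"
proof (intro allI impI)
  fix \<psi> :: "real \<Rightarrow> real" assume \<psi>: "filterlim \<psi> at_top at_top"
  obtain C t0 where C: "C > 0" "\<And>t. t \<ge> t0 \<Longrightarrow> \<bar>hardy_Z t\<bar> \<le> C * t powr \<Delta> * ln t"
    using hardy_Z_growth[OF assms(1,3)] by blast
  \<comment> \<open>The 4 gives 4 / h \<le> T^(-\<Delta>). As 2^\<Delta> \<le> 2, the number 288 =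
    18 * 2 * 8 pushes the monotonicity bound 18 B / h below ln(2 T) / 8.\<close>
  define c where "c = 4 + 288 * C"
  have c0: "c > 0" using C(1) by (simp add: c_def)
  \<comment> \<open>Chosen so that T^(-\<Delta> k) is at most T^(-9).\<close>
  define k where "k = nat \<lceil>9 / \<Delta>\<rceil>"
  have k: "real k * \<Delta> \<ge> 9" "k \<ge> 1"
  proof -
    have "9 / \<Delta> \<le> real k" unfolding k_def by linarith
    thus "real k * \<Delta> \<ge> 9" using assms(1) by (simp add: field_simps)
    thus "k \<ge> 1" by (cases k) auto
  qed
  define K where "K = real k * c"
  have K0: "K > 0" using k C unfolding K_def c_def by (intro mult_pos_pos) auto
  \<comment> \<open>The argument needs an interval of length K T^\<Delta> for one fixed K; the
    growth of \<psi> provides it.\<close>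
  have "\<forall>\<^sub>F T in at_top. \<psi> T > K" using \<psi> by (simp add: filterlim_at_top_dense)
  moreover have "\<forall>\<^sub>F T in at_top. K * T powr \<Delta> \<le> T"
    using assms(1,2) K0 by real_asymp
  \<comment> \<open>The cost of freezing the derivative of theta is of order T^(2 \<Delta> - 1) ln T
    and tends to 0.\<close>
  moreover have "\<forall>\<^sub>F T in at_top. 9 * ((K * T powr \<Delta> + 16) / T * (C * (2 * T) powr \<Delta> * ln (2 * T))) < 1"
  proof (rule order_tendstoD(2))
    show "((\<lambda>T. 9 * ((K * T powr \<Delta> + 16) / T * (C * (2 * T) powr \<Delta> * ln (2 * T)))) \<longlongrightarrow> 0) at_top"
      using assms(1,2) K0 C(1) by real_asymp
  qed simp
  \<comment> \<open>The decisive comparison is 1/8 against 1/2 as coefficients of ln T; the factor 1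
    - 24 / T comes from moving the term 24 |\<tau>| / T to the other side.\<close>
  moreover have "\<forall>\<^sub>F T::real in at_top. ln (2 * T) / 8 + 70 / T + 1 < (1 - 24 / T) * (ln T / 2 - 4)"
    by real_asymp
  ultimately show "\<forall>\<^sub>F T in at_top. \<exists>t. T < t \<and> t < T + T powr \<Delta> * \<psi> T \<and> odd_order_zero (deriv hardy_Z) t"
    using eventually_ge_at_top[of "max 24 t0"]
  proof eventually_elim
    case (elim T)
    have T: "T \<ge> 24" "T \<ge> t0" using elim(5) by auto
    define h where "h = c * T powr \<Delta>"
    define B where "B = C * (2 * T) powr \<Delta> * ln (2 * T)"
    have Tp: "T powr \<Delta> \<ge> 1" using T assms(1) by (intro ge_one_powr_ge_zero) auto
    have h4: "h \<ge> 4 * T powr \<Delta>" unfolding h_def c_def using C by (intro mult_right_mono) auto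
    have kh: "real k * h = K * T powr \<Delta>" by (simp add: h_def K_def)
    show ?case
    proof (rule ccontr)
      assume no: "\<not> ?case"
      have "T powr \<Delta> * K < T powr \<Delta> * \<psi> T" using elim(1) Tp by (intro mult_strict_left_mono) auto
      hence "\<not> odd_order_zero (deriv hardy_Z) x" if "T < x" "x < T + real k * h" for x
        using no that kh by (force simp: mult.commute)
      hence sgn: "(\<forall>u\<in>{T<..<T + real k * h}. deriv hardy_Z u \<ge> 0) \<or> (\<forall>u\<in>{T<..<T + real k * h}. deriv hardy_Z u \<le> 0)"
        by (rule hardy_Z_monotone_if_no_odd_order_zero)
      have "\<bar>rs_theta' T\<bar> \<le> 18 * B / h + (70 + 24 * \<bar>rs_theta' T\<bar>) / T + 9 * ((real k * h + 16) / T * B)"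
      proof (rule abs_rs_theta'_le_if_constant_sign[OF _ _ k(2) _ _ sgn])
        show "T \<ge> 4" "h \<ge> 1" "real k * h \<le> T" using T h4 Tp kh elim(2) by linarith+
        fix u assume u: "T \<le> u" "u \<le> 2 * T"
        have "\<bar>hardy_Z u\<bar> \<le> C * u powr \<Delta> * ln u" using C u T by auto
        also have "\<dots> \<le> B" unfolding B_def
          using u T C assms(1) by (intro mult_mono powr_mono2 mult_nonneg_nonneg) auto
        finally show "\<bar>hardy_Z u\<bar> \<le> B" .
      next
        have "4 / h \<le> 4 / (4 * T powr \<Delta>)"
          using h4 Tp by (intro divide_left_mono mult_pos_pos) auto
        hence "4 / h \<le> T powr (-\<Delta>)" by (simp add: powr_minus_divide)
        hence "(4 / h) ^ k \<le> (T powr (-\<Delta>)) ^ k"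
          using h4 Tp by (intro power_mono) auto
        also have "\<dots> = T powr (- (real k * \<Delta>))"
          using T by (simp add: powr_realpow[symmetric] powr_powr mult.commute)
        also have "\<dots> \<le> T powr (-9)" using k T by (intro powr_mono) auto
        also have "\<dots> = 1 / T ^ 9" using T by (simp add: powr_minus_divide)
        finally show "(4 / h) ^ k \<le> 1 / T ^ 9" .
      qed
      moreover have "18 * B / h \<le> ln (2 * T) / 8"
      proof -
        have "2 powr \<Delta> \<le> 2 powr (1::real)" using assms by (intro powr_mono) auto
        hence "18 * C * 2 powr \<Delta> \<le> 18 * C * 2" using C by (intro mult_left_mono) auto
        hence "18 * C * 2 powr \<Delta> * 8 \<le> c" unfolding c_def using C(1) by linarith
        hence "18 * C * 2 powr \<Delta> / c \<le> 1 / 8" using c0 by (simp add: pos_divide_le_eq)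
        hence "18 * C * 2 powr \<Delta> / c * ln (2 * T) \<le> 1 / 8 * ln (2 * T)" using T by (intro mult_right_mono) auto
        also have "18 * C * 2 powr \<Delta> / c * ln (2 * T) = 18 * B / h"
          using T c0 by (simp add: B_def h_def powr_mult)
        finally show ?thesis by simp
      qed
      moreover have "9 * ((real k * h + 16) / T * B) < 1" using elim(3) by (simp add: kh B_def)
      ultimately have "\<bar>rs_theta' T\<bar> < ln (2 * T) / 8 + (70 + 24 * \<bar>rs_theta' T\<bar>) / T + 1" by linarith
      hence "\<bar>rs_theta' T\<bar> * (1 - 24 / T) < ln (2 * T) / 8 + 70 / T + 1"
        by (simp add: algebra_simps add_divide_distrib)
      moreover have "(1 - 24 / T) * (ln T / 2 - 4) \<le> (1 - 24 / T) * \<bar>rs_theta' T\<bar>"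
        using rs_theta'_ge[of T] T by (intro mult_left_mono) auto
      ultimately show False using elim(4) by (simp add: mult.commute)
    qed
  qed
qed

end
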